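(* Let $\alpha,\beta\in\mathbf C$, and set $$\lambda_{\alpha,\beta}=\begin{cases}(1+\alpha)\Lambda_0-\alpha\Lambda_1+(2\beta+2\alpha)\Lambda_2,&\alpha\notin\mathbf Z,\\(1+\alpha)\Lambda_0-\alpha\Lambda_1+(2\beta+2\alpha)\Lambda_2,&\alpha=0,1,2,3,\dots,\\(1+\alpha)\Lambda_0-\alpha\Lambda_1+(2\beta+2\alpha+2)\Lambda_2,&\alpha=-1,-2,-3,\dots\end{cases}$$ Denote by $\overline V(\lambda_{\alpha,\beta})$ the highest weight $U_q[\widehat{gl(1|1)}]$-modules with the highest weights $\lambda_{\alpha,\beta}$. Then the following identifications of highest weight $U_q[\widehat{gl(1|1)}]$-modules hold: $$\overline V(\lambda_{\alpha,\beta})\cong Ker_{\mathcal F_{(\alpha;\beta+\frac32\alpha)}}\equiv Coker_{\mathcal F_{(\alpha;\beta+\frac32\alpha+1)}}\quad\text{for }\alpha\in\mathbf Z,$$ $$\overline V(\lambda_{\alpha,\beta})\cong\mathcal F_{(\alpha;\beta+\frac32\alpha)}\quad\text{for }\alpha\notin\mathbf Z;$$ and when $\alpha\in\mathbf Z$ each Fock space $\mathcal F_{(\alpha;\beta+\frac32\alpha)}$ can be decomposed explicitly into a direct sum of the highest weight $U_q[\widehat{gl(1|1)}]$-modules: $$\mathcal F_{(\alpha;\beta+\frac32\alpha)}=\overline V(\lambda_{\alpha,\beta})\oplus\overline V(\lambda_{\alpha,\beta-1})\quad\text{for }\alpha\in\mathbf Z.$$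
   Context: $[n]_q=\frac{q^n-q^{-n}}{q-q^{-1}}$, where $q$ is the deformation parameter. Algebra. $U_q[\widehat{gl(1|1)}]$ is the quantum affine superalgebra with Chevalley generators $e_i,f_i$ ($i=0,1$, odd), $q^{h_j}$ ($j=0,1,2$) and $d$ (even); here the Cartan subalgebra is extended by an element $h_2$ corresponding to $\alpha_2=\varepsilon_1+\varepsilon_2$, in addition to the simple roots $\alpha_1=\varepsilon_1-\varepsilon_2$, $\alpha_0=\delta-\varepsilon_1+\varepsilon_2$, with $(\varepsilon_k,\varepsilon_{k'})=(-1)^{k+1}\delta_{kk'}$, $(\delta,\delta)=(\delta,\varepsilon_k)=0$. In terms of Drinfeld generators $X^\pm_m$ (odd), $H^j_n$ ($j=1,2$), central $c$, and $d$: $h_1=H^1_0$, $h_2=H^2_0$, $h_0=c-H^1_0$, $e_1=X^+_0$, $f_1=X^-_0$, $e_0=X^-_1q^{-H^1_0}$, $f_0=-q^{H^1_0}X^+_{-1}$. $\{\Lambda_0,\Lambda_1,\Lambda_2,\delta\}$ is the basis dual to $\{h_0,h_1,h_2,d\}$. A highest weight vector of weight $(\lambda^0,\lambda^1,\lambda^2)$, i.e. $\lambda^0\Lambda_0+\lambda^1\Lambda_1+\lambda^2\Lambda_2$, is a vector $v\neq0$ with $e_0v=e_1v=0$ and $h_jv=\lambda^jv$ for $j=0,1,2$ (the $\delta$-component of weights is not recorded). A highest weight module is, as usual, one generated by a highest weight vector. Bosons. $a^j_n,c_n,Q_{a^j},Q_c$ ($n\in\mathbf Z$, $j=1,2$)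 satisfy $[a^i_n,a^j_m]=(-1)^{i+1}\delta_{ij}\delta_{m+n,0}\frac{[n]_q^2}{n}$ and $[c_n,c_m]=\delta_{n+m,0}\frac{[n]_q^2}{n}$ (for $n,m\ne0$), $[a^i_0,Q_{a^j}]=\delta_{ij}$, $[c_0,Q_c]=1$, all other commutators zero. Put $A^1_n=a^1_n+a^2_n$, $A^2_n=\frac{q^n+q^{-n}}2(a^1_n-a^2_n)$, $Q_{A^1}=Q_{a^1}-Q_{a^2}$, and $H^1(z;\kappa)=Q_{A^1}+A^1_0\ln z-\sum_{n\ne0}\frac{A^1_n}{[n]_q}q^{\kappa|n|}z^{-n}$, $\ c(z)=Q_c+c_0\ln z-\sum_{n\ne0}\frac{c_n}{[n]_q}z^{-n}$. Normal ordering $:\ :$ puts modes with $n>0$ to the right of modes with $n<0$, and $Q$'s to the left of zero modes; $\partial_zf(z)=\frac{f(qz)-f(q^{-1}z)}{(q-q^{-1})z}$. Fock modules. With $a^i_m|0\rangle=c_m|0\rangle=0$ for $m\ge0$ and $|\lambda_1,\lambda_2;\lambda_3\rangle=e^{\lambda_1Q_{a^1}+\lambda_2Q_{a^2}+\lambda_3Q_c}|0\rangle$, let $F_{\lambda_1,\lambda_2;\lambda_3}=\mathbf C[a^1_{-n},a^2_{-n},c_{-n}\,(n\ge1)]\,|\lambda_1,\lambda_2;\lambda_3\rangle$ and $\mathcal F_{(\alpha;\beta)}=\bigoplus_{i\in\mathbf Z}F_{\beta-\alpha+i,-\beta-i;\alpha+i}$. $U_q[\widehat{gl(1|1)}]$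 acts on $\mathcal F_{(\alpha;\beta)}$ at level one by: the central element is $1$, $H^j_n=A^j_n$, and $X^\pm(z)=\sum_nX^\pm_nz^{-n-1}$ with $X^+(z)=:e^{H^1(z;-1/2)}e^{c(z)}:$, $X^-(z)=:e^{-H^1(z;1/2)}\partial_z\{e^{-c(z)}\}:$, and $d=-\sum_{m\ge1}\frac{m^2}{[m]_q[2m]_q}\{A^1_{-m}A^2_m+A^2_{-m}A^1_m+\frac{[2m]_q}{[m]_q}c_{-m}c_m\}-\frac12\{A^1_0A^2_0+c_0(c_0+1)\}$. Kernel and cokernel. Let $\eta(z)=\sum_n\eta_nz^{-n-1}=:e^{c(z)}:$ and $\xi(z)=\sum_n\xi_nz^{-n}=:e^{-c(z)}:$. When $\alpha\in\mathbf Z$ the mode $\eta_0$ maps $\mathcal F_{(\alpha;\beta)}$ to $\bigoplus_iF_{\beta-\alpha+i,-\beta-i;\alpha+i+1}$ $(=\mathcal F_{(\alpha;\beta-1)})$ and $\xi_0$ maps in the opposite direction; $\eta_0^2=\xi_0^2=0$, $\eta_0\xi_0+\xi_0\eta_0=1$, so that $\mathcal F_{(\alpha;\beta)}=\eta_0\xi_0\mathcal F_{(\alpha;\beta)}\oplus\xi_0\eta_0\mathcal F_{(\alpha;\beta)}$. Set $Ker_{\mathcal F_{(\alpha;\beta)}}=\eta_0\xi_0\mathcal F_{(\alpha;\beta)}$ and $Coker_{\mathcal F_{(\alpha;\beta)}}=\xi_0\eta_0\mathcal F_{(\alpha;\beta)}=\mathcal F_{(\alpha;\beta)}/\eta_0\xi_0\mathcal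 F_{(\alpha;\beta)}$. Since $\eta_0$ commutes (anticommutes) with even (odd) generators, both are $U_q[\widehat{gl(1|1)}]$-modules.
   Formalization: q is a nonzero complex number, not a root of unity; for α∉Z also [α+n]_q≠0 for all integers n is assumed. The sum F=V⊕V is one of vector spaces, with Ker a submodule and Coker carrying the quotient action, since Ker need not have an invariant complement. *)

theory Defs
  imports
    Complex_Main
    "HOL-Library.Multiset"
    "HOL-Library.Poly_Mapping"
begin

section \<open>The deformation parameter\<close>

text \<open>
  Zero modes have arbitrary complex eigenvalues, so complex powers of q are needed. We fix a
  logarithm hb of q, i.e. q = exp hb; then \<open>qpow hb x\<close> is the x-th power of q and
  \<open>qint hb x\<close> is the q-number of x.
\<close>

definition qpow :: "complex \<Rightarrow> complex \<Rightarrow> complex" where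
  "qpow hb x = exp (hb * x)"

definition qint :: "complex \<Rightarrow> complex \<Rightarrow> complex" where
  "qint hb x = (qpow hb x - qpow hb (- x)) / (qpow hb 1 - qpow hb (- 1))"

section \<open>The Fock space of three bosons\<close>

datatype boson = Ba1 | Ba2 | Bc

text \<open>
  A weight is a triple \<open>(\<lambda>\<^sub>1, \<lambda>\<^sub>2, \<lambda>\<^sub>3)\<close>; a pair (s, n) in a multiset stands for the creation
  mode of s with index -n; a basis element is a monomial in creation modes applied to the vacuum
  vector of the given weight. The type \<open>fock\<close> collects the Fock modules of all weights;
  that only indices \<open>n \<ge> 1\<close> occur is imposed in \<open>fock_sum\<close> below.
\<close>

type_synonym weight = "complex \<times> complex \<times> complex"
type_synonym basis = "weight \<times> (boson \<times> nat) multiset"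
type_synonym fock = "basis \<Rightarrow>\<^sub>0 complex"

definition scaleF :: "complex \<Rightarrow> fock \<Rightarrow> fock" where
  "scaleF c v = Poly_Mapping.map ((*) c) v"

lemma lookup_scaleF: "Poly_Mapping.lookup (scaleF c v) b = c * Poly_Mapping.lookup v b"
  by (simp add: scaleF_def map.rep_eq when_def)

global_interpretation fock: vector_space scaleF
  by unfold_locales (auto intro!: poly_mapping_eqI simp: lookup_scaleF lookup_add algebra_simps)

definition bvec :: "basis \<Rightarrow> fock" where
  "bvec b = Poly_Mapping.single b 1"

definition lin :: "(basis \<Rightarrow> fock) \<Rightarrow> fock \<Rightarrow> fock" where
  "lin f v = (\<Sum>b\<in>Poly_Mapping.keys v. scaleF (Poly_Mapping.lookup v b) (f b))"

fun boson_sign :: "boson \<Rightarrow> complex" where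
  "boson_sign Ba1 = 1"
| "boson_sign Ba2 = -1"
| "boson_sign Bc = 1"

fun zero_mode :: "boson \<Rightarrow> weight \<Rightarrow> complex" where
  "zero_mode Ba1 (l1, l2, l3) = l1"
| "zero_mode Ba2 (l1, l2, l3) = l2"
| "zero_mode Bc (l1, l2, l3) = l3"

text \<open>Annihilation modes act as the derivations dictated by
  \<open>[s\<^sub>n, s\<^sub>-\<^sub>n] = \<plusminus>[n]\<^sub>q\<^sup>2 / n\<close>, whence the multiplicity factor.\<close>

definition osc :: "complex \<Rightarrow> boson \<Rightarrow> int \<Rightarrow> fock \<Rightarrow> fock" where
  "osc hb s n = lin (\<lambda>(w, m).
     if n < 0 then bvec (w, add_mset (s, nat (- n)) m)
     else if n > 0 then
       scaleF (boson_sign s * (qint hb (of_int n))\<^sup>2 / of_int n * of_nat (count m (s, nat n)))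
         (bvec (w, m - {#(s, nat n)#}))
     else scaleF (zero_mode s w) (bvec (w, m)))"

definition A1 :: "complex \<Rightarrow> int \<Rightarrow> fock \<Rightarrow> fock" where
  "A1 hb n v = osc hb Ba1 n v + osc hb Ba2 n v"

definition A2 :: "complex \<Rightarrow> int \<Rightarrow> fock \<Rightarrow> fock" where
  "A2 hb n v = scaleF ((qpow hb (of_int n) + qpow hb (- of_int n)) / 2)
     (osc hb Ba1 n v - osc hb Ba2 n v)"

section \<open>Vertex operators\<close>

text \<open>
  For a formal series \<open>B(x) = \<Sum>\<^sub>n\<^sub>\<ge>\<^sub>1 (G n) x\<^sup>n\<close> with operator coefficients, \<open>pow_coeff G r k\<close> is the
  coefficient of \<open>x\<^sup>k\<close> in the r-th power of B and \<open>exp_coeff G k\<close> that in exp B. As B has no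
  constant term, only \<open>r \<le> k\<close> contributes.
\<close>

primrec pow_coeff :: "(nat \<Rightarrow> fock \<Rightarrow> fock) \<Rightarrow> nat \<Rightarrow> nat \<Rightarrow> fock \<Rightarrow> fock" where
  "pow_coeff G 0 k v = (if k = 0 then v else 0)"
| "pow_coeff G (Suc r) k v = (\<Sum>n=1..k. G n (pow_coeff G r (k - n) v))"

definition exp_coeff :: "(nat \<Rightarrow> fock \<Rightarrow> fock) \<Rightarrow> nat \<Rightarrow> fock \<Rightarrow> fock" where
  "exp_coeff G k v = (\<Sum>r\<le>k. scaleF (1 / fact r) (pow_coeff G r k v))"

text \<open>
  We use the normally ordered exponential of
  \<open>\<sigma> H\<^sup>1(z; \<kappa>) + \<tau> c(q\<^sup>s z)\<close>. The operator \<open>vop_osc hb \<sigma> \<kappa> \<tau> s n\<close> (n nonzero) is the coefficient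
  of \<open>z\<^sup>-\<^sup>n\<close> in this exponent. On the Fock module of weight \<open>(l1, l2, l3)\<close> the zero modes contribute
  \<open>z powr (\<sigma> (l1 + l2) + \<tau> l3)\<close> times the power of q with exponent \<open>s \<tau> l3\<close>, and the Q's
  translate the weight. \<open>vop hb \<sigma> \<kappa> \<tau> s p\<close> is the coefficient of \<open>z\<close> to the (complex) power p;
  the index pair (k, l) records the powers of z and 1/z coming from the creation and the
  annihilation part, and only finitely many pairs contribute on a given basis vector.
\<close>

definition vop_osc ::
  "complex \<Rightarrow> complex \<Rightarrow> complex \<Rightarrow> complex \<Rightarrow> complex \<Rightarrow> int \<Rightarrow> fock \<Rightarrow> fock" where
  "vop_osc hb \<sigma> \<kappa> \<tau> s n v =
     - scaleF (\<sigma> * qpow hb (\<kappa> * of_int \<bar>n\<bar>) / qint hb (of_int n)) (A1 hb n v)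
     - scaleF (\<tau> * qpow hb (- s * of_int n) / qint hb (of_int n)) (osc hb Bc n v)"

definition shift :: "complex \<Rightarrow> complex \<Rightarrow> fock \<Rightarrow> fock" where
  "shift \<sigma> \<tau> = lin (\<lambda>((l1, l2, l3), m). bvec ((l1 + \<sigma>, l2 - \<sigma>, l3 + \<tau>), m))"

definition vop ::
  "complex \<Rightarrow> complex \<Rightarrow> complex \<Rightarrow> complex \<Rightarrow> complex \<Rightarrow> complex \<Rightarrow> fock \<Rightarrow> fock" where
  "vop hb \<sigma> \<kappa> \<tau> s p = lin (\<lambda>((l1, l2, l3), m).
     scaleF (qpow hb (s * \<tau> * l3)) (shift \<sigma> \<tau>
       (Sum_any (\<lambda>(k, l).
          if \<sigma> * (l1 + l2) + \<tau> * l3 + of_nat k - of_nat l = p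
          then exp_coeff (\<lambda>n. vop_osc hb \<sigma> \<kappa> \<tau> s (- int n)) k
                 (exp_coeff (\<lambda>n. vop_osc hb \<sigma> \<kappa> \<tau> s (int n)) l (bvec ((l1, l2, l3), m)))
          else 0))))"

definition X_plus :: "complex \<Rightarrow> int \<Rightarrow> fock \<Rightarrow> fock" where
  "X_plus hb n = vop hb 1 (- 1 / 2) 1 0 (- of_int n - 1)"

text \<open>The q-derivative contributes a factor 1/z, so the mode n is the coefficient of \<open>z\<^sup>-\<^sup>n\<close> in the
  difference of the two exponentials.\<close>

definition X_minus :: "complex \<Rightarrow> int \<Rightarrow> fock \<Rightarrow> fock" where
  "X_minus hb n v = scaleF (1 / (qpow hb 1 - qpow hb (- 1)))
     (vop hb (- 1) (1 / 2) (- 1) 1 (- of_int n) v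
      - vop hb (- 1) (1 / 2) (- 1) (- 1) (- of_int n) v)"

definition eta :: "complex \<Rightarrow> int \<Rightarrow> fock \<Rightarrow> fock" where
  "eta hb n = vop hb 0 0 1 0 (- of_int n - 1)"

definition xi :: "complex \<Rightarrow> int \<Rightarrow> fock \<Rightarrow> fock" where
  "xi hb n = vop hb 0 0 (- 1) 0 (- of_int n)"

definition deg_op :: "complex \<Rightarrow> fock \<Rightarrow> fock" where
  "deg_op hb v =
     - Sum_any (\<lambda>m::nat. if m = 0 then 0 else
         scaleF ((of_nat m)\<^sup>2 / (qint hb (of_nat m) * qint hb (2 * of_nat m)))
           (A1 hb (- int m) (A2 hb (int m) v) + A2 hb (- int m) (A1 hb (int m) v)
            + scaleF (qint hb (2 * of_nat m) / qint hb (of_nat m))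
                (osc hb Bc (- int m) (osc hb Bc (int m) v))))
     - scaleF (1 / 2)
         (A1 hb 0 (A2 hb 0 v) + osc hb Bc 0 (osc hb Bc 0 v + v))"

section \<open>Modules over the quantum affine superalgebra\<close>

text \<open>
  The generators: Drinfeld generators \<open>X\<^sup>\<plusminus>\<^sub>m\<close>, \<open>H\<^sup>j\<^sub>n\<close>, the central element, d, and
  the powers of q with exponents \<open>h\<^sub>j\<close> (\<open>Kp j\<close>) and \<open>-h\<^sub>j\<close> (\<open>Km j\<close>), j = 0, 1, 2. Submodules,
  generation and isomorphism depend on the action of the generators only, so a module is recorded
  as a carrier with an action of the generators.
\<close>

datatype cartan = C0 | C1 | C2

datatype gen = Xp int | Xm int | H1 int | H2 int | Cent | D | Kp cartan | Km cartan

fun cartan_eigenvalue :: "cartan \<Rightarrow> weight \<Rightarrow> complex" where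
  "cartan_eigenvalue C0 (l1, l2, l3) = 1 - (l1 + l2)"
| "cartan_eigenvalue C1 (l1, l2, l3) = l1 + l2"
| "cartan_eigenvalue C2 (l1, l2, l3) = l1 - l2"

fun fock_act :: "complex \<Rightarrow> gen \<Rightarrow> fock \<Rightarrow> fock" where
  "fock_act hb (Xp n) = X_plus hb n"
| "fock_act hb (Xm n) = X_minus hb n"
| "fock_act hb (H1 n) = A1 hb n"
| "fock_act hb (H2 n) = A2 hb n"
| "fock_act hb Cent = (\<lambda>v. v)"
| "fock_act hb D = deg_op hb"
| "fock_act hb (Kp j) = lin (\<lambda>(w, m). scaleF (qpow hb (cartan_eigenvalue j w)) (bvec (w, m)))"
| "fock_act hb (Km j) = lin (\<lambda>(w, m). scaleF (qpow hb (- cartan_eigenvalue j w)) (bvec (w, m)))"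

record umod =
  car :: "fock set"
  act :: "gen \<Rightarrow> fock \<Rightarrow> fock"

definition linear_on :: "fock set \<Rightarrow> (fock \<Rightarrow> fock) \<Rightarrow> bool" where
  "linear_on S f \<longleftrightarrow> (\<forall>v\<in>S. \<forall>w\<in>S. f (v + w) = f v + f w) \<and> (\<forall>c. \<forall>v\<in>S. f (scaleF c v) = scaleF c (f v))"

definition umodule :: "umod \<Rightarrow> bool" where
  "umodule M \<longleftrightarrow> fock.subspace (car M) \<and>
     (\<forall>x. linear_on (car M) (act M x) \<and> act M x ` car M \<subseteq> car M)"

definition submodule :: "umod \<Rightarrow> fock set \<Rightarrow> bool" where
  "submodule M S \<longleftrightarrow> S \<subseteq> car M \<and> fock.subspace S \<and> (\<forall>x. act M x ` S \<subseteq> S)"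

definition module_iso :: "umod \<Rightarrow> umod \<Rightarrow> bool" (infix "\<cong>\<^sub>U" 50) where
  "M \<cong>\<^sub>U N \<longleftrightarrow> (\<exists>\<Phi>. linear_on (car M) \<Phi> \<and> bij_betw \<Phi> (car M) (car N) \<and>
     (\<forall>x. \<forall>v\<in>car M. \<Phi> (act M x v) = act N x (\<Phi> v)))"

text \<open>The conditions on v are, in this order, \<open>e\<^sub>1 v = 0\<close> with \<open>e\<^sub>1 = X\<^sup>+\<^sub>0\<close>;
  \<open>e\<^sub>0 v = 0\<close> with \<open>e\<^sub>0\<close> the product of \<open>X\<^sup>-\<^sub>1\<close> and the power of q with exponent \<open>-H\<^sup>1\<^sub>0\<close>; and
  the weight conditions for \<open>h\<^sub>0 = c - H\<^sup>1\<^sub>0\<close>, \<open>h\<^sub>1 = H\<^sup>1\<^sub>0\<close>, \<open>h\<^sub>2 = H\<^sup>2\<^sub>0\<close>.\<close>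

fun hw_vector :: "umod \<Rightarrow> complex \<times> complex \<times> complex \<Rightarrow> fock \<Rightarrow> bool" where
  "hw_vector M (lam0, lam1, lam2) v \<longleftrightarrow> v \<in> car M \<and> v \<noteq> 0 \<and>
     act M (Xp 0) v = 0 \<and> act M (Xm 1) (act M (Km C1) v) = 0 \<and>
     act M Cent v - act M (H1 0) v = scaleF lam0 v \<and>
     act M (H1 0) v = scaleF lam1 v \<and>
     act M (H2 0) v = scaleF lam2 v"

definition highest_weight_module :: "umod \<Rightarrow> complex \<times> complex \<times> complex \<Rightarrow> bool" where
  "highest_weight_module M lam \<longleftrightarrow> umodule M \<and>
     (\<exists>v. hw_vector M lam v \<and> (\<forall>S. submodule M S \<and> v \<in> S \<longrightarrow> S = car M))"

section \<open>The modules in question\<close>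

definition fock_sum :: "complex \<Rightarrow> complex \<Rightarrow> fock set" where
  "fock_sum \<alpha> \<beta> = {v. \<forall>(w, m)\<in>Poly_Mapping.keys v.
     (\<exists>i::int. w = (\<beta> - \<alpha> + of_int i, - \<beta> - of_int i, \<alpha> + of_int i)) \<and>
     (\<forall>(s, n)\<in>#m. n \<ge> 1)}"

definition FockM :: "complex \<Rightarrow> complex \<Rightarrow> complex \<Rightarrow> umod" where
  "FockM hb \<alpha> \<beta> = \<lparr>car = fock_sum \<alpha> \<beta>, act = fock_act hb\<rparr>"

definition KerM :: "complex \<Rightarrow> complex \<Rightarrow> complex \<Rightarrow> umod" where
  "KerM hb \<alpha> \<beta> = \<lparr>car = (\<lambda>v. eta hb 0 (xi hb 0 v)) ` fock_sum \<alpha> \<beta>, act = fock_act hb\<rparr>"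

text \<open>
  The cokernel is the quotient of the Fock space by the submodule \<open>\<eta>\<^sub>0\<xi>\<^sub>0\<F>\<close>, identified as a
  vector space with \<open>\<xi>\<^sub>0\<eta>\<^sub>0\<F>\<close>; its action is that of the quotient, i.e. the Fock action followed
  by the projection \<open>\<xi>\<^sub>0\<eta>\<^sub>0\<close> along \<open>\<eta>\<^sub>0\<xi>\<^sub>0\<F>\<close>. The projection cannot be dropped: \<open>\<xi>\<^sub>0\<close> does not
  anticommute with \<open>X\<^sup>+\<close>, and the subspace \<open>\<xi>\<^sub>0\<eta>\<^sub>0\<F>\<close> is not stable under the modes of \<open>X\<^sup>+\<close>.
\<close>

definition CokerM :: "complex \<Rightarrow> complex \<Rightarrow> complex \<Rightarrow> umod" where
  "CokerM hb \<alpha> \<beta> = \<lparr>car = (\<lambda>v. xi hb 0 (eta hb 0 v)) ` fock_sum \<alpha> \<beta>,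
     act = (\<lambda>x v. xi hb 0 (eta hb 0 (fock_act hb x v)))\<rparr>"

text \<open>
  M is the direct sum of the carriers of K and C, where K is a submodule with the
  restricted action and the action on C is the one induced by M modulo K, so that the projection
  onto C along K identifies the quotient of M by K with C.
\<close>

definition decomposes :: "umod \<Rightarrow> umod \<Rightarrow> umod \<Rightarrow> bool" where
  "decomposes M K C \<longleftrightarrow> umodule M \<and>
     submodule M (car K) \<and> (\<forall>x. \<forall>v\<in>car K. act K x v = act M x v) \<and>
     umodule C \<and> car K \<inter> car C = {0} \<and> car M = {k + c | k c. k \<in> car K \<and> c \<in> car C} \<and>
     (\<forall>x. \<forall>c\<in>car C. act M x c - act C x c \<in> car K)"

definition lam_weight :: "complex \<Rightarrow> complex \<Rightarrow> complex \<times> complex \<times> complex" where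
  "lam_weight \<alpha> \<beta> = (1 + \<alpha>, - \<alpha>,
     if \<alpha> \<in> \<int> \<and> \<alpha> \<notin> \<nat> then 2 * \<beta> + 2 * \<alpha> + 2 else 2 * \<beta> + 2 * \<alpha>)"

end

theory Submission
  imports Defs "HOL-Library.Product_Plus" "HOL-Computational_Algebra.Formal_Power_Series"
begin

text \<open>
  On a Fock module the currents factor as a vertex operator in the a-bosons times a fermion:
  \<open>X\<^sup>+\<close> involves \<open>\<eta>\<close>, and \<open>X\<^sup>-\<close> the q-derivative of \<open>\<xi>\<close>. On vectors free of a-bosons
  this factor is triangular, with diagonal 1 and entries in the modes of \<open>H\<^sup>1\<close>, so a
  submodule is stable under the bare modes \<open>\<eta>\<^sub>p\<close> and \<open>[p]\<^sub>q \<xi>\<^sub>p\<close>. By Newton's identity the fermion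
  modes generate the c-bosons, and \<open>H\<^sup>1\<close>, \<open>H\<^sup>2\<close> generate the a-bosons. For nonintegral \<open>\<alpha>\<close> no
  \<open>[p]\<^sub>q\<close> vanishes and one vacuum generates everything. For integral \<open>\<alpha>\<close> only \<open>\<xi>\<^sub>0\<close> is missing:
  if U is what the other modes generate inside the kernel of \<open>\<eta>\<^sub>0\<close>, then \<open>U + \<xi>\<^sub>0 U\<close> is stable
  under all fermion modes, hence is everything, and \<open>\<eta>\<^sub>0 \<xi>\<^sub>0 = 1\<close> on U shows that U is the kernel.

  To compute, the Fock space is regarded as a commutative group algebra: creation modes and
  the shifts by Q act as multiplications, and a vertex operator is determined by its values on the
  vacua and its commutators with the creation modes.
\<close>

section \<open>Linear operators on the Fock space\<close>

text \<open>The obstacle is \<xi>_0. In X^- the fermion enters through a q-derivative, the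
  difference of two exponentials at qz and at z/q. This multiplies the coefficient of z^p by [p]_q,
  so for integral \<alpha> exactly the mode p = 0 is lost. The same difference makes \<eta>_0
  anticommute with X^-: the anticommutator of \<eta>_0 with the exponential at q^s z does not depend
  on s and cancels.

  The numbers in the weights come from the vacua. On the vacuum with i = 0 in
  \<open>fock_sum\<close> \<alpha> \<beta>', h_2 acts by 2\<beta>' - \<alpha>, which is 2\<beta> +
  2\<alpha> for \<beta>' = \<beta> + 3\<alpha>/2. For negative integral \<alpha> this vacuum is not
  killed by \<eta>_0; the highest weight vector of the kernel is then the \<eta>_0-image of the
  vacuum for \<beta>' + 1, whence the extra 2.

  The Fock space is not completed: on a fixed vector the modes of sufficiently small p vanish, so
  infinite sums of modes become finite sums that are correct from some truncation bound N
  on.\<close>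

definition linop :: "(fock \<Rightarrow> fock) \<Rightarrow> bool" where
  "linop f \<longleftrightarrow> (\<forall>u v. f (u + v) = f u + f v) \<and> (\<forall>c v. f (scaleF c v) = scaleF c (f v))"

lemma linopI:
  assumes "\<And>u v. f (u + v) = f u + f v" "\<And>c v. f (scaleF c v) = scaleF c (f v)"
  shows "linop f"
  using assms by (simp add: linop_def)

lemma linop_add: "linop f \<Longrightarrow> f (u + v) = f u + f v"
  and linop_scale: "linop f \<Longrightarrow> f (scaleF c v) = scaleF c (f v)"
  by (simp_all add: linop_def)

lemma linop_zero: "linop f \<Longrightarrow> f 0 = 0"
  using linop_scale[of f 0 0] by simp

lemma linop_uminus: "linop f \<Longrightarrow> f (- v) = - f v"
  using linop_scale[of f "-1" v] by simp

lemma linop_diff: "linop f \<Longrightarrow> f (u - v) = f u - f v"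
  using linop_add[of f u "- v"] by (simp add: linop_uminus)

lemma linop_sum: "linop f \<Longrightarrow> f (\<Sum>i\<in>A. g i) = (\<Sum>i\<in>A. f (g i))"
  by (induction A rule: infinite_finite_induct) (simp_all add: linop_zero linop_add)

text \<open>The product of \<open>Poly_Mapping\<close> is convolution over the monoid of pairs
  (weight, multiset). Its index 0 is the unit, so scalars embed there and scaling becomes ring
  multiplication.\<close>

lemma scaleF_eq_mult: "scaleF c v = Poly_Mapping.single 0 c * v"
  by (rule poly_mapping_eqI) (simp add: lookup_scaleF lookup_mult lookup_single when_mult)

lemma scaleF_mult_left [simp]: "scaleF c u * v = scaleF c (u * v)"
  and scaleF_mult_right [simp]: "u * scaleF c v = scaleF c (u * v)"
  by (simp_all add: scaleF_eq_mult algebra_simps)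

lemma of_nat_mult_fock: "of_nat n * (v :: fock) = scaleF (of_nat n) v"
  by (simp add: scaleF_eq_mult)

lemma scaleF_sum: "scaleF c (\<Sum>i\<in>A. f i) = (\<Sum>i\<in>A. scaleF c (f i))"
  by (rule fock.scale_sum_right)

lemma linop_id: "linop (\<lambda>v. v)"
  and linop_0: "linop (\<lambda>v. 0)"
  by (simp_all add: linop_def)

lemma linop_mult: "linop f \<Longrightarrow> linop (\<lambda>v. a * f v)"
  and linop_scaleF: "linop f \<Longrightarrow> linop (\<lambda>v. scaleF c (f v))"
  and linop_plus: "linop f \<Longrightarrow> linop g \<Longrightarrow> linop (\<lambda>v. f v + g v)"
  and linop_minus: "linop f \<Longrightarrow> linop g \<Longrightarrow> linop (\<lambda>v. f v - g v)"
  and linop_neg: "linop f \<Longrightarrow> linop (\<lambda>v. - f v)"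
  and linop_comp: "linop f \<Longrightarrow> linop g \<Longrightarrow> linop (\<lambda>v. f (g v))"
  by (auto simp: linop_def algebra_simps fock.scale_right_distrib fock.scale_right_diff_distrib)

lemma linop_setsum: "(\<And>i. i \<in> A \<Longrightarrow> linop (f i)) \<Longrightarrow> linop (\<lambda>v. \<Sum>i\<in>A. f i v)"
  by (induction A rule: infinite_finite_induct) (auto intro: linop_0 linop_plus)

lemmas linop_intros = linop_id linop_0 linop_mult linop_scaleF linop_plus linop_minus linop_neg
  linop_setsum

lemma lin_superset:
  assumes "finite A" "Poly_Mapping.keys v \<subseteq> A"
  shows "lin f v = (\<Sum>b\<in>A. scaleF (Poly_Mapping.lookup v b) (f b))"
  unfolding lin_def using assms by (intro sum.mono_neutral_left) (auto simp: in_keys_iff)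

lemma linop_lin: "linop (lin f)"
proof (rule linopI)
  fix u v :: fock
  let ?A = "Poly_Mapping.keys u \<union> Poly_Mapping.keys v"
  have "Poly_Mapping.keys (u + v) \<subseteq> ?A" by (rule keys_add)
  then show "lin f (u + v) = lin f u + lin f v"
    by (subst (1 2 3) lin_superset[of ?A])
      (auto simp: lookup_add fock.scale_left_distrib sum.distrib)
next
  fix c and v :: fock
  have "Poly_Mapping.keys (scaleF c v) \<subseteq> Poly_Mapping.keys v"
    by (auto simp: in_keys_iff lookup_scaleF)
  then show "lin f (scaleF c v) = scaleF c (lin f v)"
    by (subst (1 2) lin_superset[of "Poly_Mapping.keys v"])
      (auto simp: lookup_scaleF scaleF_sum)
qed

lemma lin_bvec [simp]: "lin f (bvec b) = f b"
  by (simp add: lin_def bvec_def)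

lemma fock_eq_sum_bvec:
  "v = (\<Sum>b\<in>Poly_Mapping.keys v. scaleF (Poly_Mapping.lookup v b) (bvec b))"
proof (rule poly_mapping_eqI)
  fix b
  show "Poly_Mapping.lookup v b =
    Poly_Mapping.lookup (\<Sum>b\<in>Poly_Mapping.keys v. scaleF (Poly_Mapping.lookup v b) (bvec b)) b"
    by (simp add: lookup_sum lookup_scaleF bvec_def lookup_single when_def in_keys_iff if_distrib
      cong: if_cong)
qed

lemma lookup_lin_diag:
  "Poly_Mapping.lookup (lin (\<lambda>b. scaleF (f b) (bvec b)) v) b = f b * Poly_Mapping.lookup v b"
  by (simp add: lin_def lookup_sum lookup_scaleF bvec_def lookup_single when_def in_keys_iff
      if_distrib cong: if_cong)

section \<open>Monomials and spanning sets\<close>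

text \<open>Placed at weight 0, so multiplying by it adds one creation mode and leaves the weight
  alone. Likewise \<open>vac w\<close> below serves both as a vacuum and as the translation by
  w.\<close>

definition mon :: "boson \<Rightarrow> nat \<Rightarrow> fock" where
  "mon s n = bvec (0, {#(s, n)#})"

definition vac :: "weight \<Rightarrow> fock" where
  "vac w = bvec (w, {#})"

lemma bvec_mult: "bvec a * bvec b = bvec (a + b)"
  by (simp add: bvec_def mult_single)

lemma vac_mult: "vac w * vac w' = vac (w + w')"
  by (simp add: vac_def bvec_mult)

lemma vac_0 [simp]: "vac 0 = 1"
  by (simp add: vac_def bvec_def flip: zero_prod_def)

lemma bvec_add_mset: "bvec (w, add_mset (s, n) m) = mon s n * bvec (w, m)"
  by (simp add: mon_def bvec_mult)

lemma vac_mult_bvec: "vac w * bvec (w', m) = bvec (w + w', m)"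
  by (simp add: vac_def bvec_mult)

lemma vac_neq_0 [simp]: "vac w \<noteq> 0"
proof
  assume "vac w = 0"
  then have "Poly_Mapping.lookup (vac w) (w, {#}) = 0" by simp
  then show False by (simp add: vac_def bvec_def)
qed

text \<open>\<open>fock_sum\<close> is the case of one orbit of weights and all bosons; B = {Bc}
  gives the vectors free of a-bosons. The clause n \<ge> 1 removes the index 0, which the type
  permits although it names no creation mode.\<close>

definition fspan :: "weight set \<Rightarrow> boson set \<Rightarrow> fock set" where
  "fspan W B = {v. \<forall>(w, m)\<in>Poly_Mapping.keys v. w \<in> W \<and> (\<forall>(s, n)\<in>#m. s \<in> B \<and> n \<ge> 1)}"

lemma bvec_fspan: "bvec (w, m) \<in> fspan W B \<longleftrightarrow> w \<in> W \<and> (\<forall>(s, n)\<in>#m. s \<in> B \<and> n \<ge> 1)"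
  by (simp add: fspan_def bvec_def)

lemma subspace_fspan: "fock.subspace (fspan W B)"
proof (rule fock.subspaceI)
  show "0 \<in> fspan W B" by (simp add: fspan_def)
next
  fix x y assume "x \<in> fspan W B" "y \<in> fspan W B"
  then show "x + y \<in> fspan W B"
    using keys_add[of x y] by (fastforce simp: fspan_def)
next
  fix c x assume "x \<in> fspan W B"
  moreover have "Poly_Mapping.keys (scaleF c x) \<subseteq> Poly_Mapping.keys x"
    by (auto simp: in_keys_iff lookup_scaleF)
  ultimately show "scaleF c x \<in> fspan W B"
    by (fastforce simp: fspan_def)
qed

lemma fspan_mono: "W \<subseteq> W' \<Longrightarrow> B \<subseteq> B' \<Longrightarrow> fspan W B \<subseteq> fspan W' B'"
  by (fastforce simp: fspan_def)

lemma fspan_subset: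
  assumes "fock.subspace S"
    and "\<And>w m. w \<in> W \<Longrightarrow> \<forall>(s, n)\<in>#m. s \<in> B \<and> n \<ge> 1 \<Longrightarrow> bvec (w, m) \<in> S"
  shows "fspan W B \<subseteq> S"
proof
  fix v assume v: "v \<in> fspan W B"
  show "v \<in> S"
    by (subst fock_eq_sum_bvec[of v], rule fock.subspace_sum[OF assms(1)],
        rule fock.subspace_scale[OF assms(1)])
      (use v assms(2) in \<open>fastforce simp: fspan_def\<close>)
qed

lemma fspan_induct [consumes 1, case_names subspace vac mult]:
  assumes "v \<in> fspan W B"
    and sub: "fock.subspace {v. P v}"
    and vac: "\<And>w. w \<in> W \<Longrightarrow> P (vac w)"
    and mult: "\<And>s n u. s \<in> B \<Longrightarrow> n \<ge> 1 \<Longrightarrow> u \<in> fspan W B \<Longrightarrow> P u \<Longrightarrow> P (mon s n * u)"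
  shows "P v"
proof -
  have "P (bvec (w, m))" if "w \<in> W" "\<forall>(s, n)\<in>#m. s \<in> B \<and> n \<ge> 1" for w m
    using that(2)
  proof (induction m)
    case empty
    then show ?case using vac[OF that(1)] by (simp add: vac_def)
  next
    case (add x m)
    then show ?case
      using that(1) by (cases x) (auto simp: bvec_add_mset bvec_fspan intro!: mult)
  qed
  then have "fspan W B \<subseteq> {v. P v}"
    by (intro fspan_subset[OF sub]) auto
  then show ?thesis using assms(1) by auto
qed

lemma fspan_mult_mon:
  assumes "u \<in> fspan W B" "s \<in> B" "n \<ge> 1"
  shows "mon s n * u \<in> fspan W B"
proof -
  have "fspan W B \<subseteq> {u. mon s n * u \<in> fspan W B}"
  proof (rule fspan_subset)
    show "fock.subspace {u. mon s n * u \<in> fspan W B}"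
      using subspace_fspan[of W B]
      by (auto simp: fock.subspace_def distrib_left)
  qed (use assms in \<open>auto simp: bvec_fspan simp flip: bvec_add_mset\<close>)
  then show ?thesis using assms(1) by auto
qed

lemma fspan_mult_vac:
  assumes "u \<in> fspan W B"
  shows "vac w * u \<in> fspan ((+) w ` W) B"
proof -
  have "fspan W B \<subseteq> {u. vac w * u \<in> fspan ((+) w ` W) B}"
  proof (rule fspan_subset)
    show "fock.subspace {u. vac w * u \<in> fspan ((+) w ` W) B}"
      using subspace_fspan[of "(+) w ` W" B]
      by (auto simp: fock.subspace_def distrib_left)
  qed (auto simp: bvec_fspan vac_mult_bvec)
  then show ?thesis using assms(1) by auto
qed

lemma vac_fspan: "vac w \<in> fspan W B \<longleftrightarrow> w \<in> W"
  by (simp add: vac_def bvec_fspan)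

lemma linop_subspace_eq:
  assumes "linop f" "linop g"
  shows "fock.subspace {v. f v = g v}"
  using assms by (auto simp: fock.subspace_def linop_zero linop_add linop_scale)

text \<open>The induction hypothesis is quantified over the parameter because commuting a vertex
  operator past a creation mode of index n replaces the power p by p + n.\<close>

lemma fspan_param_induct [consumes 1, case_names subspace vac mult]:
  assumes v: "v \<in> fspan W B" and sub: "\<And>p. fock.subspace {v. P p v}"
    and vac: "\<And>p w. w \<in> W \<Longrightarrow> P p (vac w)"
    and mult: "\<And>p s n u. s \<in> B \<Longrightarrow> n \<ge> 1 \<Longrightarrow> (\<And>q. P q u) \<Longrightarrow> P p (mon s n * u)"
  shows "P p v"
proof -
  from v have "\<forall>p. P p v"
  proof (induction rule: fspan_induct)
    case subspace
    show ?case using sub unfolding fock.subspace_def by blast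
  qed (use vac mult in blast)+
  then show ?thesis ..
qed

section \<open>Oscillators\<close>

lemma qpow_add: "qpow hb (x + y) = qpow hb x * qpow hb y"
  by (simp add: qpow_def distrib_left exp_add)

lemma qpow_0 [simp]: "qpow hb 0 = 1"
  by (simp add: qpow_def)

lemma qpow_neq_0 [simp]: "qpow hb x \<noteq> 0"
  by (simp add: qpow_def)

lemma qpow_minus: "qpow hb (- x) = inverse (qpow hb x)"
  by (simp add: qpow_def exp_minus)

lemma qpow_power: "qpow hb x ^ n = qpow hb (of_nat n * x)"
  by (simp add: qpow_def exp_of_nat_mult[symmetric] algebra_simps)

lemma qint_minus: "qint hb (- x) = - qint hb x"
  by (simp add: qint_def minus_divide_left)

lemma linop_osc: "linop (osc hb s n)"
  unfolding osc_def by (rule linop_lin)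

lemma linop_A1: "linop (A1 hb n)"
  unfolding A1_def[abs_def] by (intro linop_plus linop_osc)

lemma linop_A2: "linop (A2 hb n)"
  unfolding A2_def[abs_def] by (intro linop_scaleF linop_minus linop_osc)

lemma linop_eqI:
  assumes "linop f" "linop g" "\<And>b. f (bvec b) = g (bvec b)"
  shows "f v = g v"
proof -
  have *: "h v = (\<Sum>b\<in>Poly_Mapping.keys v. scaleF (Poly_Mapping.lookup v b) (h (bvec b)))"
    if "linop h" for h
    using arg_cong[OF fock_eq_sum_bvec[of v], of h]
    by (simp only: linop_sum[OF that] linop_scale[OF that])
  show ?thesis
    unfolding *[OF assms(1)] *[OF assms(2)] assms(3) ..
qed

lemma osc_creation: "n \<ge> 1 \<Longrightarrow> osc hb s (- int n) v = mon s n * v"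
  by (rule linop_eqI[where v = v])
    (auto intro!: linop_lin linop_intros simp: osc_def simp flip: bvec_add_mset)

definition heis :: "complex \<Rightarrow> boson \<Rightarrow> nat \<Rightarrow> complex" where
  "heis hb s n = boson_sign s * (qint hb (of_nat n))\<^sup>2 / of_nat n"

lemma osc_annihilation_bvec:
  assumes "n \<ge> 1"
  shows "osc hb s (int n) (bvec (w, m)) =
    scaleF (heis hb s n * of_nat (count m (s, n))) (bvec (w, m - {#(s, n)#}))"
  using assms by (simp add: osc_def heis_def)

lemma osc_annihilation:
  assumes "n \<ge> 1"
  shows "osc hb s (int n) (mon t k * v) =
    mon t k * osc hb s (int n) v + (if s = t \<and> n = k then scaleF (heis hb s n) v else 0)"
proof (rule linop_eqI[where v = v])
  show "linop (\<lambda>v. osc hb s (int n) (mon t k * v))"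
    by (intro linop_comp[OF linop_osc] linop_mult linop_id)
  show "linop (\<lambda>v. mon t k * osc hb s (int n) v +
      (if s = t \<and> n = k then scaleF (heis hb s n) v else 0))"
    by (cases "s = t"; cases "n = k") (simp_all add: linop_plus linop_mult linop_osc linop_scaleF linop_id linop_0)
  fix b :: basis
  obtain w m where b: "b = (w, m)" by (cases b)
  show "osc hb s (int n) (mon t k * bvec b) = mon t k * osc hb s (int n) (bvec b) +
      (if s = t \<and> n = k then scaleF (heis hb s n) (bvec b) else 0)"
  proof (cases "(s, n) = (t, k)")
    case True
    have "mon t k * scaleF (heis hb t k * of_nat (count m (t, k))) (bvec (w, m - {#(t, k)#}))
        = scaleF (heis hb t k * of_nat (count m (t, k))) (bvec (w, m))"
    \<comment> \<open>Multiset subtraction truncates; when the mode is absent its count is 0 and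
      both sides vanish.\<close>
    proof (cases "(t, k) \<in># m")
      case True
      then have "add_mset (t, k) (m - {#(t, k)#}) = m" by simp
      then show ?thesis by (simp flip: bvec_add_mset)
    qed (simp add: not_in_iff)
    then show ?thesis
      using assms True unfolding b bvec_add_mset[symmetric]
      by (auto simp add: osc_annihilation_bvec ring_distribs fock.scale_left_distrib)
  next
    case False
    then have "m + {#(t, k)#} - {#(s, n)#} = m - {#(s, n)#} + {#(t, k)#}
      \<or> (s, n) \<notin># m"
      by (metis diff_union_swap add_mset_add_single)
    then show ?thesis
      using assms False unfolding b bvec_add_mset[symmetric]
      by (auto simp: osc_annihilation_bvec bvec_add_mset[symmetric] not_in_iff)
  qed
qed

lemma osc_vac: "n \<ge> 1 \<Longrightarrow> osc hb s (int n) (vac w) = 0"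
  by (simp add: osc_def vac_def)

lemma osc_0_bvec: "osc hb s 0 (bvec (w, m)) = scaleF (zero_mode s w) (bvec (w, m))"
  by (simp add: osc_def)

unbundle fps_syntax

section \<open>Exponentials of creation operators\<close>

text \<open>A creation operator is multiplication by a ring element, so the creation part of a vertex
  operator is a formal power series over the commutative ring of Fock vectors.\<close>

definition gser :: "(nat \<Rightarrow> fock) \<Rightarrow> fock fps" where
  "gser g = Abs_fps (\<lambda>n. if n = 0 then 0 else g n)"

definition eser :: "(nat \<Rightarrow> fock) \<Rightarrow> fock fps" where
  "eser g = Abs_fps (\<lambda>k. \<Sum>r\<le>k. scaleF (1 / fact r) ((gser g ^ r) $ k))"

lemma gser_nth [simp]: "gser g $ 0 = 0" "n \<ge> 1 \<Longrightarrow> gser g $ n = g n"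
  by (simp_all add: gser_def)

lemma gser_power_nth: "k < r \<Longrightarrow> (gser g ^ r) $ k = 0"
  using startsby_zero_power_prefix[of "gser g" r] by simp

lemma eser_superset: "k \<le> K \<Longrightarrow> eser g $ k = (\<Sum>r\<le>K. scaleF (1 / fact r) ((gser g ^ r) $ k))"
  unfolding eser_def fps_nth_Abs_fps
  by (rule sum.mono_neutral_left) (auto simp: gser_power_nth)

lemma pow_coeff_creation:
  assumes "\<And>n v. n \<ge> 1 \<Longrightarrow> G n v = g n * v"
  shows "pow_coeff G r k v = (gser g ^ r) $ k * v"
proof (induction r arbitrary: k)
  case (Suc r)
  have "(gser g ^ Suc r) $ k = (\<Sum>i=0..k. gser g $ i * (gser g ^ r) $ (k - i))"
    by (simp add: fps_mult_nth)
  also have "\<dots> = (\<Sum>i=1..k. g i * (gser g ^ r) $ (k - i))"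
    by (subst sum.atLeast_Suc_atMost) auto
  finally show ?case
    using assms by (simp add: Suc.IH sum_distrib_right mult.assoc)
qed simp

lemma exp_coeff_creation:
  assumes "\<And>n v. n \<ge> 1 \<Longrightarrow> G n v = g n * v"
  shows "exp_coeff G k v = eser g $ k * v"
  by (simp add: exp_coeff_def eser_def pow_coeff_creation[OF assms] sum_distrib_right)

lemma eser_0 [simp]: "eser g $ 0 = 1"
  by (simp add: eser_def)

lemma scaleF_cancel_of_nat: "scaleF (1 / fact (Suc r)) (of_nat (Suc r) * x) = scaleF (1 / fact r) x"
proof -
  have "1 / fact (Suc r) * of_nat (Suc r) = (1 / fact r :: complex)"
    by (simp add: field_simps del: of_nat_Suc)
  then show ?thesis by (simp add: of_nat_mult_fock del: of_nat_Suc fact_Suc)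
qed

text \<open>Termwise, the derivative of h^(r+1)/(r+1)! is h' h^r / r!. From here on exponentials are
  handled through E' = h' E.\<close>

lemma eser_deriv: "fps_deriv (eser g) = fps_deriv (gser g) * eser g"
proof (rule fps_ext)
  fix n
  let ?h = "gser g"
  have "fps_deriv (eser g) $ n = (\<Sum>r\<le>Suc n. scaleF (1 / fact r) (fps_deriv (?h ^ r) $ n))"
    by (simp only: fps_deriv_nth eser_superset[of "n + 1" "Suc n"] sum_distrib_left
        scaleF_mult_right Suc_eq_plus1 order_refl)
  also have "\<dots> = (\<Sum>r\<le>n. scaleF (1 / fact (Suc r)) (fps_deriv (?h ^ Suc r) $ n))"
    by (subst sum.atMost_Suc_shift) simp
  also have "\<dots> = (\<Sum>r\<le>n. scaleF (1 / fact r) ((fps_deriv ?h * ?h ^ r) $ n))"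
  proof (rule sum.cong[OF refl])
    fix r
    have "fps_deriv (?h ^ Suc r) = of_nat (Suc r) * (fps_deriv ?h * ?h ^ r)"
      by (subst fps_deriv_power)
        (simp add: mult_ac del: of_nat_Suc flip: fps_of_nat)
    then have "fps_deriv (?h ^ Suc r) $ n = of_nat (Suc r) * (fps_deriv ?h * ?h ^ r) $ n"
      by (metis fps_mult_of_nat_nth(1))
    then show "scaleF (1 / fact (Suc r)) (fps_deriv (?h ^ Suc r) $ n) =
        scaleF (1 / fact r) ((fps_deriv ?h * ?h ^ r) $ n)"
      by (simp only: scaleF_cancel_of_nat)
  qed
  also have "\<dots> = (\<Sum>i=0..n. fps_deriv ?h $ i * (\<Sum>r\<le>n. scaleF (1 / fact r) ((?h ^ r) $ (n - i))))"
    unfolding fps_mult_nth scaleF_sum sum_distrib_left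
    by (subst sum.swap) (simp del: fps_deriv_nth)
  also have "\<dots> = (fps_deriv ?h * eser g) $ n"
    unfolding fps_mult_nth by (intro sum.cong refl) (subst eser_superset[of _ n], auto)
  finally show "fps_deriv (eser g) $ n = (fps_deriv ?h * eser g) $ n" .
qed

lemma of_nat_cancel_fock:
  assumes "of_nat (Suc n) * (x :: fock) = of_nat (Suc n) * y"
  shows "x = y"
proof -
  have "scaleF (1 / of_nat (Suc n)) (of_nat (Suc n) * z) = z" for z :: fock
    by (simp add: of_nat_mult_fock del: of_nat_Suc)
  then show ?thesis using assms by metis
qed

text \<open>Up to the factor k + 1, the coefficient of index k + 1 is an expression in the earlier
  ones, so the constant term determines a solution.\<close>

lemma fps_ode_unique:
  fixes F H D :: "fock fps"
  assumes "F $ 0 = H $ 0" "fps_deriv F = D * F" "fps_deriv H = D * H"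
  shows "F = H"
proof (rule fps_ext)
  fix n
  show "F $ n = H $ n"
  proof (induction n rule: less_induct)
    case (less n)
    show ?case
    proof (cases n)
      case (Suc k)
      have "of_nat (Suc k) * F $ Suc k = (D * F) $ k" "of_nat (Suc k) * H $ Suc k = (D * H) $ k"
        using assms(2,3) by (metis Suc_eq_plus1 fps_deriv_nth)+
      moreover have "(D * F) $ k = (D * H) $ k"
        unfolding fps_mult_nth using less.IH Suc by (intro sum.cong) auto
      ultimately show ?thesis
        using Suc of_nat_cancel_fock by metis
    qed (use assms(1) in simp)
  qed
qed

lemma eser_add: "eser g * eser h = eser (\<lambda>n. g n + h n)"
proof (rule fps_ode_unique)
  have "gser (\<lambda>n. g n + h n) = gser g + gser h"
    by (rule fps_ext) (simp add: gser_def)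
  then show "fps_deriv (eser g * eser h) = fps_deriv (gser (\<lambda>n. g n + h n)) * (eser g * eser h)"
    by (simp add: eser_deriv algebra_simps)
qed (simp_all add: eser_deriv)

lemma eser_zero: "eser (\<lambda>_. 0) = 1"
proof (rule fps_ode_unique)
  have "gser (\<lambda>_. 0) = 0" by (rule fps_ext) (simp add: gser_def)
  then show "fps_deriv (1 :: fock fps) = fps_deriv (gser (\<lambda>_. 0)) * 1" by simp
qed (simp_all add: eser_deriv)

text \<open>E' = h' E read coefficientwise. Strong induction on k with this recursion, followed by
  division by k, proves many of the later facts on exponentials.\<close>

lemma eser_rec:
  "scaleF (of_nat k) (eser g $ k) = (\<Sum>j=1..k. scaleF (of_nat j) (g j * eser g $ (k - j)))"
proof (cases k)
  case (Suc n)
  have "scaleF (of_nat (Suc n)) (eser g $ Suc n) = fps_deriv (eser g) $ n"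
    by (simp add: of_nat_mult_fock del: of_nat_Suc)
  also have "\<dots> = (\<Sum>i=0..n. fps_deriv (gser g) $ i * eser g $ (n - i))"
    by (simp only: eser_deriv fps_mult_nth)
  also have "\<dots> = (\<Sum>i=0..n. scaleF (of_nat (Suc i)) (g (Suc i) * eser g $ (n - i)))"
    by (intro sum.cong) (simp_all add: of_nat_mult_fock del: of_nat_Suc)
  also have "\<dots> = (\<Sum>j=1..Suc n. scaleF (of_nat j) (g j * eser g $ (Suc n - j)))"
    unfolding One_nat_def sum.shift_bounds_cl_Suc_ivl by simp
  finally show ?thesis using Suc by simp
qed simp

lemma scaleF_of_nat_cancel: "n \<noteq> 0 \<Longrightarrow> scaleF (of_nat n) x = scaleF (of_nat n) y \<Longrightarrow> x = y"
  using fock.scale_left_imp_eq by simp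

text \<open>This is the substitution of t z for z.\<close>

lemma eser_scale: "eser (\<lambda>n. scaleF (t ^ n) (g n)) $ k = scaleF (t ^ k) (eser g $ k)"
proof (induction k rule: less_induct)
  case (less k)
  let ?h = "\<lambda>n. scaleF (t ^ n) (g n)"
  show ?case
  proof (cases "k = 0")
    case False
    have "scaleF (of_nat k) (eser ?h $ k) =
        (\<Sum>j=1..k. scaleF (t ^ k) (scaleF (of_nat j) (g j * eser g $ (k - j))))"
      unfolding eser_rec using less.IH
      by (intro sum.cong) (auto simp: algebra_simps simp flip: power_add)
    also have "\<dots> = scaleF (of_nat k) (scaleF (t ^ k) (eser g $ k))"
      by (subst fock.scale_left_commute) (simp only: eser_rec scaleF_sum)
    finally show ?thesis by (rule scaleF_of_nat_cancel[OF False])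
  qed simp
qed

text \<open>Zero modes put arbitrary complex numbers into the exponent of z, so the coefficient
  asked for may have an index that is not a natural number; it is then 0.\<close>

definition cidx :: "fock fps \<Rightarrow> complex \<Rightarrow> fock" where
  "cidx F x = (if x \<in> \<nat> then F $ (THE k. x = of_nat k) else 0)"

lemma cidx_of_nat [simp]: "cidx F (of_nat k) = F $ k"
  by (simp add: cidx_def)

lemma cidx_0 [simp]: "cidx F 0 = F $ 0"
  using cidx_of_nat[of F 0] by simp

lemma cidx_not_Nats: "x \<notin> \<nat> \<Longrightarrow> cidx F x = 0"
  by (simp add: cidx_def)

section \<open>Structure of the vertex operators\<close>

text \<open>The coefficient of z^j in the exponent, as a ring element. The minus signs of
  \<open>vop_osc\<close> are absorbed by [-j] = -[j].\<close>

definition cgen :: "complex \<Rightarrow> complex \<Rightarrow> complex \<Rightarrow> complex \<Rightarrow> complex \<Rightarrow> nat \<Rightarrow> fock" where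
  "cgen hb \<sigma> \<kappa> \<tau> s j =
     scaleF (\<sigma> * qpow hb (\<kappa> * of_nat j) / qint hb (of_nat j)) (mon Ba1 j + mon Ba2 j)
     + scaleF (\<tau> * qpow hb (s * of_nat j) / qint hb (of_nat j)) (mon Bc j)"

definition cser :: "complex \<Rightarrow> complex \<Rightarrow> complex \<Rightarrow> complex \<Rightarrow> complex \<Rightarrow> fock fps" where
  "cser hb \<sigma> \<kappa> \<tau> s = eser (cgen hb \<sigma> \<kappa> \<tau> s)"

text \<open>The commutator of the annihilation mode of index n in the exponent with
  \<open>mon t n\<close>.\<close>

definition gam :: "complex \<Rightarrow> complex \<Rightarrow> complex \<Rightarrow> complex \<Rightarrow> complex \<Rightarrow> boson \<Rightarrow> nat \<Rightarrow> complex" where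
  "gam hb \<sigma> \<kappa> \<tau> s t n =
     - ((if t = Bc then \<tau> * qpow hb (- s * of_nat n) else \<sigma> * qpow hb (\<kappa> * of_nat n))
        / qint hb (of_nat n) * heis hb t n)"

lemma vop_osc_creation:
  "j \<ge> 1 \<Longrightarrow> vop_osc hb \<sigma> \<kappa> \<tau> s (- int j) v = cgen hb \<sigma> \<kappa> \<tau> s j * v"
  by (simp add: vop_osc_def cgen_def A1_def osc_creation qint_minus algebra_simps
      fock.scale_right_distrib)

lemma linop_vop_osc: "linop (vop_osc hb \<sigma> \<kappa> \<tau> s n)"
  unfolding vop_osc_def[abs_def]
  by (intro linop_minus linop_neg linop_scaleF linop_A1 linop_osc)

lemma vop_osc_annihilation:
  "j \<ge> 1 \<Longrightarrow> vop_osc hb \<sigma> \<kappa> \<tau> s (int j) (mon t n * v) =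
     mon t n * vop_osc hb \<sigma> \<kappa> \<tau> s (int j) v
     + (if j = n then scaleF (gam hb \<sigma> \<kappa> \<tau> s t n) v else 0)"
  unfolding vop_osc_def A1_def
  by (cases t; cases "j = n")
    (simp_all add: osc_annihilation gam_def fock.scale_right_distrib distrib_left right_diff_distrib
      algebra_simps(18-))

lemma vop_osc_vac: "j \<ge> 1 \<Longrightarrow> vop_osc hb \<sigma> \<kappa> \<tau> s (int j) (vac w) = 0"
  by (simp add: vop_osc_def A1_def osc_vac)

section \<open>Exponentials of annihilation operators\<close>

lemma linop_pow_coeff: "(\<And>n. linop (G n)) \<Longrightarrow> linop (pow_coeff G r k)"
proof (induction r arbitrary: k)
  case 0
  then show ?case by (cases "k = 0") (simp_all add: linop_id linop_0)
next
  case (Suc r)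
  show ?case
    by (simp del: of_nat_Suc) (intro linop_setsum linop_comp[OF Suc.prems Suc.IH[OF Suc.prems]])
qed

lemma pow_coeff_eq_0: "(\<And>n. linop (G n)) \<Longrightarrow> k < r \<Longrightarrow> pow_coeff G r k v = 0"
proof (induction r arbitrary: k)
  case (Suc r)
  have "pow_coeff G r (k - n) v = 0" if "n \<in> {1..k}" for n
    using that Suc.prems by (intro Suc.IH) auto
  then show ?case using Suc.prems by (simp add: linop_zero)
qed simp

text \<open>Axiomatizes the annihilation half B of an exponent: derivations in the creation modes
  that kill the vacua and have scalar commutators. For such B, exp(B) x = (x + [B, x])
  exp(B).\<close>

locale derivation_family =
  fixes G :: "nat \<Rightarrow> fock \<Rightarrow> fock" and \<gamma> :: "boson \<Rightarrow> nat \<Rightarrow> complex"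
  assumes linG: "linop (G n)"
    and G_mon: "j \<ge> 1 \<Longrightarrow> G j (mon t n * v) =
      mon t n * G j v + (if j = n then scaleF (\<gamma> t n) v else 0)"
    and G_vac: "j \<ge> 1 \<Longrightarrow> G j (vac w) = 0"
begin

lemma pow_coeff_mon_0:
  "pow_coeff G 0 k (mon t n * v) = mon t n * pow_coeff G 0 k v"
  by simp

text \<open>The commutator is a scalar times the n-th power of the formal variable, so each of the r
  + 1 factors contributes the same term.\<close>

lemma pow_coeff_mon:
  assumes n: "n \<ge> 1"
  shows "pow_coeff G (Suc r) k (mon t n * v) = mon t n * pow_coeff G (Suc r) k v
    + (if n \<le> k then scaleF (of_nat (Suc r) * \<gamma> t n) (pow_coeff G r (k - n) v) else 0)"
proof (induction r arbitrary: k)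
  case 0
  have "pow_coeff G (Suc 0) k (mon t n * v) = (\<Sum>j=1..k. mon t n * G j (if k - j = 0 then v else 0)
     + (if j = n then scaleF (\<gamma> t n) (if k - n = 0 then v else 0) else 0))"
    by (auto simp: G_mon linop_zero[OF linG] intro!: sum.cong)
  then show ?case using n
    by (simp add: sum.distrib sum_distrib_left)
next
  case (Suc r)
  let ?P = "\<lambda>r k. pow_coeff G r k v"
  have "pow_coeff G (Suc (Suc r)) k (mon t n * v) =
     (\<Sum>j=1..k. mon t n * G j (?P (Suc r) (k - j))
      + (if j = n then scaleF (\<gamma> t n) (?P (Suc r) (k - n)) else 0)
      + (if n \<le> k - j then scaleF (of_nat (Suc r) * \<gamma> t n) (G j (?P r (k - j - n))) else 0))"
    unfolding pow_coeff.simps(2)[of G "Suc r"] Suc.IH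
    by (intro sum.cong refl)
      (auto simp: G_mon linop_add[OF linG] linop_scale[OF linG] linop_zero[OF linG]
        simp del: pow_coeff.simps of_nat_Suc)
  also have "\<dots> = mon t n * ?P (Suc (Suc r)) k
      + (if n \<le> k then scaleF (\<gamma> t n) (?P (Suc r) (k - n)) else 0)
      + (\<Sum>j=1..k. if n \<le> k - j then scaleF (of_nat (Suc r) * \<gamma> t n) (G j (?P r (k - j - n))) else 0)"
    using n by (simp add: sum.distrib sum_distrib_left pow_coeff.simps(2)[of G "Suc r"]
        del: pow_coeff.simps of_nat_Suc)
  also have "(\<Sum>j=1..k. if n \<le> k - j then scaleF (of_nat (Suc r) * \<gamma> t n) (G j (?P r (k - j - n))) else 0)
     = (if n \<le> k then scaleF (of_nat (Suc r) * \<gamma> t n) (?P (Suc r) (k - n)) else 0)"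
  proof (cases "n \<le> k")
    case True
    have "(\<Sum>j=1..k. if n \<le> k - j then scaleF (of_nat (Suc r) * \<gamma> t n) (G j (?P r (k - j - n))) else 0)
      = (\<Sum>j=1..k - n. scaleF (of_nat (Suc r) * \<gamma> t n) (G j (?P r (k - j - n))))"
      using True n by (intro sum.mono_neutral_cong_right) auto
    also have "\<dots> = scaleF (of_nat (Suc r) * \<gamma> t n) (?P (Suc r) (k - n))"
      by (simp add: scaleF_sum diff_commute add.commute del: of_nat_Suc)
    finally show ?thesis using True by simp
  qed (use n in \<open>auto intro!: sum.neutral\<close>)
  finally show ?case
    by (cases "n \<le> k") (simp_all only: of_nat_Suc[of "Suc r"] ring_distribs mult_1
        fock.scale_left_distrib if_True if_False add.assoc add_0_right)
qed

lemma exp_coeff_mon: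
  assumes n: "n \<ge> 1"
  shows "exp_coeff G k (mon t n * v) = mon t n * exp_coeff G k v
    + (if n \<le> k then scaleF (\<gamma> t n) (exp_coeff G (k - n) v) else 0)"
proof (cases k)
  case 0
  then show ?thesis using n by (simp add: exp_coeff_def)
next
  case (Suc k')
  have coeff: "scaleF (1 / fact (Suc r)) (if n \<le> k then scaleF (of_nat (Suc r) * \<gamma> t n) y else 0)
      = (if n \<le> k then scaleF (\<gamma> t n) (scaleF (1 / fact r) y) else 0)" for r y
  proof -
    have "1 / fact (Suc r) * (of_nat (Suc r) * \<gamma> t n) = \<gamma> t n * (1 / fact r)"
      by (simp add: field_simps del: of_nat_Suc)
    then show ?thesis by (simp del: of_nat_Suc fact_Suc)
  qed
  have "exp_coeff G k (mon t n * v) = mon t n * exp_coeff G k v +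
    (\<Sum>r\<le>k'. scaleF (1 / fact (Suc r))
      (if n \<le> k then scaleF (of_nat (Suc r) * \<gamma> t n) (pow_coeff G r (k - n) v) else 0))"
    unfolding exp_coeff_def Suc sum.atMost_Suc_shift pow_coeff_mon[OF n] pow_coeff_mon_0
    by (simp only: distrib_left sum.distrib sum_distrib_left fock.scale_right_distrib
        scaleF_mult_right add.assoc)
  also have "\<dots> = mon t n * exp_coeff G k v +
    (\<Sum>r\<le>k'. if n \<le> k then scaleF (\<gamma> t n) (scaleF (1 / fact r) (pow_coeff G r (k - n) v)) else 0)"
    by (simp only: coeff)
  also have "(\<Sum>r\<le>k'. if n \<le> k then scaleF (\<gamma> t n) (scaleF (1 / fact r) (pow_coeff G r (k - n) v)) else 0)
     = (if n \<le> k then scaleF (\<gamma> t n) (exp_coeff G (k - n) v) else 0)"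
  proof (cases "n \<le> k")
    case True
    \<comment> \<open>The sum runs up to k - 1 instead of k - n; the surplus powers vanish by
      \<open>pow_coeff_eq_0\<close>.\<close>
    have "(\<Sum>r\<le>k'. scaleF (1 / fact r) (pow_coeff G r (k - n) v)) = exp_coeff G (k - n) v"
      unfolding exp_coeff_def using n Suc
      by (intro sum.mono_neutral_right) (auto simp: pow_coeff_eq_0 linG)
    then show ?thesis using True by (simp only: if_True scaleF_sum[symmetric])
  qed simp
  finally show ?thesis .
qed

lemma pow_coeff_vac: "pow_coeff G r k (vac w) = (if r = 0 \<and> k = 0 then vac w else 0)"
proof (induction r arbitrary: k)
  case (Suc r)
  then show ?case by (auto intro!: sum.neutral simp: G_vac linop_zero[OF linG])
qed simp

lemma exp_coeff_vac: "exp_coeff G k (vac w) = (if k = 0 then vac w else 0)"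
  by (simp add: exp_coeff_def pow_coeff_vac if_distrib cong: if_cong)

end

interpretation vop_osc: derivation_family
  "\<lambda>n. vop_osc hb \<sigma> \<kappa> \<tau> s (int n)" "gam hb \<sigma> \<kappa> \<tau> s" for hb \<sigma> \<kappa> \<tau> s
  by unfold_locales (auto simp: vop_osc_annihilation vop_osc_vac linop_vop_osc)

definition mdeg :: "(boson \<times> nat) multiset \<Rightarrow> nat" where
  "mdeg m = (\<Sum>x\<in>#m. snd x)"

abbreviation ann :: "complex \<Rightarrow> complex \<Rightarrow> complex \<Rightarrow> complex \<Rightarrow> complex \<Rightarrow> nat \<Rightarrow> fock \<Rightarrow> fock" where
  "ann hb \<sigma> \<kappa> \<tau> s \<equiv> exp_coeff (\<lambda>n. vop_osc hb \<sigma> \<kappa> \<tau> s (int n))"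

text \<open>The type allows the index 0, and \<open>vop_bvec\<close> below speaks about every basis
  vector.\<close>

lemma ann_mon_0: "ann hb \<sigma> \<kappa> \<tau> s l (mon t 0 * v) = mon t 0 * ann hb \<sigma> \<kappa> \<tau> s l v"
proof -
  have "pow_coeff (\<lambda>n. vop_osc hb \<sigma> \<kappa> \<tau> s (int n)) r k (mon t 0 * v) =
     mon t 0 * pow_coeff (\<lambda>n. vop_osc hb \<sigma> \<kappa> \<tau> s (int n)) r k v" for r k
    by (induction r arbitrary: k) (simp_all add: vop_osc_annihilation sum_distrib_left)
  then show ?thesis by (simp add: exp_coeff_def sum_distrib_left)
qed

lemma ann_eq_0:
  "mdeg m < l \<Longrightarrow> ann hb \<sigma> \<kappa> \<tau> s l (bvec (w, m)) = 0"
proof (induction m arbitrary: l)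
  case empty
  then show ?case
    using vop_osc.exp_coeff_vac[of hb \<sigma> \<kappa> \<tau> s l w] by (simp add: vac_def)
next
  case (add x m)
  obtain t n where x: "x = (t, n)" by (cases x)
  show ?case
    using add unfolding x bvec_add_mset
    by (cases "n = 0") (auto simp: ann_mon_0 vop_osc.exp_coeff_mon mdeg_def)
qed

lemma linop_vop: "linop (vop hb \<sigma> \<kappa> \<tau> s p)"
  unfolding vop_def by (rule linop_lin)

lemma shift_eq: "shift \<sigma> \<tau> v = vac (\<sigma>, - \<sigma>, \<tau>) * v"
proof (rule linop_eqI[where v = v])
  show "linop (shift \<sigma> \<tau>)" unfolding shift_def by (rule linop_lin)
  show "shift \<sigma> \<tau> (bvec b) = vac (\<sigma>, - \<sigma>, \<tau>) * bvec b" for b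
    by (cases b) (auto simp: shift_def vac_mult_bvec add.commute)
qed (intro linop_intros)

text \<open>For each l at most one k solves the equation between powers, and \<open>ann_eq_0\<close>
  bounds l. The bound L is left free so that vectors of different degrees can be compared term by
  term.\<close>

lemma vop_bvec:
  assumes "mdeg m \<le> L"
  shows "vop hb \<sigma> \<kappa> \<tau> s p (bvec ((l1, l2, l3), m)) =
    scaleF (qpow hb (s * \<tau> * l3)) (vac (\<sigma>, - \<sigma>, \<tau>) *
     (\<Sum>l\<le>L. cidx (cser hb \<sigma> \<kappa> \<tau> s) (p - (\<sigma> * (l1 + l2) + \<tau> * l3) + of_nat l)
            * ann hb \<sigma> \<kappa> \<tau> s l (bvec ((l1, l2, l3), m))))"
proof -
  let ?b = "bvec ((l1, l2, l3), m)" and ?e = "\<sigma> * (l1 + l2) + \<tau> * l3"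
  let ?F = "\<lambda>(k, l). if ?e + of_nat k - of_nat l = p
          then exp_coeff (\<lambda>n. vop_osc hb \<sigma> \<kappa> \<tau> s (- int n)) k (ann hb \<sigma> \<kappa> \<tau> s l ?b) else 0"
  let ?K = "\<lambda>l. {k. ?e + of_nat k - of_nat l = p}"
  have K: "finite (?K l)" for l
    by (rule finite_subset[of _ "{THE k. ?e + of_nat k - of_nat l = p}"])
      (auto intro!: the_equality[symmetric])
  have "Sum_any ?F = (\<Sum>(l, k)\<in>(SIGMA l:{..L}. ?K l). ?F (k, l))"
  proof -
    have "Sum_any ?F = sum ?F ((\<lambda>(l, k). (k, l)) ` (SIGMA l:{..L}. ?K l))"
    proof (rule Sum_any.expand_superset)
      show "finite ((\<lambda>(l, k). (k, l)) ` (SIGMA l:{..L}. ?K l))"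
        using K by auto
      have "ann hb \<sigma> \<kappa> \<tau> s l ?b = 0" if "l > L" for l
        using that assms by (intro ann_eq_0) auto
      then have "l \<le> L" if "?F (k, l) \<noteq> 0" for k l
        using that by (cases "l \<le> L") (auto simp: exp_coeff_creation[OF vop_osc_creation] split: if_splits)
      then show "{a. ?F a \<noteq> 0} \<subseteq> (\<lambda>(l, k). (k, l)) ` (SIGMA l:{..L}. ?K l)"
        by (force split: if_splits)
    qed
    also have "\<dots> = (\<Sum>(l, k)\<in>(SIGMA l:{..L}. ?K l). ?F (k, l))"
      by (subst sum.reindex) (auto simp: inj_on_def intro!: sum.cong)
    finally show ?thesis .
  qed
  also have "\<dots> = (\<Sum>l\<le>L. \<Sum>k\<in>?K l. ?F (k, l))"
    using K by (subst sum.Sigma) auto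
  also have "\<dots> = (\<Sum>l\<le>L. cidx (cser hb \<sigma> \<kappa> \<tau> s) (p - ?e + of_nat l) * ann hb \<sigma> \<kappa> \<tau> s l ?b)"
  proof (intro sum.cong refl)
    fix l
    show "(\<Sum>k\<in>?K l. ?F (k, l)) = cidx (cser hb \<sigma> \<kappa> \<tau> s) (p - ?e + of_nat l) * ann hb \<sigma> \<kappa> \<tau> s l ?b"
    proof (cases "p - ?e + of_nat l \<in> \<nat>")
      case True
      then obtain k where k: "p - ?e + of_nat l = of_nat k" by (auto simp: Nats_def)
      then have "?K l = {k}" "?e + of_nat k - of_nat l = p"
        by (auto simp: algebra_simps)
      then show ?thesis
        unfolding k
        by (simp add: exp_coeff_creation[OF vop_osc_creation] cser_def)
    next
      case False
      then have "?K l = {}"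
        by (auto simp: algebra_simps) (metis add_diff_cancel_right' of_nat_in_Nats)
      then show ?thesis using False by (simp add: cidx_not_Nats)
    qed
  qed
  finally show ?thesis
    by (simp add: vop_def shift_eq)
qed

lemma vop_vac:
  "vop hb \<sigma> \<kappa> \<tau> s p (vac (l1, l2, l3)) =
    scaleF (qpow hb (s * \<tau> * l3)) (vac (l1 + \<sigma>, l2 - \<sigma>, l3 + \<tau>) *
      cidx (cser hb \<sigma> \<kappa> \<tau> s) (p - (\<sigma> * (l1 + l2) + \<tau> * l3)))"
proof -
  have "vop hb \<sigma> \<kappa> \<tau> s p (vac (l1, l2, l3)) = scaleF (qpow hb (s * \<tau> * l3)) (vac (\<sigma>, - \<sigma>, \<tau>) *
      (cidx (cser hb \<sigma> \<kappa> \<tau> s) (p - (\<sigma> * (l1 + l2) + \<tau> * l3)) * vac (l1, l2, l3)))"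
    using vop_bvec[of "{#}" 0 hb \<sigma> \<kappa> \<tau> s p l1 l2 l3] vop_osc.exp_coeff_vac[of hb \<sigma> \<kappa> \<tau> s 0 "(l1, l2, l3)"]
    by (simp add: mdeg_def flip: vac_def)
  also have "vac (l1 + \<sigma>, l2 - \<sigma>, l3 + \<tau>) = vac (\<sigma>, - \<sigma>, \<tau>) * vac (l1, l2, l3)"
    by (simp add: vac_mult add.commute)
  ultimately show ?thesis by (simp add: mult_ac)
qed

text \<open>The creation half and the shift commute with \<open>mon t n\<close>. The annihilation
  half contributes \<open>gam\<close> times z^-n, which moves the requested power from p to p +
  n.\<close>

lemma vop_mon:
  assumes n: "n \<ge> 1"
  shows "vop hb \<sigma> \<kappa> \<tau> s p (mon t n * v) =
    mon t n * vop hb \<sigma> \<kappa> \<tau> s p v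
    + scaleF (gam hb \<sigma> \<kappa> \<tau> s t n) (vop hb \<sigma> \<kappa> \<tau> s (p + of_nat n) v)"
proof (rule linop_eqI[where v = v])
  fix b :: basis
  obtain l1 l2 l3 m where b: "b = ((l1, l2, l3), m)" by (cases b) auto
  let ?b = "bvec ((l1, l2, l3), m)" and ?x = "p - (\<sigma> * (l1 + l2) + \<tau> * l3)"
  let ?C = "cidx (cser hb \<sigma> \<kappa> \<tau> s)" and ?A = "ann hb \<sigma> \<kappa> \<tau> s" and ?g = "gam hb \<sigma> \<kappa> \<tau> s t n"
  let ?M = "mdeg m"
  \<comment> \<open>The common bound is the degree of \<open>mon t n * ?b\<close>.\<close>
  have "(\<Sum>l\<le>?M + n. ?C (?x + of_nat l) * ?A l (mon t n * ?b)) =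
     mon t n * (\<Sum>l\<le>?M + n. ?C (?x + of_nat l) * ?A l ?b)
     + (\<Sum>l\<le>?M + n. if n \<le> l then scaleF ?g (?C (?x + of_nat l) * ?A (l - n) ?b) else 0)"
    unfolding sum_distrib_left sum.distrib[symmetric]
    by (intro sum.cong refl) (auto simp: vop_osc.exp_coeff_mon[OF n] algebra_simps)
  also have "(\<Sum>l\<le>?M + n. if n \<le> l then scaleF ?g (?C (?x + of_nat l) * ?A (l - n) ?b) else 0)
     = (\<Sum>l\<le>?M. scaleF ?g (?C (?x + of_nat n + of_nat l) * ?A l ?b))"
  proof -
    have "(\<Sum>l\<le>?M + n. if n \<le> l then scaleF ?g (?C (?x + of_nat l) * ?A (l - n) ?b) else 0)
      = (\<Sum>l=n..?M + n. scaleF ?g (?C (?x + of_nat l) * ?A (l - n) ?b))"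
      by (rule sum.mono_neutral_cong_right) auto
    also have "\<dots> = (\<Sum>l\<le>?M. scaleF ?g (?C (?x + of_nat n + of_nat l) * ?A l ?b))"
      by (rule sum.reindex_bij_witness[of _ "\<lambda>l. l + n" "\<lambda>l. l - n"])
        (auto simp: algebra_simps of_nat_diff)
    finally show ?thesis .
  qed
  finally have "(\<Sum>l\<le>?M + n. ?C (?x + of_nat l) * ?A l (mon t n * ?b)) =
     mon t n * (\<Sum>l\<le>?M + n. ?C (?x + of_nat l) * ?A l ?b)
     + scaleF ?g (\<Sum>l\<le>?M. ?C (?x + of_nat n + of_nat l) * ?A l ?b)"
    by (simp add: scaleF_sum)
  moreover have x: "p + of_nat n - (\<sigma> * (l1 + l2) + \<tau> * l3) = ?x + of_nat n" by simp
  ultimately show "vop hb \<sigma> \<kappa> \<tau> s p (mon t n * bvec b) =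
    mon t n * vop hb \<sigma> \<kappa> \<tau> s p (bvec b)
    + scaleF ?g (vop hb \<sigma> \<kappa> \<tau> s (p + of_nat n) (bvec b))"
    using vop_bvec[of "add_mset (t, n) m" "?M + n" hb \<sigma> \<kappa> \<tau> s p l1 l2 l3]
      vop_bvec[of m "?M + n" hb \<sigma> \<kappa> \<tau> s p l1 l2 l3]
      vop_bvec[of m ?M hb \<sigma> \<kappa> \<tau> s "p + of_nat n" l1 l2 l3, unfolded x]
    unfolding b bvec_add_mset
    by (simp add: mdeg_def distrib_left mult_ac fock.scale_right_distrib fock.scale_left_commute)
qed (intro linop_comp[OF linop_vop] linop_intros linop_vop)+

section \<open>Anticommutation relations\<close>

lemma cidx_of_int: "cidx F (of_int z) = (if z \<ge> 0 then F $ nat z else 0)"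
proof (cases "z \<ge> 0")
  case True
  then show ?thesis using cidx_of_nat[of F "nat z"] by (simp del: cidx_of_nat)
next
  case False
  then have "(of_int z :: complex) \<notin> \<nat>"
  proof (intro notI, elim Nats_cases)
    fix n assume "(of_int z :: complex) = of_nat n"
    then have "(of_int z :: complex) = of_int (int n)" by simp
    then have "z = int n" by (simp only: of_int_eq_iff)
    then show False using False by simp
  qed
  then show ?thesis using False by (simp add: cidx_not_Nats)
qed

lemma sum_triangle_swap:
  fixes f :: "nat \<Rightarrow> nat \<Rightarrow> 'a :: comm_monoid_add"
  shows "(\<Sum>j=1..a. \<Sum>b\<le>a - j. f j b) = (\<Sum>b\<le>a. \<Sum>j=1..a - b. f j b)"
  by (simp add: sum.Sigma, rule sum.reindex_bij_witness[of _ prod.swap prod.swap]) auto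

lemma sum_triangle_diag:
  fixes f :: "nat \<Rightarrow> nat \<Rightarrow> 'a :: comm_monoid_add"
  shows "(\<Sum>j=1..a. \<Sum>b\<le>a - j. f j b) = (\<Sum>c\<le>a. \<Sum>j=1..c. f j (c - j))"
  by (simp add: sum.Sigma, rule sum.reindex_bij_witness[of _ "\<lambda>(c, j). (j, c - j)" "\<lambda>(j, b). (j + b, j)"])
    auto

locale qgen =
  fixes hb :: complex
  assumes not_root_of_unity: "\<And>n::nat. n > 0 \<Longrightarrow> qpow hb 1 ^ n \<noteq> 1"
begin

lemma qpow_neq_1: "n \<ge> 1 \<Longrightarrow> qpow hb (of_nat n) \<noteq> 1"
  using not_root_of_unity[of n] by (simp add: qpow_power)

lemma qpow_eq_minus_iff: "qpow hb x = qpow hb (- x) \<longleftrightarrow> qpow hb (2 * x) = 1"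
proof -
  have "qpow hb (2 * x) = qpow hb x * qpow hb x"
    by (simp only: mult_2 qpow_add)
  then show ?thesis by (auto simp: qpow_minus field_simps)
qed

lemma qpow_diff_neq_0: "n \<ge> 1 \<Longrightarrow> qpow hb (of_nat n) - qpow hb (- of_nat n) \<noteq> 0"
  using qpow_eq_minus_iff[of "of_nat n"] qpow_neq_1[of "2 * n"] by auto

lemma qdenom_neq_0: "qpow hb 1 - qpow hb (- 1) \<noteq> 0"
  using qpow_diff_neq_0[of 1] by simp

lemma qint_neq_0: "n \<ge> 1 \<Longrightarrow> qint hb (of_nat n) \<noteq> 0"
  using qpow_diff_neq_0[of n] qdenom_neq_0 by (simp add: qint_def)

text \<open>The a-parts cancel because Ba1 and Ba2 have opposite signs, so the modes of H^1 commute
  with each other. What remains is the coefficient of x^j in \<tau>\<tau>' log(1 - t x) with t =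
  q^(s' - s).\<close>

lemma vop_cgen:
  assumes j: "j \<ge> 1"
  shows "vop hb \<sigma> \<kappa> \<tau> s p (cgen hb \<sigma>' \<kappa>' \<tau>' s' j * u) =
    cgen hb \<sigma>' \<kappa>' \<tau>' s' j * vop hb \<sigma> \<kappa> \<tau> s p u
    + scaleF (- (\<tau> * \<tau>') * qpow hb (s' - s) ^ j / of_nat j) (vop hb \<sigma> \<kappa> \<tau> s (p + of_nat j) u)"
proof -
  let ?V = "vop hb \<sigma> \<kappa> \<tau> s"
  let ?a = "\<sigma>' * qpow hb (\<kappa>' * of_nat j) / qint hb (of_nat j)"
  let ?b = "\<tau>' * qpow hb (s' * of_nat j) / qint hb (of_nat j)"
  have "?V p (cgen hb \<sigma>' \<kappa>' \<tau>' s' j * u) = cgen hb \<sigma>' \<kappa>' \<tau>' s' j * ?V p u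
    + scaleF (?a * (gam hb \<sigma> \<kappa> \<tau> s Ba1 j + gam hb \<sigma> \<kappa> \<tau> s Ba2 j) + ?b * gam hb \<sigma> \<kappa> \<tau> s Bc j)
      (?V (p + of_nat j) u)"
    by (simp add: cgen_def distrib_right linop_add[OF linop_vop] linop_scale[OF linop_vop] vop_mon[OF j]
        fock.scale_right_distrib fock.scale_left_distrib distrib_left add_ac)
  also have "gam hb \<sigma> \<kappa> \<tau> s Ba1 j + gam hb \<sigma> \<kappa> \<tau> s Ba2 j = 0"
    by (simp add: gam_def heis_def)
  also have "?b * gam hb \<sigma> \<kappa> \<tau> s Bc j = - (\<tau> * \<tau>') * qpow hb (s' - s) ^ j / of_nat j"
  proof -
    have "qpow hb (s' - s) ^ j = qpow hb (s' * of_nat j) * qpow hb (- s * of_nat j)"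
      by (simp add: qpow_power algebra_simps flip: qpow_add)
    then show ?thesis
      using qint_neq_0[OF j] by (simp add: gam_def heis_def power2_eq_square)
  qed
  finally show ?thesis by simp
qed

text \<open>The recursion makes K the coefficient sequence of (1 - t x)^(\<tau>\<tau>'), the
  contraction of the two exponentials. It is used for the exponent -1, a geometric series, and the
  exponent 1, a linear polynomial.\<close>

lemma vop_cser:
  fixes K :: "nat \<Rightarrow> complex" and s s' :: complex
  defines "t \<equiv> qpow hb (s' - s)"
  assumes K0: "K 0 = 1"
    and K: "\<And>b. of_nat b * K b = (\<Sum>j=1..b. - (\<tau> * \<tau>') * t ^ j * K (b - j))"
  shows "vop hb \<sigma> \<kappa> \<tau> s p (cser hb \<sigma>' \<kappa>' \<tau>' s' $ a * u) =
    (\<Sum>b\<le>a. scaleF (K b) (cser hb \<sigma>' \<kappa>' \<tau>' s' $ (a - b) * vop hb \<sigma> \<kappa> \<tau> s (p + of_nat b) u))"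
proof (induction a arbitrary: p rule: less_induct)
  case (less a)
  let ?V = "vop hb \<sigma> \<kappa> \<tau> s" and ?C = "cser hb \<sigma>' \<kappa>' \<tau>' s'" and ?g = "cgen hb \<sigma>' \<kappa>' \<tau>' s'"
  let ?\<phi> = "\<lambda>j. - (\<tau> * \<tau>') * t ^ j"
  let ?W = "\<lambda>b. ?V (p + of_nat b) u"
  have rec: "scaleF (of_nat k) (?C $ k) = (\<Sum>j=1..k. scaleF (of_nat j) (?g j * ?C $ (k - j)))" for k
    unfolding cser_def by (rule eser_rec)
  show ?case
  proof (cases "a = 0")
    case True
    then show ?thesis by (simp add: cser_def K0)
  next
    case False
    have "scaleF (of_nat a) (?V p (?C $ a * u)) = ?V p (scaleF (of_nat a) (?C $ a) * u)"
      by (simp add: linop_scale[OF linop_vop])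
    also have "\<dots> = (\<Sum>j=1..a. scaleF (of_nat j) (?V p (?g j * (?C $ (a - j) * u))))"
      unfolding rec by (simp add: sum_distrib_right linop_sum[OF linop_vop] linop_scale[OF linop_vop] mult.assoc)
    also have "\<dots> = (\<Sum>j=1..a. scaleF (of_nat j) (?g j * ?V p (?C $ (a - j) * u))
        + scaleF (?\<phi> j) (?V (p + of_nat j) (?C $ (a - j) * u)))"
    proof (intro sum.cong refl)
      fix j assume "j \<in> {1..a}"
      then have "j \<ge> 1" "of_nat j \<noteq> (0 :: complex)" by auto
      then show "scaleF (of_nat j) (?V p (?g j * (?C $ (a - j) * u))) =
          scaleF (of_nat j) (?g j * ?V p (?C $ (a - j) * u))
          + scaleF (?\<phi> j) (?V (p + of_nat j) (?C $ (a - j) * u))"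
        by (simp add: vop_cgen fock.scale_right_distrib fock.scale_right_diff_distrib t_def)
    qed
    also have "\<dots> = (\<Sum>j=1..a. \<Sum>b\<le>a - j. scaleF (K b) (scaleF (of_nat j) (?g j * ?C $ (a - b - j)) * ?W b))
        + (\<Sum>j=1..a. \<Sum>b\<le>a - j. scaleF (?\<phi> j * K b) (?C $ (a - (j + b)) * ?W (j + b)))"
      unfolding sum.distrib[symmetric]
    proof (intro sum.cong refl)
      fix j assume j: "j \<in> {1..a}"
      then have "a - j < a" by auto
      then have "?V q (?C $ (a - j) * u) =
        (\<Sum>b\<le>a - j. scaleF (K b) (?C $ (a - j - b) * ?V (q + of_nat b) u))" for q
        by (rule less.IH)
      then show "scaleF (of_nat j) (?g j * ?V p (?C $ (a - j) * u))
          + scaleF (?\<phi> j) (?V (p + of_nat j) (?C $ (a - j) * u)) =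
         (\<Sum>b\<le>a - j. scaleF (K b) (scaleF (of_nat j) (?g j * ?C $ (a - b - j)) * ?W b)
          + scaleF (?\<phi> j * K b) (?C $ (a - (j + b)) * ?W (j + b)))"
        by (simp add: sum.distrib sum_subtractf sum_negf sum_distrib_left scaleF_sum mult.assoc
            diff_commute[of a j] mult.commute[of "of_nat j"] add_ac)
    qed
    also have "(\<Sum>j=1..a. \<Sum>b\<le>a - j. scaleF (K b) (scaleF (of_nat j) (?g j * ?C $ (a - b - j)) * ?W b))
       = (\<Sum>b\<le>a. scaleF (K b) (scaleF (of_nat (a - b)) (?C $ (a - b)) * ?W b))"
      unfolding sum_triangle_swap rec sum_distrib_right scaleF_sum ..
    also have "(\<Sum>j=1..a. \<Sum>b\<le>a - j. scaleF (?\<phi> j * K b) (?C $ (a - (j + b)) * ?W (j + b)))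
       = (\<Sum>c\<le>a. scaleF (of_nat c * K c) (?C $ (a - c) * ?W c))"
      unfolding sum_triangle_diag K fock.scale_sum_left
      by (intro sum.cong refl) (auto simp: t_def)
    \<comment> \<open>The weights a - b and b of the two sums add up to the factor a introduced at
      the start.\<close>
    also have "(\<Sum>b\<le>a. scaleF (K b) (scaleF (of_nat (a - b)) (?C $ (a - b)) * ?W b))
        + (\<Sum>c\<le>a. scaleF (of_nat c * K c) (?C $ (a - c) * ?W c))
        = scaleF (of_nat a) (\<Sum>b\<le>a. scaleF (K b) (?C $ (a - b) * ?W b))"
      unfolding sum.distrib[symmetric] scaleF_sum
      by (intro sum.cong refl)
        (auto simp: of_nat_diff algebra_simps simp flip: fock.scale_left_distrib)
    finally show ?thesis by (rule scaleF_of_nat_cancel[OF False])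
  qed
qed

lemma vop_cser_geometric:
  assumes "\<tau> * \<tau>' = - 1"
  shows "vop hb \<sigma> \<kappa> \<tau> s p (cser hb \<sigma>' \<kappa>' \<tau>' s' $ a * u) =
    (\<Sum>b\<le>a. scaleF (qpow hb (s' - s) ^ b)
      (cser hb \<sigma>' \<kappa>' \<tau>' s' $ (a - b) * vop hb \<sigma> \<kappa> \<tau> s (p + of_nat b) u))"
  by (rule vop_cser) (simp_all add: assms flip: power_add)

lemma vop_cidx:
  assumes "\<tau> * \<tau>' = 1"
  shows "vop hb \<sigma> \<kappa> \<tau> s p (cidx (cser hb \<sigma>' \<kappa>' \<tau>' s') x * u) =
    cidx (cser hb \<sigma>' \<kappa>' \<tau>' s') x * vop hb \<sigma> \<kappa> \<tau> s p u
    - scaleF (qpow hb (s' - s)) (cidx (cser hb \<sigma>' \<kappa>' \<tau>' s') (x - 1) * vop hb \<sigma> \<kappa> \<tau> s (p + 1) u)"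
proof (cases "x \<in> \<nat>")
  case False
  then have "x - 1 \<notin> \<nat>"
    using Nats_add[of "x - 1" 1] by auto
  then show ?thesis using False by (simp add: cidx_not_Nats linop_zero[OF linop_vop])
next
  case True
  then obtain a where x: "x = of_nat a" by (auto simp: Nats_def)
  let ?t = "qpow hb (s' - s)" and ?C = "cser hb \<sigma>' \<kappa>' \<tau>' s'"
  \<comment> \<open>Coefficients of 1 - t x; for b \<ge> 2 the two surviving terms of the recursion
    cancel.\<close>
  define K :: "nat \<Rightarrow> complex" where "K b = (if b = 0 then 1 else if b = 1 then - ?t else 0)" for b
  have "of_nat b * K b = (\<Sum>j=1..b. - (\<tau> * \<tau>') * ?t ^ j * K (b - j))" for b
  proof (cases "b \<le> 1")
    case True
    then have "b = 0 \<or> b = 1" by auto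
    then show ?thesis using assms by (auto simp: K_def)
  next
    case False
    then obtain c where b: "b = Suc (Suc c)" by (metis One_nat_def not0_implies_Suc not_less_eq_eq le0)
    have "(\<Sum>j=1..c. - (\<tau> * \<tau>') * ?t ^ j * K (b - j)) = 0"
      by (intro sum.neutral) (auto simp: K_def b)
    then show ?thesis using assms by (simp add: b K_def)
  qed
  then have *: "vop hb \<sigma> \<kappa> \<tau> s p (?C $ a * u) =
    (\<Sum>b\<le>a. scaleF (K b) (?C $ (a - b) * vop hb \<sigma> \<kappa> \<tau> s (p + of_nat b) u))"
    by (intro vop_cser) (simp_all add: K_def)
  show ?thesis
  proof (cases a)
    case 0
    have "cidx ?C (- 1) = 0" using cidx_of_int[of ?C "- 1"] by simp
    then show ?thesis using * by (simp add: x 0 K_def)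
  next
    case (Suc c)
    have x1: "of_nat a - 1 = (of_nat c :: complex)" by (simp add: Suc)
    have "(\<Sum>b\<le>a. scaleF (K b) (?C $ (a - b) * vop hb \<sigma> \<kappa> \<tau> s (p + of_nat b) u))
      = (\<Sum>b\<in>{0, 1}. scaleF (K b) (?C $ (a - b) * vop hb \<sigma> \<kappa> \<tau> s (p + of_nat b) u))"
      by (rule sum.mono_neutral_right) (auto simp: K_def Suc)
    also have "\<dots> = ?C $ a * vop hb \<sigma> \<kappa> \<tau> s p u - scaleF ?t (?C $ c * vop hb \<sigma> \<kappa> \<tau> s (p + 1) u)"
      by (simp add: K_def Suc)
    finally show ?thesis by (simp only: x x1 cidx_of_nat *)
  qed
qed

text \<open>The two orders produce the contractions q^s z - w and w - q^s z in front of the same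
  normally ordered product.\<close>

lemma vop_anticommute_vac:
  assumes "\<tau> * \<tau> = 1"
  shows "vop hb \<sigma> \<kappa> \<tau> s p (vop hb 0 0 \<tau> 0 r (vac w)) + vop hb 0 0 \<tau> 0 r (vop hb \<sigma> \<kappa> \<tau> s p (vac w)) = 0"
proof -
  obtain l1 l2 l3 where w: "w = (l1, l2, l3)" by (cases w) auto
  let ?W = "cidx (cser hb 0 0 \<tau> 0)" and ?V = "cidx (cser hb \<sigma> \<kappa> \<tau> s)"
  define x where "x = r - \<tau> * l3"
  define y where "y = p - (\<sigma> * (l1 + l2) + \<tau> * l3)"
  let ?v = "vac (l1 + \<sigma>, l2 - \<sigma>, l3 + \<tau> + \<tau>)"
  have ix: "r - \<tau> * (l3 + \<tau>) = x - 1" "r + 1 - \<tau> * (l3 + \<tau>) = x"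
     "p - (\<sigma> * (l1 + l2) + \<tau> * (l3 + \<tau>)) = y - 1" "p + 1 - (\<sigma> * (l1 + l2) + \<tau> * (l3 + \<tau>)) = y"
    by (simp_all add: x_def y_def assms algebra_simps)
  have "vop hb 0 0 \<tau> 0 r (vac w) = ?W x * vac (l1, l2, l3 + \<tau>)"
    by (simp add: w vop_vac x_def mult.commute)
  then have VW: "vop hb \<sigma> \<kappa> \<tau> s p (vop hb 0 0 \<tau> 0 r (vac w)) =
     scaleF (qpow hb (s * \<tau> * (l3 + \<tau>))) (?W x * (?v * ?V (y - 1))
       - scaleF (qpow hb (0 - s)) (?W (x - 1) * (?v * ?V y)))"
    by (simp only: vop_cidx[OF assms] vop_vac ix scaleF_mult_right fock.scale_right_diff_distrib
        fock.scale_left_commute)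
  have "vop hb \<sigma> \<kappa> \<tau> s p (vac w) = scaleF (qpow hb (s * \<tau> * l3)) (?V y * vac (l1 + \<sigma>, l2 - \<sigma>, l3 + \<tau>))"
    by (simp add: w vop_vac y_def mult.commute)
  then have WV: "vop hb 0 0 \<tau> 0 r (vop hb \<sigma> \<kappa> \<tau> s p (vac w)) =
     scaleF (qpow hb (s * \<tau> * l3)) (?V y * (?v * ?W (x - 1)) - scaleF (qpow hb (s - 0)) (?V (y - 1) * (?v * ?W x)))"
    using vop_vac[of hb 0 0 \<tau> 0 r "l1 + \<sigma>" "l2 - \<sigma>" "l3 + \<tau>"]
      vop_vac[of hb 0 0 \<tau> 0 "r + 1" "l1 + \<sigma>" "l2 - \<sigma>" "l3 + \<tau>"]
    by (simp add: linop_scale[OF linop_vop] vop_cidx[OF assms] ix)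
  \<comment> \<open>In the first order the operator at q^s z acts on a third weight already shifted
    by \<tau>, whence the extra factor q^s.\<close>
  have q: "qpow hb (s * \<tau> * (l3 + \<tau>)) = qpow hb (s * \<tau> * l3) * qpow hb s"
    using assms by (simp add: distrib_left mult.assoc flip: qpow_add)
  have "qpow hb s * qpow hb (0 - s) = 1" by (simp flip: qpow_add)
  then show ?thesis
    unfolding VW WV q
    by (simp add: fock.scale_right_diff_distrib mult_ac)
qed

lemma vop_anticommute:
  assumes "\<tau> * \<tau> = 1" "v \<in> fspan UNIV UNIV"
  shows "vop hb \<sigma> \<kappa> \<tau> s p (vop hb 0 0 \<tau> 0 r v) + vop hb 0 0 \<tau> 0 r (vop hb \<sigma> \<kappa> \<tau> s p v) = 0"
proof -
  let ?V = "vop hb \<sigma> \<kappa> \<tau> s" and ?W = "vop hb 0 0 \<tau> 0"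
  note lin = linop_add[OF linop_vop] linop_scale[OF linop_vop]
  \<comment> \<open>The pair of powers is the induction parameter, since a creation mode shifts
    either of them.\<close>
  have "?V (fst x) (?W (snd x) v) + ?W (snd x) (?V (fst x) v) = 0" for x
    using assms(2)
  proof (induction x v rule: fspan_param_induct)
    case (subspace x)
    show ?case by (intro linop_subspace_eq linop_plus linop_comp[OF linop_vop linop_vop] linop_0)
  next
    case (vac x w)
    show ?case by (rule vop_anticommute_vac[OF assms(1)])
  next
    case (mult x t n u)
    have "?V p (?W r (mon t n * u)) + ?W r (?V p (mon t n * u)) =
       mon t n * (?V p (?W r u) + ?W r (?V p u))
       + scaleF (gam hb \<sigma> \<kappa> \<tau> s t n) (?V (p + of_nat n) (?W r u) + ?W r (?V (p + of_nat n) u))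
       + scaleF (gam hb 0 0 \<tau> 0 t n) (?V p (?W (r + of_nat n) u) + ?W (r + of_nat n) (?V p u))" for p r
      using mult.hyps(2)
      by (simp add: vop_mon lin fock.scale_right_distrib distrib_left add_ac)
    then show ?case using mult.IH[of "(_, _)"] by simp
  qed
  from this[of "(p, r)"] show ?thesis by simp
qed

text \<open>At w = q^s z the creation parts of c in the two fields cancel and only the a-part is
  left. This is the residue of their product at its pole.\<close>

lemma cser_mult_bosonic:
  "(\<Sum>i\<le>N. scaleF (qpow hb s ^ i) (cser hb 0 0 1 0 $ i * cser hb \<sigma> \<kappa> (- 1) s $ (N - i))) =
     cser hb \<sigma> \<kappa> 0 0 $ N"
proof -
  have "cser hb \<sigma> \<kappa> 0 0 = eser (\<lambda>n. scaleF (qpow hb s ^ n) (cgen hb 0 0 1 0 n)) * cser hb \<sigma> \<kappa> (- 1) s"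
    unfolding cser_def eser_add
    by (rule arg_cong[where f = eser])
      (auto simp: fun_eq_iff cgen_def qpow_power mult.commute fock.scale_right_distrib)
  then have "cser hb \<sigma> \<kappa> 0 0 $ N =
     (\<Sum>i=0..N. scaleF (qpow hb s ^ i) (cser hb 0 0 1 0 $ i) * cser hb \<sigma> \<kappa> (- 1) s $ (N - i))"
    by (simp only: fps_mult_nth eser_scale cser_def)
  then show ?thesis by (simp add: atLeast0AtMost)
qed

text \<open>Opposite charges contract to 1/(q^s z - w) and 1/(w - q^s z), expanded in opposite
  regions. Their sum is a delta function at w = q^s z, where \<open>cser_mult_bosonic\<close>
  applies. Integrality of r - l3 lets both expansions run over the same integral powers of
  w.\<close>

lemma vop_anticommute_dual_vac:
  assumes "r - l3 \<in> \<int>"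
  shows "vop hb \<sigma> \<kappa> (- 1) s p (vop hb 0 0 1 0 r (vac (l1, l2, l3)))
      + vop hb 0 0 1 0 r (vop hb \<sigma> \<kappa> (- 1) s p (vac (l1, l2, l3)))
    = scaleF (qpow hb (- s * (r + 1))) (vop hb \<sigma> \<kappa> 0 0 (p + r + 1) (vac (l1, l2, l3)))"
proof -
  let ?w = "vac (l1, l2, l3)" and ?v = "vac (l1 + \<sigma>, l2 - \<sigma>, l3)"
  let ?W = "cser hb 0 0 1 0" and ?V = "cser hb \<sigma> \<kappa> (- 1) s" and ?U = "cser hb \<sigma> \<kappa> 0 0"
  let ?q = "qpow hb s"
  define y where "y = p - (\<sigma> * (l1 + l2) - l3)"
  obtain X where X: "r - l3 = of_int X" using assms by (auto simp: Ints_def)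
  have U: "vop hb \<sigma> \<kappa> 0 0 (p + r + 1) ?w = ?v * cidx ?U (y + of_int X + 1)"
    by (simp add: vop_vac y_def flip: X) (simp add: algebra_simps)
  have W: "vop hb 0 0 1 0 r ?w = vac (l1, l2, l3 + 1) * cidx ?W (of_int X)"
    by (simp add: vop_vac X)
  have V: "vop hb \<sigma> \<kappa> (- 1) s p ?w = scaleF (qpow hb (- s * l3)) (vac (l1 + \<sigma>, l2 - \<sigma>, l3 - 1) * cidx ?V y)"
    by (simp add: vop_vac y_def)
  have W': "vop hb 0 0 1 0 (r + of_nat b) (vac (l1 + \<sigma>, l2 - \<sigma>, l3 - 1)) = ?v * cidx ?W (of_int (X + 1 + int b))" for b
  proof -
    have e: "r + of_nat b - (l3 - 1) = of_int X + 1 + of_nat b" by (simp flip: X)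
    show ?thesis by (simp add: vop_vac e)
  qed
  have V': "vop hb \<sigma> \<kappa> (- 1) s (p + of_nat b) (vac (l1, l2, l3 + 1)) =
      scaleF (qpow hb (- s * (l3 + 1))) (?v * cidx ?V (y + 1 + of_nat b))" for b
  proof -
    have e: "p + of_nat b - (\<sigma> * (l1 + l2) + (- l3 - 1)) = y + 1 + of_nat b" by (simp add: y_def)
    show ?thesis by (simp add: vop_vac e)
  qed
  show ?thesis
  proof (cases "y \<in> \<int>")
    case False
    then have "y \<notin> \<nat>" "y + of_int X + 1 \<notin> \<nat>" "\<And>b. y + 1 + of_nat b \<notin> \<nat>"
      using Nats_subset_Ints by (auto dest!: subsetD[OF Nats_subset_Ints])
    note nn = this
    have "vop hb \<sigma> \<kappa> (- 1) s p (vac (l1, l2, l3 + 1) * cidx ?W (of_int X)) = 0"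
    proof (cases "X \<ge> 0")
      case True
      then show ?thesis
        by (simp add: cidx_of_int mult.commute[of "vac _"] vop_cser_geometric V' nn(3) cidx_not_Nats)
    qed (simp add: cidx_of_int linop_zero[OF linop_vop])
    then show ?thesis
      by (simp add: U W V nn cidx_not_Nats linop_zero[OF linop_vop])
  next
    case True
    then obtain Y where Y: "y = of_int Y" by (auto simp: Ints_def)
    \<comment> \<open>X and Y are the creation degrees that the two modes reach on the vacuum; the
      contraction adds 1. The term \<open>f i\<close> below is the part of the convolution with
      degree i from \<eta>.\<close>
    define N where "N = X + Y + 1"
    define f where "f i = scaleF (?q ^ i) (?W $ i * ?V $ (nat N - i))" for i
    have qp: "qpow hb (- s) ^ k = inverse (?q ^ k)" for k
      by (simp add: qpow_minus power_inverse)
    \<comment> \<open>This order yields the terms with i \<le> X, the reverse order in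
      \<open>WV\<close> those with i > X; together they form the full convolution.\<close>
    have VW: "vop hb \<sigma> \<kappa> (- 1) s p (vac (l1, l2, l3 + 1) * cidx ?W (of_int X)) =
      scaleF (qpow hb (- s * (r + 1))) (?v * (\<Sum>i\<in>{i. int i \<le> X \<and> int i \<le> N}. f i))"
    proof (cases "X \<ge> 0")
      case False
      then have "{i. int i \<le> X \<and> int i \<le> N} = {}" by auto
      then show ?thesis using False by (simp add: cidx_of_int linop_zero[OF linop_vop])
    next
      case True
      then obtain c where c: "X = int c" by (metis nonneg_int_cases)
      have r: "- s * (r + 1) = - s * (l3 + 1) + - s * of_nat c"
        using X by (simp add: c algebra_simps)
      have "vop hb \<sigma> \<kappa> (- 1) s p (vac (l1, l2, l3 + 1) * cidx ?W (of_int X)) =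
        (\<Sum>b\<le>c. scaleF (qpow hb (- s) ^ b) (?W $ (c - b) * scaleF (qpow hb (- s * (l3 + 1)))
           (?v * cidx ?V (of_int (Y + 1 + int b)))))"
        by (simp add: c mult.commute[of "vac _"] vop_cser_geometric V' Y)
      also have "\<dots> = (\<Sum>i\<le>c. scaleF (qpow hb (- s) ^ (c - i)) (?W $ i * scaleF (qpow hb (- s * (l3 + 1)))
           (?v * cidx ?V (of_int (N - int i)))))"
        by (rule sum.reindex_bij_witness[of _ "\<lambda>i. c - i" "\<lambda>i. c - i"])
          (auto simp: N_def c of_nat_diff add_ac)
      also have "\<dots> = (\<Sum>i\<in>{i. int i \<le> X \<and> int i \<le> N}. scaleF (qpow hb (- s * (r + 1))) (?v * f i))"
      proof (rule sum.mono_neutral_cong_right)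
        fix i assume i: "i \<in> {i. int i \<le> X \<and> int i \<le> N}"
        then have "qpow hb (- s) ^ (c - i) = qpow hb (- s) ^ c * ?q ^ i"
          by (simp add: c qp power_diff field_simps)
        moreover have "cidx ?V (of_int (N - int i)) = ?V $ (nat N - i)"
          using i by (simp add: cidx_of_int nat_diff_distrib del: of_int_diff)
        ultimately show "scaleF (qpow hb (- s) ^ (c - i)) (?W $ i * scaleF (qpow hb (- s * (l3 + 1)))
           (?v * cidx ?V (of_int (N - int i)))) = scaleF (qpow hb (- s * (r + 1))) (?v * f i)"
          unfolding r qpow_add by (simp add: f_def qpow_power mult_ac)
      qed (auto simp: c cidx_of_int simp del: of_int_diff split: if_splits)
      finally show ?thesis by (simp add: sum_distrib_left scaleF_sum)
    qed
    have WV: "vop hb 0 0 1 0 r (vac (l1 + \<sigma>, l2 - \<sigma>, l3 - 1) * cidx ?V (of_int Y)) =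
      scaleF (qpow hb (- s * (r + 1)) / qpow hb (- s * l3)) (?v * (\<Sum>i\<in>{i. \<not> int i \<le> X \<and> int i \<le> N}. f i))"
    proof (cases "Y \<ge> 0")
      case False
      then have e: "{i. \<not> int i \<le> X \<and> int i \<le> N} = {}" by (auto simp: N_def)
      show ?thesis unfolding e using False
        by (simp add: cidx_of_int linop_zero[OF linop_vop])
    next
      case True
      then obtain c where c: "Y = int c" by (metis nonneg_int_cases)
      have r: "- s * (r + 1) = - s * (of_int X + 1) + - s * l3"
        by (simp add: algebra_simps flip: X)
      have "vop hb 0 0 1 0 r (vac (l1 + \<sigma>, l2 - \<sigma>, l3 - 1) * cidx ?V (of_int Y)) =
        (\<Sum>b\<le>c. scaleF (?q ^ b) (?V $ (c - b) * (?v * cidx ?W (of_int (X + 1 + int b)))))"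
        using W' by (simp add: c mult.commute[of "vac _"] vop_cser_geometric del: of_int_add)
      also have "\<dots> = (\<Sum>b\<in>{b. b \<le> c \<and> X + 1 + int b \<ge> 0}. scaleF (?q ^ b) (?V $ (c - b) * (?v * cidx ?W (of_int (X + 1 + int b)))))"
        by (rule sum.mono_neutral_right) (auto simp: cidx_of_int simp del: of_int_add)
      also have "\<dots> = (\<Sum>i\<in>{i. \<not> int i \<le> X \<and> int i \<le> N}. scaleF (qpow hb (- s * (r + 1)) / qpow hb (- s * l3)) (?v * f i))"
      proof (rule sum.reindex_bij_witness[of _ "\<lambda>i. nat (int i - X - 1)" "\<lambda>b. nat (X + 1 + int b)"])
        fix b assume b: "b \<in> {b. b \<le> c \<and> X + 1 + int b \<ge> 0}"
        have "of_nat (nat (X + 1 + int b)) = (of_int X + 1 + of_nat b :: complex)"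
          using b by (metis (mono_tags, lifting) mem_Collect_eq of_int_1 of_int_add of_int_of_nat_eq of_nat_nat)
        then have "- s * (of_int X + 1) + s * of_nat (nat (X + 1 + int b)) = s * of_nat b"
          by (simp add: algebra_simps)
        then have "qpow hb (- s * (of_int X + 1)) * ?q ^ nat (X + 1 + int b) = ?q ^ b"
          unfolding qpow_power qpow_add[symmetric] by (simp only: mult.commute)
        moreover have "nat N - nat (X + 1 + int b) = c - b" using b by (auto simp: N_def c)
        ultimately show "scaleF (qpow hb (- s * (r + 1)) / qpow hb (- s * l3)) (?v * f (nat (X + 1 + int b)))
          = scaleF (?q ^ b) (?V $ (c - b) * (?v * cidx ?W (of_int (X + 1 + int b))))"
          using b unfolding r qpow_add
          by (simp add: f_def cidx_of_int mult_ac del: of_int_add)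
      qed (auto simp: N_def c)
      finally show ?thesis by (simp add: sum_distrib_left scaleF_sum)
    qed
    have "(\<Sum>i\<in>{i. int i \<le> X \<and> int i \<le> N}. f i) + (\<Sum>i\<in>{i. \<not> int i \<le> X \<and> int i \<le> N}. f i)
       = (\<Sum>i\<in>{i. int i \<le> N}. f i)"
    proof (subst sum.union_disjoint[symmetric])
      have "{i. int i \<le> N} \<subseteq> {..nat N}" by auto
      then show "finite {i. int i \<le> X \<and> int i \<le> N}" "finite {i. \<not> int i \<le> X \<and> int i \<le> N}"
        by (auto intro: finite_subset[of _ "{..nat N}"])
    qed (auto intro!: sum.cong)
    also have "\<dots> = cidx ?U (y + of_int X + 1)"
    proof -
      have y: "y + of_int X + 1 = of_int N" by (simp add: Y N_def)
      show ?thesis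
      proof (cases "N \<ge> 0")
        case True
        then have "{i. int i \<le> N} = {..nat N}" by auto
        then show ?thesis using True cser_mult_bosonic[of s \<sigma> \<kappa> "nat N"]
          by (simp add: y f_def cidx_of_int)
      next
        case False
        then have "{i. int i \<le> N} = {}" by auto
        then show ?thesis using False by (simp add: y cidx_of_int)
      qed
    qed
    finally show ?thesis
      by (simp add: U W V linop_scale[OF linop_vop] VW WV[folded Y]
          flip: fock.scale_right_distrib distrib_left)
  qed
qed

lemma vop_anticommute_dual:
  assumes "v \<in> fspan {(l1, l2, l3). r - l3 \<in> \<int>} UNIV"
  shows "vop hb \<sigma> \<kappa> (- 1) s p (vop hb 0 0 1 0 r v) + vop hb 0 0 1 0 r (vop hb \<sigma> \<kappa> (- 1) s p v)
    = scaleF (qpow hb (- s * (r + 1))) (vop hb \<sigma> \<kappa> 0 0 (p + r + 1) v)"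
proof -
  let ?V = "vop hb \<sigma> \<kappa> (- 1) s" and ?W = "vop hb 0 0 1 0" and ?U = "vop hb \<sigma> \<kappa> 0 0"
  note lin = linop_add[OF linop_vop] linop_scale[OF linop_vop]
  let ?P = "\<lambda>v p r. ?V p (?W r v) + ?W r (?V p v) = scaleF (qpow hb (- s * (r + 1))) (?U (p + r + 1) v)"
  \<comment> \<open>Creation modes move r by integers, so the induction covers the whole class of r
    modulo the integers.\<close>
  from assms have "\<forall>p r'. r' - r \<in> \<int> \<longrightarrow> ?P v p r'"
  proof (induction rule: fspan_induct)
    case subspace
    have "fock.subspace {v. ?P v p r}" for p r
      by (intro linop_subspace_eq linop_plus linop_scaleF linop_vop linop_comp[OF linop_vop])
    then show ?case unfolding fock.subspace_def by blast
  next
    case (vac w)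
    then obtain l1 l2 l3 where w: "w = (l1, l2, l3)" "r - l3 \<in> \<int>" by auto
    have "r' - l3 \<in> \<int>" if "r' - r \<in> \<int>" for r'
      using Ints_add[OF that w(2)] by simp
    then show ?case unfolding w(1) using vop_anticommute_dual_vac by blast
  next
    case (mult t n u)
    show ?case
    proof (intro allI impI)
      fix p r' assume r': "r' - r \<in> \<int>"
      let ?gv = "gam hb \<sigma> \<kappa> (- 1) s t n" and ?gw = "gam hb 0 0 1 0 t n"
      have "r' + of_nat n - r \<in> \<int>"
        using Ints_add[OF r' Ints_of_nat[of n]] by (simp add: algebra_simps)
      then have IH: "?P u p r'" "?P u (p + of_nat n) r'" "?P u p (r' + of_nat n)"
        using mult.IH r' by blast+
      have "?V p (?W r' (mon t n * u)) + ?W r' (?V p (mon t n * u)) =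
         mon t n * (?V p (?W r' u) + ?W r' (?V p u))
         + scaleF ?gv (?V (p + of_nat n) (?W r' u) + ?W r' (?V (p + of_nat n) u))
         + scaleF ?gw (?V p (?W (r' + of_nat n) u) + ?W (r' + of_nat n) (?V p u))"
        using mult.hyps(2)
        by (simp add: vop_mon lin fock.scale_right_distrib distrib_left add_ac)
      also have "\<dots> = mon t n * scaleF (qpow hb (- s * (r' + 1))) (?U (p + r' + 1) u)
         + scaleF (?gv * qpow hb (- s * (r' + 1)) + ?gw * qpow hb (- s * (r' + of_nat n + 1)))
             (?U (p + r' + 1 + of_nat n) u)"
        unfolding IH by (simp add: fock.scale_left_distrib add_ac)
      \<comment> \<open>For the boson c the two commutators cancel once the shift of r' has produced
        q^(-s n); for the bosons a only the first is present.\<close>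
      also have "?gv * qpow hb (- s * (r' + 1)) + ?gw * qpow hb (- s * (r' + of_nat n + 1)) =
          qpow hb (- s * (r' + 1)) * gam hb \<sigma> \<kappa> 0 0 t n"
      proof -
        have "qpow hb (- s * (r' + of_nat n + 1)) = qpow hb (- s * (r' + 1)) * qpow hb (- s * of_nat n)"
          by (subst qpow_add[symmetric]) (simp add: algebra_simps)
        then show ?thesis by (simp add: gam_def)
      qed
      finally show "?P (mon t n * u) p r'"
        using mult.hyps(2) by (simp add: vop_mon fock.scale_right_distrib)
    qed
  qed
  then show ?thesis by simp
qed

lemma vop_trivial: "v \<in> fspan UNIV UNIV \<Longrightarrow> vop hb 0 0 0 0 p v = (if p = 0 then v else 0)"
proof (induction p v rule: fspan_param_induct)
  case (subspace p)
  have "linop (\<lambda>v. if p = 0 then v else 0)" by (cases "p = 0") (simp_all add: linop_id linop_0)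
  then show ?case by (intro linop_subspace_eq linop_vop)
next
  case (vac p w)
  have "cser hb 0 0 0 0 = 1" by (simp add: cser_def cgen_def[abs_def] eser_zero)
  moreover have "cidx 1 p = (if p = 0 then 1 else 0)" for p :: complex
    by (cases "p \<in> \<nat>") (auto simp: cidx_not_Nats elim!: Nats_cases)
  ultimately show ?case by (cases w) (simp add: vop_vac)
qed (simp add: vop_mon gam_def)

end

section \<open>Support and local finiteness\<close>

lemma cidx_eventually_0: "\<exists>N0. \<forall>N\<ge>N0. cidx F (x - of_nat N) = 0"
proof (cases "x \<in> \<int>")
  case True
  then obtain z where "x = of_int z" by (auto simp: Ints_def)
  then have "cidx F (x - of_nat N) = cidx F (of_int (z - int N))" for N by simp
  then have "\<forall>N\<ge>nat (z + 1). cidx F (x - of_nat N) = 0"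
    by (auto simp: cidx_of_int simp del: of_int_diff)
  then show ?thesis by blast
next
  case False
  have "x - of_nat N \<notin> \<nat>" for N
    using False by (metis Ints_add Ints_of_nat Nats_subset_Ints diff_add_cancel subsetD)
  then show ?thesis by (simp add: cidx_not_Nats)
qed

lemma eser_closed:
  assumes S: "fock.subspace S"
    and g: "\<And>j u. j \<ge> 1 \<Longrightarrow> u \<in> S \<Longrightarrow> g j * u \<in> S"
    and u: "u \<in> S"
  shows "eser g $ k * u \<in> S"
proof (induction k rule: less_induct)
  case (less k)
  show ?case
  proof (cases "k = 0")
    case True
    then show ?thesis using u by simp
  next
    case False
    have "scaleF (of_nat k) (eser g $ k) * u = (\<Sum>j=1..k. scaleF (of_nat j) (g j * (eser g $ (k - j) * u)))"
      unfolding eser_rec by (simp add: sum_distrib_right mult.assoc)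
    also have "\<dots> \<in> S"
      using less.IH by (intro fock.subspace_sum[OF S] fock.subspace_scale[OF S] g) auto
    finally have "scaleF (1 / of_nat k) (scaleF (of_nat k) (eser g $ k) * u) \<in> S"
      by (rule fock.subspace_scale[OF S])
    then show ?thesis using False by simp
  qed
qed

definition shifted :: "complex \<Rightarrow> complex \<Rightarrow> weight set \<Rightarrow> weight set" where
  "shifted \<sigma> \<tau> W = (\<lambda>(l1, l2, l3). (l1 + \<sigma>, l2 - \<sigma>, l3 + \<tau>)) ` W"

lemma cser_fspan:
  assumes B: "\<sigma> = 0 \<or> {Ba1, Ba2} \<subseteq> B" "\<tau> = 0 \<or> Bc \<in> B" and u: "u \<in> fspan W B"
  shows "cser hb \<sigma> \<kappa> \<tau> s $ k * u \<in> fspan W B"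
  unfolding cser_def
proof (rule eser_closed[OF subspace_fspan _ u])
  fix j :: nat and u assume j: "j \<ge> 1" and u: "u \<in> fspan W B"
  note sub = subspace_fspan[of W B]
  have a: "scaleF (\<sigma> * c) (mon t j * u) \<in> fspan W B" if "t = Ba1 \<or> t = Ba2" for c t
    using B(1)
  proof
    assume "\<sigma> = 0" then show ?thesis using fock.subspace_0[OF sub] by simp
  next
    assume "{Ba1, Ba2} \<subseteq> B"
    then show ?thesis using that u j by (intro fock.subspace_scale[OF sub] fspan_mult_mon) auto
  qed
  have c: "scaleF (\<tau> * c) (mon Bc j * u) \<in> fspan W B" for c
    using B(2)
  proof
    assume "\<tau> = 0" then show ?thesis using fock.subspace_0[OF sub] by simp
  next
    assume "Bc \<in> B"
    then show ?thesis using u j by (intro fock.subspace_scale[OF sub] fspan_mult_mon) auto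
  qed
  show "cgen hb \<sigma> \<kappa> \<tau> s j * u \<in> fspan W B"
    unfolding cgen_def distrib_right scaleF_mult_left fock.scale_right_distrib times_divide_eq_right[symmetric]
    by (intro fock.subspace_add[OF sub] a c) auto
qed

lemma vop_fspan:
  assumes B: "\<sigma> = 0 \<or> {Ba1, Ba2} \<subseteq> B" "\<tau> = 0 \<or> Bc \<in> B" and v: "v \<in> fspan W B"
  shows "vop hb \<sigma> \<kappa> \<tau> s p v \<in> fspan (shifted \<sigma> \<tau> W) B"
proof -
  note sub = subspace_fspan[of "shifted \<sigma> \<tau> W" B]
  from v have "\<forall>p. vop hb \<sigma> \<kappa> \<tau> s p v \<in> fspan (shifted \<sigma> \<tau> W) B"
  proof (induction rule: fspan_induct)
    case subspace
    show ?case using sub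
      by (auto simp: fock.subspace_def linop_zero[OF linop_vop] linop_add[OF linop_vop] linop_scale[OF linop_vop])
  next
    case (vac w)
    obtain l1 l2 l3 where w: "w = (l1, l2, l3)" by (cases w) auto
    have v: "vac (l1 + \<sigma>, l2 - \<sigma>, l3 + \<tau>) \<in> fspan (shifted \<sigma> \<tau> W) B"
      using vac by (force simp: vac_fspan shifted_def w)
    have "cidx (cser hb \<sigma> \<kappa> \<tau> s) x * vac (l1 + \<sigma>, l2 - \<sigma>, l3 + \<tau>) \<in> fspan (shifted \<sigma> \<tau> W) B" for x
    proof (cases "x \<in> \<nat>")
      case True
      then show ?thesis using cser_fspan[OF B v] by (auto elim!: Nats_cases)
    qed (use fock.subspace_0[OF sub] in \<open>simp add: cidx_not_Nats\<close>)
    then show ?case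
      by (auto simp: w vop_vac mult.commute[of "vac _"] intro!: fock.subspace_scale[OF sub])
  next
    case (mult t n u)
    then show ?case
      by (auto simp: vop_mon intro!: fock.subspace_add[OF sub] fock.subspace_scale[OF sub] fspan_mult_mon)
  qed
  then show ?thesis by blast
qed

text \<open>Infinite sums are replaced by partial sums that are correct from some bound on. The
  bound depends on the vector; taking the maximum of two bounds gives closure under
  addition.\<close>

lemma subspace_eventually_eq:
  assumes f: "\<And>N::nat. linop (f N)" and g: "\<And>N. linop (g N)"
  shows "fock.subspace {v. \<exists>N0. \<forall>N\<ge>N0. f N v = g N v}"
proof (rule fock.subspaceI)
  fix u v assume uv: "u \<in> {v. \<exists>N0. \<forall>N\<ge>N0. f N v = g N v}" "v \<in> {v. \<exists>N0. \<forall>N\<ge>N0. f N v = g N v}"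
  obtain N1 where "\<forall>N\<ge>N1. f N u = g N u" using uv(1) by blast
  moreover obtain N2 where "\<forall>N\<ge>N2. f N v = g N v" using uv(2) by blast
  ultimately have "\<forall>N\<ge>max N1 N2. f N (u + v) = g N (u + v)"
    by (simp add: linop_add[OF f] linop_add[OF g])
  then show "u + v \<in> {v. \<exists>N0. \<forall>N\<ge>N0. f N v = g N v}" by blast
next
  fix c u assume "u \<in> {v. \<exists>N0. \<forall>N\<ge>N0. f N v = g N v}"
  then obtain N0 where "\<forall>N\<ge>N0. f N u = g N u" by blast
  then have "\<forall>N\<ge>N0. f N (scaleF c u) = g N (scaleF c u)"
    by (simp add: linop_scale[OF f] linop_scale[OF g])
  then show "scaleF c u \<in> {v. \<exists>N0. \<forall>N\<ge>N0. f N v = g N v}" by blast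
qed (simp add: linop_zero[OF f] linop_zero[OF g])

text \<open>On a fixed vector a field has powers of z bounded below; this is where the triangular
  argument in \<open>descent\<close> starts.\<close>

lemma vop_eventually_0:
  assumes "v \<in> fspan UNIV UNIV"
  shows "\<exists>N0. \<forall>N\<ge>N0. vop hb \<sigma> \<kappa> \<tau> s (p - of_nat N) v = 0"
  using assms
proof (induction p v rule: fspan_param_induct)
  case (subspace p)
  show ?case by (intro subspace_eventually_eq linop_vop linop_0)
next
  case (vac p w)
  obtain l1 l2 l3 where w: "w = (l1, l2, l3)" by (cases w) auto
  have e: "p - of_nat N - (\<sigma> * (l1 + l2) + \<tau> * l3) = p - (\<sigma> * (l1 + l2) + \<tau> * l3) - of_nat N" for N
    by simp
  obtain N0 where "\<forall>N\<ge>N0. cidx (cser hb \<sigma> \<kappa> \<tau> s) (p - (\<sigma> * (l1 + l2) + \<tau> * l3) - of_nat N) = 0"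
    using cidx_eventually_0 by blast
  then have "\<forall>N\<ge>N0. vop hb \<sigma> \<kappa> \<tau> s (p - of_nat N) (vac w) = 0"
    by (simp only: w vop_vac e) simp
  then show ?case by blast
next
  case (mult p t n u)
  have ix: "p - of_nat N + of_nat n = p + of_nat n - of_nat N" for N by simp
  obtain N1 where "\<forall>N\<ge>N1. vop hb \<sigma> \<kappa> \<tau> s (p - of_nat N) u = 0" using mult.IH by blast
  moreover obtain N2 where "\<forall>N\<ge>N2. vop hb \<sigma> \<kappa> \<tau> s (p + of_nat n - of_nat N) u = 0" using mult.IH by blast
  ultimately have "\<forall>N\<ge>max N1 N2. vop hb \<sigma> \<kappa> \<tau> s (p - of_nat N) (mon t n * u) = 0"
    by (simp add: vop_mon[OF mult.hyps(2)] ix del: diff_add_eq)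
  then show ?case by blast
qed

lemma vop_nonint:
  assumes "v \<in> fspan W B" "\<And>l1 l2 l3. (l1, l2, l3) \<in> W \<Longrightarrow> p - \<tau> * l3 \<notin> \<int>"
  shows "vop hb 0 0 \<tau> s p v = 0"
proof -
  \<comment> \<open>All p + n are included since commuting past a creation mode raises the
    power.\<close>
  from assms(1) have "\<forall>n::nat. vop hb 0 0 \<tau> s (p + of_nat n) v = 0"
  proof (induction rule: fspan_induct)
    case subspace
    show ?case
      by (auto simp: fock.subspace_def linop_zero[OF linop_vop] linop_add[OF linop_vop] linop_scale[OF linop_vop])
  next
    case (vac w)
    then obtain l1 l2 l3 where w: "w = (l1, l2, l3)" "p - \<tau> * l3 \<notin> \<int>" using assms(2) by (cases w) auto
    have "p + of_nat n - \<tau> * l3 \<notin> \<nat>" for n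
    proof
      assume "p + of_nat n - \<tau> * l3 \<in> \<nat>"
      then have "p + of_nat n - \<tau> * l3 - of_nat n \<in> \<int>"
        by (intro Ints_diff subsetD[OF Nats_subset_Ints]) auto
      then show False using w(2) by (simp add: algebra_simps)
    qed
    then show ?case by (simp add: w(1) vop_vac cidx_not_Nats)
  next
    case (mult t n u)
    show ?case
    proof
      fix k :: nat
      have "p + of_nat k + of_nat n = p + of_nat (k + n)" by simp
      then show "vop hb 0 0 \<tau> s (p + of_nat k) (mon t n * u) = 0"
        using mult.IH mult.hyps(2) by (simp only: vop_mon) simp
    qed
  qed
  from spec[OF this, of 0] show ?thesis by simp
qed

section \<open>Separating the bosons a from the fermions\<close>

lemma cser_split: "cser hb \<sigma> \<kappa> \<tau> s = cser hb \<sigma> \<kappa> 0 0 * cser hb 0 0 \<tau> s"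
  unfolding cser_def eser_add by (rule arg_cong[where f = eser]) (auto simp: cgen_def)

lemma cidx_split:
  "\<exists>N0. \<forall>N\<ge>N0. cidx (F * H) x = (\<Sum>k\<le>N. F $ k * cidx H (x - of_nat k))"
proof (cases "x \<in> \<nat>")
  case False
  have "x - of_nat k \<notin> \<nat>" for k
    using False by (metis Nats_add diff_add_cancel of_nat_in_Nats)
  then show ?thesis using False by (simp add: cidx_not_Nats)
next
  case True
  then obtain M where M: "x = of_nat M" by (auto elim: Nats_cases)
  have *: "cidx H (x - of_nat k) = (if k \<le> M then H $ (M - k) else 0)" for k
    using cidx_of_int[of H "int M - int k"] by (auto simp: M nat_diff_distrib)
  have "cidx (F * H) x = (\<Sum>k\<le>N. F $ k * cidx H (x - of_nat k))" if "N \<ge> M" for N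
  proof -
    have "(\<Sum>k\<le>N. F $ k * cidx H (x - of_nat k)) = (\<Sum>k\<le>M. F $ k * H $ (M - k))"
      by (rule sum.mono_neutral_cong_right) (use that in \<open>auto simp: *\<close>)
    then show ?thesis by (simp add: M fps_mult_nth atLeast0AtMost)
  qed
  then show ?thesis by blast
qed

text \<open>Without a-bosons the annihilation half of H^1 acts as 0, and on l1 + l2 = a its zero
  mode gives a fixed power of z. What remains is the creation series of H^1 applied to fermion
  modes, with p offset by \<sigma> a.\<close>

lemma vop_split:
  assumes "v \<in> fspan {(l1, l2, l3). l1 + l2 = a} {Bc}"
  shows "\<exists>N0. \<forall>N\<ge>N0. vop hb \<sigma> \<kappa> \<tau> s p v =
    (\<Sum>k\<le>N. cser hb \<sigma> \<kappa> 0 0 $ k * (vac (\<sigma>, - \<sigma>, 0) * vop hb 0 0 \<tau> s (p - \<sigma> * a - of_nat k) v))"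
proof -
  let ?V = "vop hb \<sigma> \<kappa> \<tau> s" and ?W = "vop hb 0 0 \<tau> s" and ?C = "cser hb \<sigma> \<kappa> 0 0"
  let ?R = "\<lambda>N p v. \<Sum>k\<le>N. ?C $ k * (vac (\<sigma>, - \<sigma>, 0) * ?W (p - \<sigma> * a - of_nat k) v)"
  show ?thesis
    using assms
  proof (induction p v rule: fspan_param_induct)
    case (subspace p)
    show ?case by (intro subspace_eventually_eq linop_setsum linop_mult linop_vop)
  next
    case (vac p w)
    obtain l1 l2 l3 where w: "w = (l1, l2, l3)" "l1 + l2 = a" using vac by auto
    define x where "x = p - \<sigma> * a - \<tau> * l3"
    obtain N0 where N0: "\<forall>N\<ge>N0. cidx (cser hb \<sigma> \<kappa> \<tau> s) x = (\<Sum>k\<le>N. ?C $ k * cidx (cser hb 0 0 \<tau> s) (x - of_nat k))"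
      unfolding cser_split[of hb \<sigma> \<kappa> \<tau> s] using cidx_split by blast
    have "p - (\<sigma> * a + \<tau> * l3) = x" by (simp add: x_def)
    then have V: "?V p (vac w) = scaleF (qpow hb (s * \<tau> * l3)) (vac (l1 + \<sigma>, l2 - \<sigma>, l3 + \<tau>) * cidx (cser hb \<sigma> \<kappa> \<tau> s) x)"
      by (simp add: w vop_vac)
    have vv: "vac (\<sigma>, - \<sigma>, 0) * vac (l1, l2, l3 + \<tau>) = vac (l1 + \<sigma>, l2 - \<sigma>, l3 + \<tau>)"
      by (simp add: vac_mult add.commute)
    have e: "p - \<sigma> * a - of_nat k - \<tau> * l3 = x - of_nat k" for k by (simp add: x_def)
    have "vac (\<sigma>, - \<sigma>, 0) * ?W (p - \<sigma> * a - of_nat k) (vac w) =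
      scaleF (qpow hb (s * \<tau> * l3)) (vac (l1 + \<sigma>, l2 - \<sigma>, l3 + \<tau>) * cidx (cser hb 0 0 \<tau> s) (x - of_nat k))" for k
      by (simp add: w vop_vac e vv mult.assoc[symmetric])
    then have "?V p (vac w) = ?R N p (vac w)" if "N \<ge> N0" for N
      unfolding V N0[rule_format, OF that]
      by (simp add: sum_distrib_left scaleF_sum mult.left_commute)
    then show ?case by blast
  next
    case (mult p t n u)
    then have t: "t = Bc" by simp
    obtain N1 where N1: "\<forall>N\<ge>N1. ?V p u = ?R N p u" using mult.IH by blast
    obtain N2 where N2: "\<forall>N\<ge>N2. ?V (p + of_nat n) u = ?R N (p + of_nat n) u" using mult.IH by blast
    have g: "gam hb \<sigma> \<kappa> \<tau> s t n = gam hb 0 0 \<tau> s t n" by (simp add: t gam_def)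
    have ix: "p - \<sigma> * a - of_nat k + of_nat n = p + of_nat n - \<sigma> * a - of_nat k" for k by simp
    have "?R N p (mon t n * u) = mon t n * ?R N p u + scaleF (gam hb 0 0 \<tau> s t n) (?R N (p + of_nat n) u)" for N
      unfolding vop_mon[OF mult.hyps(2)] ix
      by (simp add: sum.distrib sum_distrib_left scaleF_sum distrib_left mult.left_commute)
    moreover have "?V p (mon t n * u) = mon t n * ?R N p u + scaleF (gam hb 0 0 \<tau> s t n) (?R N (p + of_nat n) u)"
      if "N \<ge> max N1 N2" for N
      unfolding vop_mon[OF mult.hyps(2)] g using N1[rule_format, of N] N2[rule_format, of N] that by simp
    ultimately have "\<forall>N\<ge>max N1 N2. ?V p (mon t n * u) = ?R N p (mon t n * u)" by simp
    then show ?case by blast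
  qed
qed

text \<open>Replacing z by q^s z multiplies the coefficient of z^p by q^(s p). The difference of s =
  1 and s = -1 is the source of [p]_q in X^-.\<close>

lemma vop_rescale:
  assumes "v \<in> fspan UNIV UNIV"
  shows "vop hb 0 0 \<tau> s p v = scaleF (qpow hb (s * p)) (vop hb 0 0 \<tau> 0 p v)"
  using assms
proof (induction p v rule: fspan_param_induct)
  case (vac p w)
  obtain l1 l2 l3 where w: "w = (l1, l2, l3)" by (cases w) auto
  have c: "cser hb 0 0 \<tau> s $ k = scaleF (qpow hb s ^ k) (cser hb 0 0 \<tau> 0 $ k)" for k
  proof -
    have "cser hb 0 0 \<tau> s = eser (\<lambda>n. scaleF (qpow hb s ^ n) (cgen hb 0 0 \<tau> 0 n))"
      unfolding cser_def by (rule arg_cong[where f = eser]) (auto simp: cgen_def qpow_power mult_ac)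
    then show ?thesis by (simp only: eser_scale cser_def)
  qed
  show ?case
  proof (cases "p - \<tau> * l3 \<in> \<nat>")
    case True
    then obtain k where k: "p - \<tau> * l3 = of_nat k" by (auto elim: Nats_cases)
    then have "s * p = s * \<tau> * l3 + of_nat k * s" by (simp add: algebra_simps)
    then have "qpow hb (s * p) = qpow hb (s * \<tau> * l3) * qpow hb s ^ k"
      by (simp only: qpow_add qpow_power)
    then show ?thesis using k by (simp add: w vop_vac c)
  qed (simp add: w vop_vac cidx_not_Nats)
next
  case (mult p t n u)
  have "gam hb 0 0 \<tau> s t n * qpow hb (s * (p + of_nat n)) = qpow hb (s * p) * gam hb 0 0 \<tau> 0 t n"
    by (simp add: gam_def distrib_left qpow_add qpow_minus)
  then show ?case using mult.IH by (simp add: vop_mon[OF mult.hyps(2)] fock.scale_right_distrib)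
qed (intro linop_subspace_eq linop_vop linop_scaleF)

lemma vop_vac_mult:
  assumes "v \<in> fspan UNIV UNIV"
  shows "vop hb 0 0 \<tau> s p (vac (a, b, 0) * v) = vac (a, b, 0) * vop hb 0 0 \<tau> s p v"
  using assms
proof (induction p v rule: fspan_param_induct)
  case (vac p w)
  show ?case
    by (cases w) (simp add: vac_mult vop_vac mult.assoc[symmetric])
next
  case (mult p t n u)
  then show ?case
    by (simp add: mult.left_commute[of "vac _"] vop_mon distrib_left)
qed (intro linop_subspace_eq linop_comp[OF linop_vop] linop_mult linop_id linop_vop)

text \<open>The creation part of an a-vertex operator is a series with constant term 1, so it can be
  stripped off mode by mode.\<close>

lemma triangular_closed:
  fixes C y :: "nat \<Rightarrow> fock"
  assumes S: "fock.subspace S" and C0: "C 0 = 1"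
    and C: "\<And>k u. u \<in> S \<Longrightarrow> C k * u \<in> S"
    and Y: "\<And>d. (\<Sum>k\<le>d. C k * y (d - k)) \<in> S"
  shows "y d \<in> S"
proof (induction d rule: less_induct)
  case (less d)
  have "(\<Sum>k\<le>d. C k * y (d - k)) = y d + (\<Sum>k\<in>{1..d}. C k * y (d - k))"
    by (simp add: C0 atLeast0AtMost[symmetric] sum.atLeast_Suc_atMost)
  moreover have "(\<Sum>k\<in>{1..d}. C k * y (d - k)) \<in> S"
    using less.IH by (intro fock.subspace_sum[OF S] C) auto
  ultimately show ?case
    using fock.subspace_diff[OF S Y[of d]] by fastforce
qed

text \<open>\<open>van\<close> gives a power below which g vanishes. Counting upwards from there,
  \<open>dec\<close> becomes a unitriangular system for the values of g, which
  \<open>triangular_closed\<close> solves inside S.\<close>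

lemma descent:
  assumes S: "fock.subspace S" and C0: "C 0 = 1"
    and C: "\<And>k u. u \<in> S \<Longrightarrow> C k * u \<in> S"
    and van: "\<exists>N0. \<forall>N\<ge>N0. g (p - of_nat N) = 0"
    and dec: "\<And>x. x - p \<in> \<int> \<Longrightarrow> \<exists>N0. \<forall>N\<ge>N0. V x = (\<Sum>k\<le>N. C k * g (x - of_nat k))"
    and V: "\<And>x. x - p \<in> \<int> \<Longrightarrow> V x \<in> S"
  shows "g (p :: complex) \<in> S"
proof -
  obtain M where M: "\<And>N. N \<ge> M \<Longrightarrow> g (p - of_nat N) = 0" using van by blast
  define y where "y d = g (p - of_nat M + of_nat d)" for d
  have "(\<Sum>k\<le>d. C k * y (d - k)) \<in> S" for d
  proof -
    let ?x = "p - of_nat M + of_nat d"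
    have x: "?x - p \<in> \<int>" by (simp add: algebra_simps)
    obtain N0 where N0: "\<And>N. N \<ge> N0 \<Longrightarrow> V ?x = (\<Sum>k\<le>N. C k * g (?x - of_nat k))"
      using dec[OF x] by blast
    have "g (?x - of_nat k) = 0" if "k > d" for k
    proof -
      have "?x - of_nat k = p - of_nat (M + (k - d))" using that by (simp add: of_nat_diff)
      then show ?thesis using M[of "M + (k - d)"] by (simp only:)
    qed
    moreover have "g (?x - of_nat k) = y (d - k)" if "k \<le> d" for k
      using that by (simp add: y_def of_nat_diff algebra_simps)
    ultimately have "V ?x = (\<Sum>k\<le>d. C k * y (d - k))"
      unfolding N0[OF max.cobounded1[of N0 d]]
      by (intro sum.mono_neutral_cong_right) auto
    then show ?thesis using V[OF x] by simp
  qed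
  from triangular_closed[where y = y, OF S C0 C this] have "y M \<in> S" by blast
  then show ?thesis by (simp add: y_def)
qed

section \<open>Generation by fermions\<close>

text \<open>\<open>eh hb p\<close> and \<open>xh hb p\<close> are the modes of \<open>\<eta>\<close> and \<open>\<xi>\<close>, indexed by the power of z and
  twisted by the shift that accompanies them in \<open>X\<^sup>\<plusminus>\<close>, so that they preserve \<open>fock_sum \<alpha> \<beta>\<close>.\<close>

definition eh :: "complex \<Rightarrow> complex \<Rightarrow> fock \<Rightarrow> fock" where
  "eh hb p v = vac (1, - 1, 0) * vop hb 0 0 1 0 p v"

definition xh :: "complex \<Rightarrow> complex \<Rightarrow> fock \<Rightarrow> fock" where
  "xh hb p v = vac (- 1, 1, 0) * vop hb 0 0 (- 1) 0 p v"

lemma linop_eh: "linop (eh hb p)"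
  unfolding eh_def[abs_def] by (intro linop_mult linop_vop)

lemma linop_xh: "linop (xh hb p)"
  unfolding xh_def[abs_def] by (intro linop_mult linop_vop)

lemma eh_mon: "n \<ge> 1 \<Longrightarrow> eh hb p (mon t n * v) =
    mon t n * eh hb p v + scaleF (gam hb 0 0 1 0 t n) (eh hb (p + of_nat n) v)"
  and xh_mon: "n \<ge> 1 \<Longrightarrow> xh hb p (mon t n * v) =
    mon t n * xh hb p v + scaleF (gam hb 0 0 (- 1) 0 t n) (xh hb (p + of_nat n) v)"
  by (simp_all add: eh_def xh_def vop_mon distrib_left mult.left_commute)

lemma eh_vac: "eh hb p (vac (l1, l2, l3)) = vac (l1 + 1, l2 - 1, l3 + 1) * cidx (cser hb 0 0 1 0) (p - l3)"
  by (simp add: eh_def vop_vac vac_mult mult.assoc[symmetric] add.commute)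

lemma xh_vac: "xh hb p (vac (l1, l2, l3)) = vac (l1 - 1, l2 + 1, l3 - 1) * cidx (cser hb 0 0 (- 1) 0) (p + l3)"
  by (simp add: xh_def vop_vac vac_mult mult.assoc[symmetric] add.commute)

text \<open>All modes are allowed, including p = 0 for \<xi>, under which a submodule need not be
  stable. Submodules are compared with this set afterwards by rule induction.\<close>

inductive_set ferm :: "complex \<Rightarrow> weight \<Rightarrow> fock set" for hb :: complex and w :: weight where
  vac: "vac w \<in> ferm hb w"
| add: "u \<in> ferm hb w \<Longrightarrow> v \<in> ferm hb w \<Longrightarrow> u + v \<in> ferm hb w"
| scale: "u \<in> ferm hb w \<Longrightarrow> scaleF c u \<in> ferm hb w"
| eh: "u \<in> ferm hb w \<Longrightarrow> eh hb p u \<in> ferm hb w"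
| xh: "u \<in> ferm hb w \<Longrightarrow> xh hb p u \<in> ferm hb w"

lemma subspace_ferm: "fock.subspace (ferm hb w)"
proof (rule fock.subspaceI)
  show "0 \<in> ferm hb w" using ferm.scale[OF ferm.vac, where c = 0] by simp
qed (auto intro: ferm.intros)

text \<open>Newton's identity: with \<open>g n\<close> a multiple of the n-th creation mode of c, both factors on the
  right are coefficients of fermion fields.\<close>

lemma eser_newton:
  "scaleF (of_nat (Suc n)) (g (Suc n)) =
     (\<Sum>i\<le>n. scaleF (of_nat (Suc i)) (eser g $ Suc i * eser (\<lambda>n. - g n) $ (n - i)))"
proof -
  have "eser g * eser (\<lambda>n. - g n) = 1"
    by (simp add: eser_add eser_zero)
  then have "fps_deriv (gser g) = fps_deriv (eser g) * eser (\<lambda>n. - g n)"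
    by (simp add: eser_deriv mult.assoc)
  then have "fps_deriv (gser g) $ n = (fps_deriv (eser g) * eser (\<lambda>n. - g n)) $ n" by simp
  then show ?thesis
    by (simp add: fps_mult_nth of_nat_mult_fock atLeast0AtMost mult.assoc del: of_nat_Suc)
qed

definition orbit :: "weight \<Rightarrow> weight set" where
  "orbit w = range (\<lambda>i::int. case w of (l1, l2, l3) \<Rightarrow> (l1 + of_int i, l2 - of_int i, l3 + of_int i))"

context qgen
begin

text \<open>Applying \<open>eh\<close> to a \<xi>-descendant of the vacuum gives
  \<open>Y p a\<close>, a sum over b from the geometric contraction. The difference of
  \<open>Y p a\<close> and \<open>Y (p + 1) (a - 1)\<close> telescopes to the term b = 0.\<close>

lemma ferm_cser_product:
  "cser hb 0 0 (- 1) 0 $ a * (cser hb 0 0 1 0 $ k * vac w) \<in> ferm hb w"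
proof -
  obtain l1 l2 l3 where w: "w = (l1, l2, l3)" by (cases w) auto
  let ?E = "cser hb 0 0 1 0" and ?X = "cser hb 0 0 (- 1) 0"
  let ?u = "vac (l1 - 1, l2 + 1, l3 - 1)"
  define Y where "Y p a = eh hb p (?X $ a * ?u)" for p a
  have "?X $ a * ?u = xh hb (of_nat a - l3) (vac w)" for a
    by (simp add: w xh_vac mult.commute)
  then have Y_ferm: "Y p a \<in> ferm hb w" for p a
    unfolding Y_def using ferm.intros by metis
  have Y: "Y p a = (\<Sum>b\<le>a. ?X $ (a - b) * eh hb (p + of_nat b) ?u)" for p a
    by (simp add: Y_def eh_def vop_cser_geometric sum_distrib_left mult.left_commute)
  \<comment> \<open>At this power \<open>eh\<close> takes the lowered vacuum \<open>?u\<close> back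
    to \<open>vac w\<close>, multiplied by the k-th coefficient of the \<eta>-series.\<close>
  let ?p = "l3 - 1 + of_nat k"
  have "?X $ a * eh hb ?p ?u = (if a = 0 then Y ?p 0 else Y ?p a - Y (?p + 1) (a - 1))"
  proof (cases a)
    case (Suc c)
    show ?thesis
      unfolding Suc Y sum.atMost_Suc_shift by (simp add: add_ac)
  qed (simp add: Y)
  then have "?X $ a * eh hb ?p ?u \<in> ferm hb w"
    using Y_ferm fock.subspace_diff[OF subspace_ferm] by simp
  moreover have "eh hb ?p ?u = ?E $ k * vac w"
    by (simp add: w eh_vac mult.commute)
  ultimately show ?thesis by simp
qed

lemma ferm_mon_vac: "n \<ge> 1 \<Longrightarrow> mon Bc n * vac w \<in> ferm hb w"
proof -
  assume n: "n \<ge> 1"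
  then obtain m where m: "n = Suc m" by (cases n) auto
  let ?g = "cgen hb 0 0 1 0"
  note sub = subspace_ferm[of hb w]
  have "(\<lambda>n. - ?g n) = cgen hb 0 0 (- 1) 0" by (simp add: cgen_def fun_eq_iff)
  then have "scaleF (of_nat n) (?g n) * vac w = (\<Sum>i\<le>m. scaleF (of_nat (Suc i))
      (cser hb 0 0 (- 1) 0 $ (m - i) * (cser hb 0 0 1 0 $ Suc i * vac w)))"
    unfolding m eser_newton cser_def by (simp add: sum_distrib_left mult_ac)
  also have "\<dots> \<in> ferm hb w"
    by (intro fock.subspace_sum[OF sub] fock.subspace_scale[OF sub] ferm_cser_product)
  finally have "scaleF (qint hb (of_nat n) / of_nat n) (scaleF (of_nat n) (?g n) * vac w) \<in> ferm hb w"
    by (rule fock.subspace_scale[OF sub])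
  then show ?thesis
    using n qint_neq_0[OF n] by (simp add: cgen_def)
qed

text \<open>The commutator of a creation mode with a fermion mode is a multiple of another fermion
  mode, so the case of the vacuum propagates.\<close>

lemma ferm_mon:
  assumes "v \<in> ferm hb w" "n \<ge> 1"
  shows "mon Bc n * v \<in> ferm hb w"
  using assms(1)
proof (induction rule: ferm.induct)
  case vac
  show ?case by (rule ferm_mon_vac[OF assms(2)])
next
  case (eh u p)
  have "mon Bc n * eh hb p u = eh hb p (mon Bc n * u) - scaleF (gam hb 0 0 1 0 Bc n) (eh hb (p + of_nat n) u)"
    by (simp add: eh_mon[OF assms(2)])
  also have "\<dots> \<in> ferm hb w"
    using eh by (intro fock.subspace_diff[OF subspace_ferm] ferm.intros)
  finally show ?case .
next
  case (xh u p)
  have "mon Bc n * xh hb p u = xh hb p (mon Bc n * u) - scaleF (gam hb 0 0 (- 1) 0 Bc n) (xh hb (p + of_nat n) u)"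
    by (simp add: xh_mon[OF assms(2)])
  also have "\<dots> \<in> ferm hb w"
    using xh by (intro fock.subspace_diff[OF subspace_ferm] ferm.intros)
  finally show ?case .
qed (auto simp: distrib_left intro: ferm.intros)

lemma ferm_vac: "w' \<in> orbit w \<Longrightarrow> vac w' \<in> ferm hb w"
proof -
  obtain l1 l2 l3 where w: "w = (l1, l2, l3)" by (cases w) auto
  let ?v = "\<lambda>i::int. vac (l1 + of_int i, l2 - of_int i, l3 + of_int i)"
  have "?v i \<in> ferm hb w" for i
  proof (induction i rule: int_induct[where k = 0])
    case base
    show ?case using ferm.vac[of w hb] by (simp add: w)
  next
    case (step1 i)
    \<comment> \<open>The lowest power present on a vacuum has coefficient 1 and leads to the
      neighbouring vacuum.\<close>
    have "?v (i + 1) = eh hb (l3 + of_int i) (?v i)"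
      by (simp add: eh_vac cser_def algebra_simps)
    then show ?case using ferm.eh[OF step1(2)] by simp
  next
    case (step2 i)
    have "?v (i - 1) = xh hb (- (l3 + of_int i)) (?v i)"
      by (simp add: xh_vac cser_def algebra_simps)
    then show ?case using ferm.xh[OF step2(2)] by simp
  qed
  then show "w' \<in> orbit w \<Longrightarrow> vac w' \<in> ferm hb w" by (auto simp: orbit_def w)
qed

lemma fspan_subset_ferm: "fspan (orbit w) {Bc} \<subseteq> ferm hb w"
proof
  fix v assume "v \<in> fspan (orbit w) {Bc}"
  then show "v \<in> ferm hb w"
  proof (induction rule: fspan_induct)
    case subspace
    show ?case using subspace_ferm[of hb w] by simp
  qed (auto intro: ferm_vac ferm_mon)
qed

end

section \<open>Operators commuting with the fermions\<close>

text \<open>If every g j has weight j c under the commutator with L, then the k-th coefficient,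
  being homogeneous of degree k, has weight k c.\<close>

lemma eser_commute:
  assumes L: "linop L"
    and g: "\<And>j u. j \<ge> 1 \<Longrightarrow> L (g j * u) = g j * L u + scaleF (of_nat j * c) (g j * u)"
  shows "L (eser g $ k * u) = eser g $ k * L u + scaleF (of_nat k * c) (eser g $ k * u)"
proof (induction k rule: less_induct)
  case (less k)
  show ?case
  proof (cases "k = 0")
    case False
    let ?C = "\<lambda>k. eser g $ k"
    have rec: "scaleF (of_nat k) (?C k * v) = (\<Sum>j=1..k. scaleF (of_nat j) (g j * (?C (k - j) * v)))" for v
      using arg_cong[OF eser_rec[of k g], of "\<lambda>x. x * v"] by (simp add: sum_distrib_right mult.assoc)
    have "scaleF (of_nat k) (L (?C k * u)) = (\<Sum>j=1..k. scaleF (of_nat j) (L (g j * (?C (k - j) * u))))"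
      by (simp add: rec linop_scale[OF L, symmetric] linop_sum[OF L])
    also have "\<dots> = (\<Sum>j=1..k. scaleF (of_nat j) (g j * (?C (k - j) * L u))
        + scaleF (of_nat k * c) (scaleF (of_nat j) (g j * (?C (k - j) * u))))"
    proof (intro sum.cong refl)
      fix j assume j: "j \<in> {1..k}"
      then have j1: "j \<ge> 1" and jk: "k - j < k" by auto
      have "of_nat (k - j) * c + of_nat j * c = of_nat k * c"
        using j by (simp add: of_nat_diff algebra_simps)
      then have "L (g j * (?C (k - j) * u)) = g j * (?C (k - j) * L u) + scaleF (of_nat k * c) (g j * (?C (k - j) * u))"
        by (simp add: g[OF j1] less.IH[OF jk] distrib_left add.assoc flip: fock.scale_left_distrib)
      then show "scaleF (of_nat j) (L (g j * (?C (k - j) * u))) = scaleF (of_nat j) (g j * (?C (k - j) * L u))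
        + scaleF (of_nat k * c) (scaleF (of_nat j) (g j * (?C (k - j) * u)))"
        by (simp add: fock.scale_right_distrib mult_ac)
    qed
    also have "\<dots> = scaleF (of_nat k) (?C k * L u + scaleF (of_nat k * c) (?C k * u))"
      unfolding sum.distrib rec[symmetric] scaleF_sum[symmetric]
      by (simp add: fock.scale_right_distrib mult_ac)
    finally show ?thesis by (rule scaleF_of_nat_cancel[OF False])
  qed simp
qed

text \<open>Covers at once the Cartan modes, the grading and the annihilation modes of the bosons a.\<close>

lemma vop_weight_commute:
  assumes L: "linop L"
    and mon: "\<And>t n u. n \<ge> 1 \<Longrightarrow>
      L (mon t n * u) = mon t n * L u + scaleF (of_nat n * c) (mon t n * u) + scaleF (d t n) u"
    and d: "\<And>n. d Bc n = 0"
    and vac: "\<And>w. L (vac w) = scaleF (f w) (vac w)"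
    and f: "\<And>l1 l2 l3. f (l1, l2, l3 + \<tau>) = f (l1, l2, l3) + \<tau> * l3 * c + e"
    and v: "v \<in> fspan UNIV UNIV"
  shows "L (vop hb 0 0 \<tau> 0 p v) = vop hb 0 0 \<tau> 0 p (L v) + scaleF (p * c + e) (vop hb 0 0 \<tau> 0 p v)"
proof -
  let ?V = "vop hb 0 0 \<tau> 0" and ?C = "cser hb 0 0 \<tau> 0"
  note lin = linop_add[OF linop_vop] linop_scale[OF linop_vop] linop_add[OF L] linop_scale[OF L]
  have C: "L (?C $ k * u) = ?C $ k * L u + scaleF (of_nat k * c) (?C $ k * u)" for k u
    unfolding cser_def
  proof (rule eser_commute[OF L])
    fix j u assume j: "(j :: nat) \<ge> 1"
    have "L (cgen hb 0 0 \<tau> 0 j * u) = scaleF (\<tau> / qint hb (of_nat j)) (L (mon Bc j * u))"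
      by (simp add: cgen_def linop_scale[OF L])
    then show "L (cgen hb 0 0 \<tau> 0 j * u) = cgen hb 0 0 \<tau> 0 j * L u + scaleF (of_nat j * c) (cgen hb 0 0 \<tau> 0 j * u)"
      unfolding mon[OF j] d by (simp add: cgen_def fock.scale_right_distrib mult_ac)
  qed
  show ?thesis
    using v
  proof (induction p v rule: fspan_param_induct)
    case (subspace p)
    show ?case
      by (intro linop_subspace_eq linop_comp[OF L] linop_plus linop_comp[OF linop_vop L] linop_scaleF linop_vop)
  next
    case (vac p w)
    obtain l1 l2 l3 where w: "w = (l1, l2, l3)" by (cases w) auto
    show ?case
    proof (cases "p - \<tau> * l3 \<in> \<nat>")
      case True
      then obtain k where k: "p - \<tau> * l3 = of_nat k" by (auto elim: Nats_cases)
      have V: "?V p (vac w) = ?C $ k * vac (l1, l2, l3 + \<tau>)"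
        by (simp add: w vop_vac k mult.commute)
      have p: "p = \<tau> * l3 + of_nat k" using k by (simp add: algebra_simps)
      have "f (l1, l2, l3 + \<tau>) + of_nat k * c = f w + (p * c + e)"
        unfolding f w p by (simp add: algebra_simps)
      then show ?thesis
        by (simp add: assms(4) linop_scale[OF linop_vop] V C flip: fock.scale_left_distrib)
    next
      case False
      then have "?V p (vac w) = 0" by (simp add: w vop_vac cidx_not_Nats)
      then show ?thesis
        by (simp add: assms(4) linop_scale[OF linop_vop] linop_zero[OF L])
    qed
  next
    case (mult p t n u)
    let ?g = "gam hb 0 0 \<tau> 0 t n" and ?x = "mon t n"
    let ?S = "?x * ?V p (L u) + scaleF (p * c + e + of_nat n * c) (?x * ?V p u)
        + scaleF (d t n) (?V p u) + scaleF ?g (?V (p + of_nat n) (L u))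
        + scaleF (?g * (p * c + e + of_nat n * c)) (?V (p + of_nat n) u)"
    have "L (?V p (?x * u)) = ?S"
      by (simp add: vop_mon[OF mult.hyps(2)] lin mon[OF mult.hyps(2)] mult.IH distrib_left
          fock.scale_right_distrib fock.scale_left_distrib distrib_right add_ac)
    moreover have "?V p (L (?x * u)) + scaleF (p * c + e) (?V p (?x * u)) = ?S"
      by (simp add: vop_mon[OF mult.hyps(2)] lin mon[OF mult.hyps(2)] distrib_left
          fock.scale_right_distrib fock.scale_left_distrib)
        (simp add: algebra_simps)
    ultimately show ?case by simp
  qed
qed

text \<open>Covers the zero modes, the powers of q, the grading and the parity twist; c is the
  contribution of one unit of mode degree.\<close>

definition diag :: "(weight \<Rightarrow> complex) \<Rightarrow> complex \<Rightarrow> fock \<Rightarrow> fock" where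
  "diag f c = lin (\<lambda>(w, m). scaleF (f w + c * of_nat (mdeg m)) (bvec (w, m)))"

lemma linop_diag: "linop (diag f c)"
  unfolding diag_def by (rule linop_lin)

lemma diag_bvec: "diag f c (bvec (w, m)) = scaleF (f w + c * of_nat (mdeg m)) (bvec (w, m))"
  by (simp add: diag_def)

lemma diag_vac: "diag f c (vac w) = scaleF (f w) (vac w)"
  by (simp add: vac_def diag_bvec mdeg_def)

lemma diag_mon: "diag f c (mon t n * u) = mon t n * diag f c u + scaleF (of_nat n * c) (mon t n * u)"
proof (rule linop_eqI[where v = u])
  fix b :: basis
  show "diag f c (mon t n * bvec b) = mon t n * diag f c (bvec b) + scaleF (of_nat n * c) (mon t n * bvec b)"
    by (cases b) (simp add: diag_bvec mdeg_def algebra_simps flip: bvec_add_mset)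
qed (intro linop_comp[OF linop_diag] linop_plus linop_mult linop_scaleF linop_id linop_diag)+

lemma diag_fspan: "v \<in> fspan W B \<Longrightarrow> diag f c v \<in> fspan W B"
proof -
  have "fspan W B \<subseteq> {v. diag f c v \<in> fspan W B}"
  proof (rule fspan_subset)
    show "fock.subspace {v. diag f c v \<in> fspan W B}"
      using subspace_fspan[of W B]
      by (auto simp: fock.subspace_def linop_zero[OF linop_diag] linop_add[OF linop_diag] linop_scale[OF linop_diag])
  qed (auto simp: diag_bvec bvec_fspan intro!: fock.subspace_scale[OF subspace_fspan])
  then show "v \<in> fspan W B \<Longrightarrow> diag f c v \<in> fspan W B" by auto
qed

lemma vop_diag_commute:
  assumes "\<And>l1 l2 l3. f (l1, l2, l3 + \<tau>) = f (l1, l2, l3) + \<tau> * l3 * c + e" "v \<in> fspan UNIV UNIV"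
  shows "diag f c (vop hb 0 0 \<tau> 0 p v) = vop hb 0 0 \<tau> 0 p (diag f c v) + scaleF (p * c + e) (vop hb 0 0 \<tau> 0 p v)"
  by (rule vop_weight_commute[where d = "\<lambda>_ _. 0" and f = f])
    (simp_all add: linop_diag diag_mon diag_vac assms)

lemma osc_0_eq: "osc hb s 0 = diag (zero_mode s) 0"
  by (rule ext, rule linop_eqI) (auto simp: linop_osc linop_diag osc_0_bvec diag_bvec)

lemma vop_osc_commute:
  assumes s: "s \<noteq> Bc" and v: "v \<in> fspan UNIV UNIV"
  shows "osc hb s n (vop hb 0 0 \<tau> 0 p v) = vop hb 0 0 \<tau> 0 p (osc hb s n v)"
proof -
  consider "n = 0" | k where "n = int k" "k \<ge> 1" | k where "n = - int k" "k \<ge> 1"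
    by (metis One_nat_def Suc_leI int_cases2 of_nat_0 neq0_conv minus_zero)
  then show ?thesis
  proof cases
    case 1
    have "zero_mode s (l1, l2, l3 + \<tau>) = zero_mode s (l1, l2, l3) + \<tau> * l3 * 0 + 0" for l1 l2 l3
      using s by (cases s) auto
    from vop_diag_commute[OF this v] show ?thesis by (simp add: 1 osc_0_eq)
  next
    case (2 k)
    have "osc hb s (int k) (vop hb 0 0 \<tau> 0 p v) = vop hb 0 0 \<tau> 0 p (osc hb s (int k) v)
        + scaleF (p * 0 + 0) (vop hb 0 0 \<tau> 0 p v)"
      by (rule vop_weight_commute[where d = "\<lambda>t n. if s = t \<and> k = n then heis hb s k else 0" and f = "\<lambda>_. 0"])
        (use s 2 v in \<open>auto simp: linop_osc osc_annihilation osc_vac\<close>)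
    then show ?thesis by (simp add: 2)
  next
    case (3 k)
    have "gam hb 0 0 \<tau> 0 s k = 0" using s by (simp add: gam_def)
    then show ?thesis using 3 by (simp add: osc_creation vop_mon)
  qed
qed

lemma osc_fspan: "v \<in> fspan W UNIV \<Longrightarrow> osc hb s n v \<in> fspan W UNIV"
proof -
  have "fspan W UNIV \<subseteq> {v. osc hb s n v \<in> fspan W UNIV}"
  proof (rule fspan_subset)
    show "fock.subspace {v. osc hb s n v \<in> fspan W UNIV}"
      using subspace_fspan[of W UNIV]
      by (auto simp: fock.subspace_def linop_zero[OF linop_osc] linop_add[OF linop_osc] linop_scale[OF linop_osc])
  next
    fix w and m :: "(boson \<times> nat) multiset"
    assume "w \<in> W" "\<forall>(s, n)\<in>#m. s \<in> (UNIV :: boson set) \<and> 1 \<le> n"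
    then show "bvec (w, m) \<in> {v. osc hb s n v \<in> fspan W UNIV}"
      by (auto simp: osc_def bvec_fspan intro!: fock.subspace_scale[OF subspace_fspan])
        (fastforce dest: in_diffD)
  qed
  then show "v \<in> fspan W UNIV \<Longrightarrow> osc hb s n v \<in> fspan W UNIV" by auto
qed

section \<open>The grading operator\<close>

lemma osc_number:
  assumes "n \<ge> 1"
  shows "mon s n * osc hb s (int n) (bvec (w, m)) = scaleF (heis hb s n * of_nat (count m (s, n))) (bvec (w, m))"
proof (cases "(s, n) \<in># m")
  case True
  then have "add_mset (s, n) (m - {#(s, n)#}) = m" by simp
  then show ?thesis using assms by (simp add: osc_annihilation_bvec flip: bvec_add_mset)
qed (use assms in \<open>simp add: osc_annihilation_bvec not_in_iff\<close>)

definition occ :: "nat \<Rightarrow> (boson \<times> nat) multiset \<Rightarrow> nat" where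
  "occ n m = count m (Ba1, n) + count m (Ba2, n) + count m (Bc, n)"

lemma occ_add: "occ n (add_mset (t, k) m) = occ n m + (if n = k then 1 else 0)"
  by (cases t) (auto simp: occ_def)

lemma sum_occ: "finite A \<Longrightarrow> snd ` set_mset m \<subseteq> A \<Longrightarrow> (\<Sum>n\<in>A. n * occ n m) = mdeg m"
proof (induction m)
  case empty
  then show ?case by (simp add: occ_def mdeg_def)
next
  case (add x m)
  obtain t k where x: "x = (t, k)" by (cases x)
  have "(\<Sum>n\<in>A. n * occ n (add_mset x m)) = (\<Sum>n\<in>A. n * occ n m + (if n = k then k else 0))"
    by (intro sum.cong) (auto simp: x occ_add)
  also have "\<dots> = mdeg (add_mset x m)"
    using add by (simp add: sum.distrib x mdeg_def)
  finally show ?case .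
qed

definition deg_weight :: "weight \<Rightarrow> complex" where
  "deg_weight = (\<lambda>(l1, l2, l3). - ((l1 + l2) * (l1 - l2) + l3 * (l3 + 1)) / 2)"

context qgen
begin

text \<open>The mixed products of a^1 and a^2 cancel. The minus sign of the Ba2 term is undone by
  \<open>boson_sign Ba2\<close>, so all three bosons count with the same sign, and the prefactor
  makes each mode of index n count n.\<close>

lemma deg_summand:
  assumes n: "n \<ge> 1"
  shows "scaleF ((of_nat n)\<^sup>2 / (qint hb (of_nat n) * qint hb (2 * of_nat n)))
           (A1 hb (- int n) (A2 hb (int n) v) + A2 hb (- int n) (A1 hb (int n) v)
            + scaleF (qint hb (2 * of_nat n) / qint hb (of_nat n))
                (osc hb Bc (- int n) (osc hb Bc (int n) v)))
     = lin (\<lambda>b. scaleF (of_nat (n * occ n (snd b))) (bvec b)) v" (is "?L v = ?R v")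
proof (rule linop_eqI[where v = v])
  show "linop ?L"
    by (intro linop_scaleF linop_plus linop_comp[OF linop_A1 linop_A2] linop_comp[OF linop_A2 linop_A1]
        linop_comp[OF linop_osc linop_osc])
  show "linop ?R" by (rule linop_lin)
  fix b :: basis
  obtain w m where b: "b = (w, m)" by (cases b)
  let ?q = "qint hb (of_nat n)" and ?h = "(qpow hb (of_nat n) + qpow hb (- of_nat n)) / 2"
  have q0: "?q \<noteq> 0" by (rule qint_neq_0[OF n])
  \<comment> \<open>This ties [2n] to the normalization of \<open>A2\<close>; the factor
    \<open>2 * ?h\<close> cancels below.\<close>
  have q2: "qint hb (2 * of_nat n) = ?q * (2 * ?h)"
  proof -
    have "qpow hb (2 * of_nat n) = qpow hb (of_nat n) * qpow hb (of_nat n)"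
      "qpow hb (- (2 * of_nat n)) = qpow hb (- of_nat n) * qpow hb (- of_nat n)"
      unfolding qpow_add[symmetric] by (simp_all add: algebra_simps)
    then have e: "qpow hb (2 * of_nat n) - qpow hb (- (2 * of_nat n)) =
        (qpow hb (of_nat n) - qpow hb (- of_nat n)) * (qpow hb (of_nat n) + qpow hb (- of_nat n))"
      by (simp add: algebra_simps)
    have h: "2 * ?h = qpow hb (of_nat n) + qpow hb (- of_nat n)" by simp
    show ?thesis unfolding qint_def h e by simp
  qed
  have q20: "qint hb (2 * of_nat n) \<noteq> 0"
    using qint_neq_0[of "2 * n"] n by simp
  then have h0: "?h \<noteq> 0" using q2 by (metis mult_zero_right)
  let ?b = "bvec (w, m)"
  let ?x1 = "mon Ba1 n * osc hb Ba1 (int n) ?b" and ?x2 = "mon Ba2 n * osc hb Ba2 (int n) ?b"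
  have h: "(qpow hb (of_int (int n)) + qpow hb (- of_int (int n))) / 2 = ?h"
      "(qpow hb (of_int (- int n)) + qpow hb (- of_int (- int n))) / 2 = ?h"
    by (simp_all add: add.commute)
  have "A1 hb (- int n) (A2 hb (int n) ?b) + A2 hb (- int n) (A1 hb (int n) ?b) =
      (scaleF ?h ?x1 + scaleF ?h ?x1) - (scaleF ?h ?x2 + scaleF ?h ?x2)"
    unfolding A1_def A2_def h osc_creation[OF n] scaleF_mult_right distrib_left right_diff_distrib
      fock.scale_right_distrib fock.scale_right_diff_distrib
    by (simp only: algebra_simps)
  also have "\<dots> = scaleF (2 * ?h) ?x1 - scaleF (2 * ?h) ?x2"
    by (simp only: mult_2 fock.scale_left_distrib)
  also have "\<dots> = scaleF (2 * ?h * (?q\<^sup>2 / of_nat n) * (of_nat (count m (Ba1, n)) + of_nat (count m (Ba2, n)))) ?b"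
  proof -
    have "H * (1 * Q / N * k) - H * (- 1 * Q / N * l) = H * (Q / N) * (k + l)" for H Q N k l :: complex
      by (simp add: algebra_simps add_divide_distrib)
    then show ?thesis
      unfolding osc_number[OF n] heis_def boson_sign.simps
      by (simp only: fock.scale_scale fock.scale_left_diff_distrib[symmetric])
  qed
  finally have A: "A1 hb (- int n) (A2 hb (int n) ?b) + A2 hb (- int n) (A1 hb (int n) ?b) =
      scaleF (2 * ?h * (?q\<^sup>2 / of_nat n) * (of_nat (count m (Ba1, n)) + of_nat (count m (Ba2, n)))) ?b" .
  have C: "osc hb Bc (- int n) (osc hb Bc (int n) ?b) = scaleF (?q\<^sup>2 / of_nat n * of_nat (count m (Bc, n))) ?b"
    unfolding osc_creation[OF n] osc_number[OF n] by (simp add: heis_def)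
  define k1 k2 k3 :: complex where "k1 = of_nat (count m (Ba1, n))" and "k2 = of_nat (count m (Ba2, n))"
    and "k3 = of_nat (count m (Bc, n))"
  define N h q :: complex where "N = of_nat n" and "h = 2 * ?h" and "q = ?q"
  have "2 * ?h \<noteq> 0" using h0 by (metis mult_eq_0_iff zero_neq_numeral)
  then have nz: "N \<noteq> 0" "h \<noteq> 0" "q \<noteq> 0" using n q0 unfolding N_def h_def q_def by auto
  have e: "N\<^sup>2 / (q * (q * h)) * (h * (q\<^sup>2 / N) * (k1 + k2) + q * h / q * (q\<^sup>2 / N * k3)) = N * (k1 + k2 + k3)"
    using nz by (simp add: field_simps power2_eq_square)
  have "?L (bvec b) = scaleF (N * (k1 + k2 + k3)) ?b"
    unfolding b A C q2 fock.scale_scale fock.scale_left_distrib[symmetric]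
    by (simp only: e[unfolded k1_def k2_def k3_def N_def h_def q_def] k1_def k2_def k3_def N_def)
  then show "?L (bvec b) = ?R (bvec b)"
    by (simp add: b occ_def k1_def k2_def k3_def N_def)
qed

text \<open>On each vector the sum over m is finite, because only indices of modes present in it
  contribute; the zero modes give \<open>deg_weight\<close>.\<close>

lemma deg_op_eq: "deg_op hb v = diag deg_weight (- 1) v"
proof -
  let ?T = "\<lambda>n. lin (\<lambda>b. scaleF (of_nat (n * occ n (snd b))) (bvec b)) v"
  define A where "A = insert 0 (\<Union>b\<in>Poly_Mapping.keys v. snd ` set_mset (snd b))"
  have A: "finite A" by (simp add: A_def)
  have T0: "?T n = 0" if "n \<notin> A" for n
  proof (rule poly_mapping_eqI)
    fix b
    have "occ n (snd b) = 0" if "b \<in> Poly_Mapping.keys v"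
      using \<open>n \<notin> A\<close> that by (force simp: A_def occ_def count_eq_zero_iff)
    then show "Poly_Mapping.lookup (?T n) b = Poly_Mapping.lookup 0 b"
      by (auto simp: lookup_lin_diag in_keys_iff)
  qed
  have "Sum_any (\<lambda>m::nat. if m = 0 then 0 else
         scaleF ((of_nat m)\<^sup>2 / (qint hb (of_nat m) * qint hb (2 * of_nat m)))
           (A1 hb (- int m) (A2 hb (int m) v) + A2 hb (- int m) (A1 hb (int m) v)
            + scaleF (qint hb (2 * of_nat m) / qint hb (of_nat m))
                (osc hb Bc (- int m) (osc hb Bc (int m) v)))) = Sum_any (\<lambda>m. if m = 0 then 0 else ?T m)"
    by (intro Sum_any.cong) (simp add: deg_summand)
  also have "\<dots> = (\<Sum>m\<in>A. if m = 0 then 0 else ?T m)"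
    using A T0 by (intro Sum_any.expand_superset) auto
  also have "\<dots> = (\<Sum>m\<in>A. ?T m)"
    by (intro sum.cong) (auto simp: lin_def)
  also have "\<dots> = diag (\<lambda>_. 0) 1 v"
  proof (rule poly_mapping_eqI)
    fix b
    have "diag (\<lambda>_. 0) 1 = lin (\<lambda>b. scaleF (of_nat (mdeg (snd b))) (bvec b))"
      by (simp add: diag_def case_prod_beta')
    then have "Poly_Mapping.lookup (diag (\<lambda>_. 0) 1 v) b = of_nat (mdeg (snd b)) * Poly_Mapping.lookup v b"
      by (simp only: lookup_lin_diag)
    moreover have "(\<Sum>m\<in>A. of_nat (m * occ m (snd b))) = (of_nat (mdeg (snd b)) :: complex)"
      if "b \<in> Poly_Mapping.keys v"
    proof -
      have "snd ` set_mset (snd b) \<subseteq> A" using that by (auto simp: A_def)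
      from sum_occ[OF A this] show ?thesis by (metis of_nat_sum)
    qed
    ultimately show "Poly_Mapping.lookup (\<Sum>m\<in>A. ?T m) b = Poly_Mapping.lookup (diag (\<lambda>_. 0) 1 v) b"
      by (cases "b \<in> Poly_Mapping.keys v")
        (simp_all add: lookup_sum lookup_lin_diag in_keys_iff flip: sum_distrib_right)
  qed
  finally have "deg_op hb v = - diag (\<lambda>_. 0) 1 v
      - scaleF (1 / 2) (A1 hb 0 (A2 hb 0 v) + osc hb Bc 0 (osc hb Bc 0 v + v))"
    by (simp only: deg_op_def)
  also have "\<dots> = diag deg_weight (- 1) v"
  proof (rule linop_eqI[where v = v])
    show "linop (\<lambda>v. - diag (\<lambda>_. 0) 1 v - scaleF (1 / 2) (A1 hb 0 (A2 hb 0 v) + osc hb Bc 0 (osc hb Bc 0 v + v)))"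
      by (intro linop_minus linop_neg linop_scaleF linop_plus linop_diag linop_comp[OF linop_A1 linop_A2]
          linop_comp[OF linop_osc] linop_osc linop_id)
    fix b :: basis
    obtain l1 l2 l3 m where b: "b = ((l1, l2, l3), m)" by (cases b) auto
    show "- diag (\<lambda>_. 0) 1 (bvec b) - scaleF (1 / 2) (A1 hb 0 (A2 hb 0 (bvec b)) + osc hb Bc 0 (osc hb Bc 0 (bvec b) + bvec b))
        = diag deg_weight (- 1) (bvec b)"
    proof -
      have e: "- (0 + 1 * c) - 1 / 2 * ((l1 - l2) * (l1 + l2) + (l3 * l3 + l3)) = deg_weight (l1, l2, l3) + - 1 * c" for c
        by (simp add: deg_weight_def field_simps)
      have A: "A1 hb 0 (A2 hb 0 (bvec b)) = scaleF ((l1 - l2) * (l1 + l2)) (bvec b)"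
        by (simp add: A1_def A2_def b osc_0_bvec linop_diff[OF linop_osc] linop_scale[OF linop_osc]
            algebra_simps fock.scale_left_distrib fock.scale_left_diff_distrib)
      have C: "osc hb Bc 0 (osc hb Bc 0 (bvec b) + bvec b) = scaleF (l3 * l3 + l3) (bvec b)"
        by (simp add: b osc_0_bvec linop_add[OF linop_osc] linop_scale[OF linop_osc] fock.scale_left_distrib)
      show ?thesis
        unfolding A C unfolding b diag_bvec
        by (simp only: fock.scale_minus_left[symmetric] fock.scale_left_distrib[symmetric] fock.scale_scale
            fock.scale_left_diff_distrib[symmetric] e)
    qed
  qed (rule linop_diag)
  finally show ?thesis .
qed

end

section \<open>The action on the Fock modules\<close>

abbreviation fwts :: "complex \<Rightarrow> complex \<Rightarrow> weight set" where
  "fwts \<alpha> \<beta> \<equiv> orbit (\<beta> - \<alpha>, - \<beta>, \<alpha>)"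

lemma fock_sum_eq: "fock_sum \<alpha> \<beta> = fspan (fwts \<alpha> \<beta>) UNIV"
  by (auto simp: fock_sum_def fspan_def orbit_def)

lemma subspace_fock_sum: "fock.subspace (fock_sum \<alpha> \<beta>)"
  unfolding fock_sum_eq by (rule subspace_fspan)

lemma fock_sum_subset: "fock_sum \<alpha> \<beta> \<subseteq> fspan UNIV UNIV"
  unfolding fock_sum_eq by (rule fspan_mono) auto

lemma orbit_iff: "x \<in> orbit (l1, l2, l3) \<longleftrightarrow> (\<exists>i::int. x = (l1 + of_int i, l2 - of_int i, l3 + of_int i))"
  by (auto simp: orbit_def)

lemma orbit_shift:
  assumes "k = 1 \<or> k = - 1"
  shows "shifted (of_int k) (of_int k) (orbit w) \<subseteq> orbit w"
proof
  fix x assume x: "x \<in> shifted (of_int k) (of_int k) (orbit w)"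
  obtain l1 l2 l3 where w: "w = (l1, l2, l3)" by (cases w) auto
  obtain i :: int where "x = (l1 + of_int i + of_int k, l2 - of_int i - of_int k, l3 + of_int i + of_int k)"
    using x by (auto simp: shifted_def w orbit_iff)
  then have "x = (l1 + of_int (i + k), l2 - of_int (i + k), l3 + of_int (i + k))" by simp
  then show "x \<in> orbit w" unfolding w orbit_iff by blast
qed

text \<open>Translating only the third entry by k amounts to replacing i by i + k and \<beta> by
  \<beta> - k.\<close>

lemma fwts_shift: "shifted 0 (of_int k) (fwts \<alpha> \<beta>) \<subseteq> fwts \<alpha> (\<beta> - of_int k)"
proof
  fix x assume "x \<in> shifted 0 (of_int k) (fwts \<alpha> \<beta>)"
  then obtain i :: int where "x = (\<beta> - \<alpha> + of_int i, - \<beta> - of_int i, \<alpha> + of_int i + of_int k)"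
    by (auto simp: shifted_def orbit_iff)
  then have "x = (\<beta> - of_int k - \<alpha> + of_int (i + k), - (\<beta> - of_int k) - of_int (i + k), \<alpha> + of_int (i + k))"
    by simp
  then show "x \<in> fwts \<alpha> (\<beta> - of_int k)" unfolding orbit_iff by blast
qed

lemma fwts_sum: "(l1, l2, l3) \<in> fwts \<alpha> \<beta> \<Longrightarrow> l1 + l2 = - \<alpha>"
  and fwts_third: "(l1, l2, l3) \<in> fwts \<alpha> \<beta> \<Longrightarrow> \<exists>i. l3 = \<alpha> + of_int i"
  by (auto simp: orbit_def)

lemma fock_sum_integral:
  assumes "\<alpha> \<in> \<int>" "v \<in> fock_sum \<alpha> \<beta>" "r \<in> \<int>"
  shows "v \<in> fspan {(l1, l2, l3). r - l3 \<in> \<int>} UNIV"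
proof -
  have "r - l3 \<in> \<int>" if "(l1, l2, l3) \<in> fwts \<alpha> \<beta>" for l1 l2 l3
    using fwts_third[OF that] assms by auto
  then have "fwts \<alpha> \<beta> \<subseteq> {(l1, l2, l3). r - l3 \<in> \<int>}" by auto
  then show ?thesis
    using assms(2) fspan_mono[of "fwts \<alpha> \<beta>" _ UNIV UNIV] unfolding fock_sum_eq by blast
qed

lemma vop_fock_sum:
  assumes "v \<in> fock_sum \<alpha> \<beta>" "\<sigma> = 1 \<and> \<tau> = 1 \<or> \<sigma> = - 1 \<and> \<tau> = - 1"
  shows "vop hb \<sigma> \<kappa> \<tau> s p v \<in> fock_sum \<alpha> \<beta>"
proof -
  have "shifted \<sigma> \<tau> (fwts \<alpha> \<beta>) \<subseteq> fwts \<alpha> \<beta>"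
    using assms(2) orbit_shift[of 1 "(\<beta> - \<alpha>, - \<beta>, \<alpha>)"] orbit_shift[of "- 1" "(\<beta> - \<alpha>, - \<beta>, \<alpha>)"]
    by (elim disjE conjE) simp_all
  from fspan_mono[OF this order_refl] vop_fspan[of \<sigma> UNIV \<tau> v "fwts \<alpha> \<beta>" hb \<kappa> s p]
  show ?thesis using assms(1) unfolding fock_sum_eq by blast
qed

lemma eta_0: "eta hb 0 = vop hb 0 0 1 0 (- 1)"
  and xi_0: "xi hb 0 = vop hb 0 0 (- 1) 0 0"
  by (simp_all add: eta_def xi_def)

lemma linop_eta: "linop (eta hb n)" and linop_xi: "linop (xi hb n)"
  by (simp_all add: eta_def xi_def linop_vop)

lemma eta_0_fock_sum: "v \<in> fock_sum \<alpha> \<beta> \<Longrightarrow> eta hb 0 v \<in> fock_sum \<alpha> (\<beta> - 1)"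
  using vop_fspan[of 0 UNIV 1 v "fwts \<alpha> \<beta>" hb 0 0 "- 1"] fspan_mono[OF fwts_shift[where k = 1 and \<alpha> = \<alpha> and \<beta> = \<beta>] order_refl, of UNIV]
  unfolding fock_sum_eq eta_0 by auto

lemma xi_0_fock_sum: "v \<in> fock_sum \<alpha> \<beta> \<Longrightarrow> xi hb 0 v \<in> fock_sum \<alpha> (\<beta> + 1)"
  using vop_fspan[of 0 UNIV "- 1" v "fwts \<alpha> \<beta>" hb 0 0 0] fspan_mono[OF fwts_shift[where k = "- 1" and \<alpha> = \<alpha> and \<beta> = \<beta>] order_refl, of UNIV]
  unfolding fock_sum_eq xi_0 by auto

lemma Kp_eq: "fock_act hb (Kp j) = diag (\<lambda>w. qpow hb (cartan_eigenvalue j w)) 0"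
  and Km_eq: "fock_act hb (Km j) = diag (\<lambda>w. qpow hb (- cartan_eigenvalue j w)) 0"
  by (simp_all add: diag_def)

context qgen
begin

lemma D_eq: "fock_act hb D = diag deg_weight (- 1)"
  by (simp add: fun_eq_iff deg_op_eq)

lemma linop_X_plus: "linop (X_plus hb n)"
  by (simp add: X_plus_def linop_vop)

lemma linop_X_minus: "linop (X_minus hb n)"
  unfolding X_minus_def[abs_def] by (intro linop_scaleF linop_minus linop_vop)

lemma linop_act: "linop (fock_act hb x)"
proof (cases x)
  case D
  then show ?thesis using D_eq linop_diag by simp
next
  case (Kp j)
  then show ?thesis using Kp_eq linop_diag by simp
next
  case (Km j)
  then show ?thesis using Km_eq linop_diag by simp
qed (simp_all add: linop_X_plus linop_X_minus linop_A1 linop_A2 linop_id)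

lemma act_fock_sum: "v \<in> fock_sum \<alpha> \<beta> \<Longrightarrow> fock_act hb x v \<in> fock_sum \<alpha> \<beta>"
proof (cases x)
  case (Xp n)
  assume "v \<in> fock_sum \<alpha> \<beta>"
  then show ?thesis by (simp add: Xp X_plus_def vop_fock_sum)
next
  case (Xm n)
  assume "v \<in> fock_sum \<alpha> \<beta>"
  then show ?thesis
    by (simp add: Xm X_minus_def vop_fock_sum fock.subspace_scale fock.subspace_diff subspace_fock_sum)
next
  case (H1 n)
  assume "v \<in> fock_sum \<alpha> \<beta>"
  then show ?thesis
    by (simp add: H1 A1_def fock_sum_eq osc_fspan fock.subspace_add subspace_fspan)
next
  case (H2 n)
  assume "v \<in> fock_sum \<alpha> \<beta>"
  then show ?thesis
    by (simp add: H2 A2_def fock_sum_eq osc_fspan fock.subspace_diff fock.subspace_scale subspace_fspan)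
next
  case D
  assume "v \<in> fock_sum \<alpha> \<beta>"
  then show ?thesis unfolding D D_eq fock_sum_eq by (rule diag_fspan)
next
  case (Kp j)
  assume "v \<in> fock_sum \<alpha> \<beta>"
  then show ?thesis unfolding Kp Kp_eq fock_sum_eq by (rule diag_fspan)
next
  case (Km j)
  assume "v \<in> fock_sum \<alpha> \<beta>"
  then show ?thesis unfolding Km Km_eq fock_sum_eq by (rule diag_fspan)
qed simp

section \<open>Commutation of \<eta>_0 and \<xi>_0 with the generators\<close>

definition par :: "gen \<Rightarrow> complex" where
  "par x = (case x of Xp _ \<Rightarrow> - 1 | Xm _ \<Rightarrow> - 1 | _ \<Rightarrow> 1)"

lemma fock_double_0: "(x :: fock) + x = 0 \<Longrightarrow> x = 0"
proof -
  assume "x + x = 0"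
  then have "scaleF 2 x = 0" using fock.scale_left_distrib[of 1 1 x] by simp
  then show "x = 0" by simp
qed

lemma vop_act_commute:
  assumes "\<tau> * \<tau> = 1" "v \<in> fspan UNIV UNIV"
  shows "\<forall>n. x \<noteq> Xp n \<and> x \<noteq> Xm n \<and> x \<noteq> D \<Longrightarrow>
    vop hb 0 0 \<tau> 0 p (fock_act hb x v) = fock_act hb x (vop hb 0 0 \<tau> 0 p v)"
proof (cases x)
  case (H1 n)
  then show ?thesis using assms(2)
    by (simp add: A1_def linop_add[OF linop_vop] vop_osc_commute)
next
  case (H2 n)
  then show ?thesis using assms(2)
    by (simp add: A2_def linop_diff[OF linop_vop] linop_scale[OF linop_vop] vop_osc_commute)
next
  case (Kp j)
  have "qpow hb (cartan_eigenvalue j (l1, l2, l3 + \<tau>)) = qpow hb (cartan_eigenvalue j (l1, l2, l3)) + \<tau> * l3 * 0 + 0" for l1 l2 l3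
    by (cases j) simp_all
  from vop_diag_commute[of "\<lambda>w. qpow hb (cartan_eigenvalue j w)", OF this assms(2)]
  show ?thesis unfolding Kp Kp_eq by simp
next
  case (Km j)
  have "qpow hb (- cartan_eigenvalue j (l1, l2, l3 + \<tau>)) = qpow hb (- cartan_eigenvalue j (l1, l2, l3)) + \<tau> * l3 * 0 + 0" for l1 l2 l3
    by (cases j) simp_all
  from vop_diag_commute[of "\<lambda>w. qpow hb (- cartan_eigenvalue j w)", OF this assms(2)]
  show ?thesis unfolding Km Km_eq by simp
qed auto

text \<open>The commutator with the grading is -p - (1 + \<tau>)/2 times the mode. The stated p
  makes it vanish: it is -1 for \<tau> = 1, the mode \<eta>_0, and 0 for \<tau> = -1, the mode
  \<xi>_0.\<close>

lemma vop_D_commute: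
  assumes "\<tau> * \<tau> = 1" "v \<in> fspan UNIV UNIV" "p = - (1 + \<tau>) / 2"
  shows "vop hb 0 0 \<tau> 0 p (fock_act hb D v) = fock_act hb D (vop hb 0 0 \<tau> 0 p v)"
proof -
  have "deg_weight (l1, l2, l3 + \<tau>) = deg_weight (l1, l2, l3) + \<tau> * l3 * (- 1) + (- (1 + \<tau>) / 2)" for l1 l2 l3
  proof -
    have "(l3 + \<tau>) * (l3 + \<tau> + 1) = l3 * (l3 + 1) + 2 * \<tau> * l3 + 1 + \<tau>"
      using assms(1) by (simp add: algebra_simps)
    then show ?thesis by (simp add: deg_weight_def) (simp add: field_simps)
  qed
  from vop_diag_commute[of deg_weight, OF this assms(2), of hb p]
  show ?thesis unfolding D_eq by (simp add: assms(3))
qed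

text \<open>X^- is a difference of exponentials at s = 1 and s = -1. If both have the same
  anticommutator c with f, it drops out: a q-derivative has no residue.\<close>

lemma X_minus_anticommute:
  assumes f: "linop f"
    and V: "\<And>s. s = 1 \<or> s = - 1 \<Longrightarrow> vop hb (- 1) (1 / 2) (- 1) s (- of_int n) (f v)
      + f (vop hb (- 1) (1 / 2) (- 1) s (- of_int n) v) = c"
  shows "f (X_minus hb n v) = - X_minus hb n (f v)"
proof -
  let ?V = "\<lambda>s. vop hb (- 1) (1 / 2) (- 1) s (- of_int n)"
  have "(?V 1 (f v) - ?V (- 1) (f v)) + (f (?V 1 v) - f (?V (- 1) v)) = 0"
    by (simp only: add_diff_add[symmetric] V diff_self simp_thms)
  then have "X_minus hb n (f v) + f (X_minus hb n v) = 0"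
    unfolding X_minus_def linop_scale[OF f] linop_diff[OF f] fock.scale_right_distrib[symmetric] by simp
  then show ?thesis by (simp add: eq_neg_iff_add_eq_0 add.commute)
qed

lemma eta_0_act:
  assumes a: "\<alpha> \<in> \<int>" and v: "v \<in> fock_sum \<alpha> \<beta>"
  shows "eta hb 0 (fock_act hb x v) = scaleF (par x) (fock_act hb x (eta hb 0 v))"
proof -
  have v': "v \<in> fspan UNIV UNIV" using v fock_sum_subset by auto
  note v'' = fock_sum_integral[OF a v, of "- 1", OF Ints_minus[OF Ints_1]]
  show ?thesis
  proof (cases x)
    case (Xp n)
    have "X_plus hb n (eta hb 0 v) + eta hb 0 (X_plus hb n v) = 0"
      unfolding X_plus_def eta_0 by (rule vop_anticommute[OF _ v']) simp
    then show ?thesis by (simp add: Xp par_def eq_neg_iff_add_eq_0 add.commute)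
  next
    case (Xm n)
    \<comment> \<open>\<eta>_0 is the power r = -1, for which the factor q^(-s (r + 1)) is 1 and s
      disappears.\<close>
    have "eta hb 0 (X_minus hb n v) = - X_minus hb n (eta hb 0 v)"
      unfolding eta_0 using vop_anticommute_dual[OF v'', of "- 1" "1 / 2" _ "- of_int n"]
      by (intro X_minus_anticommute linop_vop) auto
    then show ?thesis by (simp add: Xm par_def)
  next
    case D
    show ?thesis unfolding eta_0 D using vop_D_commute[of 1 v "- 1", OF _ v'] by (simp add: par_def)
  qed (use vop_act_commute[of 1 v x "- 1", OF _ v'] in \<open>simp_all add: par_def eta_0\<close>)
qed

lemma xi_0_act:
  assumes v: "v \<in> fock_sum \<alpha> \<beta>" and x: "x \<notin> range Xp"
  shows "xi hb 0 (fock_act hb x v) = scaleF (par x) (fock_act hb x (xi hb 0 v))"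
proof -
  have v': "v \<in> fspan UNIV UNIV" using v fock_sum_subset by auto
  show ?thesis
  proof (cases x)
    case (Xp n)
    then show ?thesis using x by simp
  next
    case (Xm n)
    have "xi hb 0 (X_minus hb n v) = - X_minus hb n (xi hb 0 v)"
      unfolding xi_0 by (rule X_minus_anticommute[where c = 0]) (simp_all add: linop_vop vop_anticommute v')
    then show ?thesis by (simp add: Xm par_def)
  next
    case D
    show ?thesis unfolding xi_0 D using vop_D_commute[of "- 1" v 0, OF _ v'] by (simp add: par_def)
  qed (use vop_act_commute[of "- 1" v x 0, OF _ v'] in \<open>simp_all add: par_def xi_0\<close>)
qed

lemma eta_0_eta_0: "v \<in> fock_sum \<alpha> \<beta> \<Longrightarrow> eta hb 0 (eta hb 0 v) = 0"
  unfolding eta_0 by (rule fock_double_0, rule vop_anticommute) (use fock_sum_subset in auto)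

text \<open>The pole in the product of \<eta> and \<xi> has residue 1: \<open>vop_trivial\<close>
  gives the identity at p + r + 1 = 0, here with p = 0 and r = -1.\<close>

lemma eta_xi:
  assumes a: "\<alpha> \<in> \<int>" and v: "v \<in> fock_sum \<alpha> \<beta>"
  shows "eta hb 0 (xi hb 0 v) + xi hb 0 (eta hb 0 v) = v"
proof -
  note v'' = fock_sum_integral[OF a v, of "- 1", OF Ints_minus[OF Ints_1]]
  have "v \<in> fspan UNIV UNIV" using v fock_sum_subset by auto
  then show ?thesis
    using vop_anticommute_dual[OF v'', of 0 0 0 0] by (simp add: eta_0 xi_0 vop_trivial add.commute)
qed

section \<open>Kernel and cokernel\<close>

text \<open>On the kernel of \<eta>_0 the relation \<open>eta_xi\<close> reduces to v = \<eta>_0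
  \<xi>_0 v; conversely \<eta>_0 squares to 0.\<close>

lemma car_KerM:
  assumes a: "\<alpha> \<in> \<int>"
  shows "car (KerM hb \<alpha> \<beta>) = {v \<in> fock_sum \<alpha> \<beta>. eta hb 0 v = 0}"
proof -
  have "eta hb 0 (xi hb 0 v) \<in> fock_sum \<alpha> \<beta>" if "v \<in> fock_sum \<alpha> \<beta>" for v
    using eta_0_fock_sum[OF xi_0_fock_sum[OF that]] by simp
  moreover have "eta hb 0 (eta hb 0 (xi hb 0 v)) = 0" if "v \<in> fock_sum \<alpha> \<beta>" for v
    by (rule eta_0_eta_0[OF xi_0_fock_sum[OF that]])
  moreover have "v = eta hb 0 (xi hb 0 v)" if "v \<in> fock_sum \<alpha> \<beta>" "eta hb 0 v = 0" for v
    using eta_xi[OF a that(1)] that(2) by (simp add: linop_zero[OF linop_xi])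
  ultimately show ?thesis by (auto simp: KerM_def)
qed

lemma xi_eta_fock_sum: "v \<in> fock_sum \<alpha> \<beta> \<Longrightarrow> xi hb 0 (eta hb 0 v) \<in> fock_sum \<alpha> \<beta>"
  using xi_0_fock_sum[OF eta_0_fock_sum[of v \<alpha> \<beta>]] by simp

lemma eta_xi_eta:
  assumes a: "\<alpha> \<in> \<int>" and v: "v \<in> fock_sum \<alpha> \<beta>"
  shows "eta hb 0 (xi hb 0 (eta hb 0 v)) = eta hb 0 v"
  using eta_xi[OF a eta_0_fock_sum[OF v, of hb]] eta_0_eta_0[OF v] by (simp add: linop_zero[OF linop_xi])

lemma car_CokerM:
  assumes a: "\<alpha> \<in> \<int>"
  shows "car (CokerM hb \<alpha> \<beta>) = {v \<in> fock_sum \<alpha> \<beta>. xi hb 0 (eta hb 0 v) = v}"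
proof -
  have "xi hb 0 (eta hb 0 (xi hb 0 (eta hb 0 v))) = xi hb 0 (eta hb 0 v)" if "v \<in> fock_sum \<alpha> \<beta>" for v
    by (simp only: eta_xi_eta[OF a that])
  moreover have "v \<in> (\<lambda>v. xi hb 0 (eta hb 0 v)) ` fock_sum \<alpha> \<beta>"
    if "v \<in> fock_sum \<alpha> \<beta>" "xi hb 0 (eta hb 0 v) = v" for v
    by (rule image_eqI[where x = v]) (use that in simp_all)
  ultimately show ?thesis by (auto simp: CokerM_def xi_eta_fock_sum)
qed

lemma linop_linear_on: "linop f \<Longrightarrow> linear_on S f"
  by (simp add: linear_on_def linop_add linop_scale)

lemma umodule_FockM: "umodule (FockM hb \<alpha> \<beta>)"
  by (auto simp: umodule_def FockM_def subspace_fock_sum linop_linear_on linop_act act_fock_sum)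

lemma subspace_linop_kernel: "linop f \<Longrightarrow> fock.subspace S \<Longrightarrow> fock.subspace {v \<in> S. f v = 0}"
  by (auto simp: fock.subspace_def linop_zero linop_add linop_scale)

lemma umodule_KerM:
  assumes a: "\<alpha> \<in> \<int>"
  shows "umodule (KerM hb \<alpha> \<beta>)"
proof -
  have "fock.subspace (car (KerM hb \<alpha> \<beta>))"
    unfolding car_KerM[OF a] by (rule subspace_linop_kernel[OF linop_eta subspace_fock_sum])
  moreover have "act (KerM hb \<alpha> \<beta>) = fock_act hb" by (simp add: KerM_def)
  moreover have "fock_act hb x v \<in> car (KerM hb \<alpha> \<beta>)" if "v \<in> car (KerM hb \<alpha> \<beta>)" for x v
    using that eta_0_act[OF a, of v \<beta> x]
    by (auto simp: car_KerM[OF a] act_fock_sum linop_zero[OF linop_act])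
  ultimately show ?thesis
    by (auto simp: umodule_def linop_linear_on linop_act)
qed

lemma umodule_CokerM:
  assumes a: "\<alpha> \<in> \<int>"
  shows "umodule (CokerM hb \<alpha> \<beta>)"
proof -
  have "fock.subspace (car (CokerM hb \<alpha> \<beta>))"
    unfolding car_CokerM[OF a] using subspace_fock_sum[of \<alpha> \<beta>]
    by (auto simp: fock.subspace_def linop_zero[OF linop_eta] linop_zero[OF linop_xi] linop_add[OF linop_eta]
        linop_add[OF linop_xi] linop_scale[OF linop_eta] linop_scale[OF linop_xi])
  moreover have "act (CokerM hb \<alpha> \<beta>) = (\<lambda>x v. xi hb 0 (eta hb 0 (fock_act hb x v)))"
    by (simp add: CokerM_def)
  moreover have "xi hb 0 (eta hb 0 (fock_act hb x v)) \<in> car (CokerM hb \<alpha> \<beta>)" if "v \<in> car (CokerM hb \<alpha> \<beta>)" for x v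
    using that act_fock_sum by (auto simp: CokerM_def xi_eta_fock_sum)
  moreover have "linop (\<lambda>v. xi hb 0 (eta hb 0 (fock_act hb x v)))" for x
    by (intro linop_comp[OF linop_xi] linop_comp[OF linop_eta] linop_act)
  ultimately show ?thesis
    by (auto simp: umodule_def linop_linear_on)
qed

lemma FockM_decomposes:
  assumes a: "\<alpha> \<in> \<int>"
  shows "decomposes (FockM hb \<alpha> \<beta>) (KerM hb \<alpha> \<beta>) (CokerM hb \<alpha> \<beta>)"
proof -
  let ?K = "car (KerM hb \<alpha> \<beta>)" and ?C = "car (CokerM hb \<alpha> \<beta>)"
  have K: "umodule (KerM hb \<alpha> \<beta>)" by (rule umodule_KerM[OF a])
  have "submodule (FockM hb \<alpha> \<beta>) ?K"
  proof -
    have "?K \<subseteq> fock_sum \<alpha> \<beta>" by (auto simp: car_KerM[OF a])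
    moreover have "act (KerM hb \<alpha> \<beta>) = fock_act hb" by (simp add: KerM_def)
    ultimately show ?thesis using K by (simp add: umodule_def submodule_def FockM_def)
  qed
  moreover have "?K \<inter> ?C = {0}"
    by (auto simp: car_KerM[OF a] car_CokerM[OF a] linop_zero[OF linop_eta] linop_zero[OF linop_xi]
        fock.subspace_0[OF subspace_fock_sum])
  moreover have "car (FockM hb \<alpha> \<beta>) = {k + c | k c. k \<in> ?K \<and> c \<in> ?C}"
  proof (intro equalityI subsetI)
    fix v assume v: "v \<in> car (FockM hb \<alpha> \<beta>)"
    then have "v \<in> fock_sum \<alpha> \<beta>" by (simp add: FockM_def)
    then have "v = eta hb 0 (xi hb 0 v) + xi hb 0 (eta hb 0 v)"
      "eta hb 0 (xi hb 0 v) \<in> ?K" "xi hb 0 (eta hb 0 v) \<in> ?C"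
      using eta_xi[OF a, of v \<beta>] by (auto simp: KerM_def CokerM_def)
    then show "v \<in> {k + c | k c. k \<in> ?K \<and> c \<in> ?C}" by blast
  next
    fix v assume "v \<in> {k + c | k c. k \<in> ?K \<and> c \<in> ?C}"
    then show "v \<in> car (FockM hb \<alpha> \<beta>)"
      by (auto simp: car_KerM[OF a] car_CokerM[OF a] FockM_def fock.subspace_add[OF subspace_fock_sum])
  qed
  moreover have "act (FockM hb \<alpha> \<beta>) x c - act (CokerM hb \<alpha> \<beta>) x c \<in> ?K" if "c \<in> ?C" for x c
  proof -
    have "fock_act hb x c \<in> fock_sum \<alpha> \<beta>" using that by (simp add: car_CokerM[OF a] act_fock_sum)
    moreover from this have "fock_act hb x c - xi hb 0 (eta hb 0 (fock_act hb x c)) = eta hb 0 (xi hb 0 (fock_act hb x c))"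
      using eta_xi[OF a, of "fock_act hb x c" \<beta>] by (metis add_diff_cancel_right')
    ultimately show ?thesis by (auto simp: FockM_def CokerM_def KerM_def)
  qed
  moreover have "act (KerM hb \<alpha> \<beta>) = act (FockM hb \<alpha> \<beta>)" by (simp add: KerM_def FockM_def)
  ultimately show ?thesis
    unfolding decomposes_def using umodule_FockM umodule_CokerM[OF a] by simp
qed

text \<open>Moving a generator through \<eta>_0 and then through \<xi>_0 produces the sign
  \<open>par x\<close> twice; the second move is the one that fails for X^+.\<close>

lemma CokerM_act_eq:
  assumes a: "\<alpha> \<in> \<int>" and x: "x \<notin> range Xp" and v: "v \<in> car (CokerM hb \<alpha> \<beta>)"
  shows "act (CokerM hb \<alpha> \<beta>) x v = act (FockM hb \<alpha> \<beta>) x v"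
proof -
  have v': "v \<in> fock_sum \<alpha> \<beta>" "xi hb 0 (eta hb 0 v) = v" using v by (auto simp: car_CokerM[OF a])
  have "xi hb 0 (eta hb 0 (fock_act hb x v)) = scaleF (par x) (scaleF (par x) (fock_act hb x (xi hb 0 (eta hb 0 v))))"
    using xi_0_act[OF eta_0_fock_sum[OF v'(1)] x] by (simp add: eta_0_act[OF a v'(1)] linop_scale[OF linop_xi])
  then show ?thesis by (simp add: CokerM_def FockM_def v' par_def split: gen.splits)
qed

text \<open>The parity (-1)^(c_0), continued to complex eigenvalues of c_0. What matters is that it
  is nonzero and changes sign when l3 moves by 1.\<close>

definition psgn :: "weight \<Rightarrow> complex" where
  "psgn = (\<lambda>(l1, l2, l3). exp (\<i> * of_real pi * l3))"

lemma diag_vop: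
  assumes f: "\<And>l1 l2 l3. f (l1 + \<sigma>, l2 - \<sigma>, l3 + \<tau>) = - f (l1, l2, l3)" and v: "v \<in> fspan UNIV UNIV"
  shows "diag f 0 (vop hb \<sigma> \<kappa> \<tau> s p v) = - vop hb \<sigma> \<kappa> \<tau> s p (diag f 0 v)"
  using v
proof (induction p v rule: fspan_param_induct)
  case (vac p w)
  obtain l1 l2 l3 where w: "w = (l1, l2, l3)" by (cases w) auto
  have "diag f 0 (eser (cgen hb \<sigma> \<kappa> \<tau> s) $ k * u) = eser (cgen hb \<sigma> \<kappa> \<tau> s) $ k * diag f 0 u
      + scaleF (of_nat k * 0) (eser (cgen hb \<sigma> \<kappa> \<tau> s) $ k * u)" for k u
    by (rule eser_commute[OF linop_diag])
      (simp add: cgen_def distrib_right linop_add[OF linop_diag] linop_scale[OF linop_diag] diag_mon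
        fock.scale_right_distrib)
  then have "diag f 0 (cidx (cser hb \<sigma> \<kappa> \<tau> s) x * u) = cidx (cser hb \<sigma> \<kappa> \<tau> s) x * diag f 0 u" for x u
    by (cases "x \<in> \<nat>") (auto simp: cser_def cidx_not_Nats linop_zero[OF linop_diag] elim!: Nats_cases)
  then show ?case
    by (simp add: w vop_vac mult.commute[of "vac _"] linop_scale[OF linop_diag] linop_scale[OF linop_vop]
        diag_vac f fock.scale_left_commute)
next
  case (mult p t n u)
  then show ?case
    by (simp add: vop_mon diag_mon linop_add[OF linop_diag] linop_scale[OF linop_diag] fock.scale_right_distrib)
qed (intro linop_subspace_eq linop_comp[OF linop_diag linop_vop] linop_neg linop_comp[OF linop_vop linop_diag])

lemma diag_osc: "diag f 0 (osc hb s n v) = osc hb s n (diag f 0 v)"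
proof (rule linop_eqI[where v = v])
  fix b :: basis
  obtain w m where b: "b = (w, m)" by (cases b)
  have "\<exists>c m'. osc hb s n (bvec b) = scaleF c (bvec (w, m'))"
    unfolding b osc_def lin_bvec prod.case
    by (cases "n < 0"; cases "n > 0") (simp, metis fock.scale_one, auto)
  then obtain c m' where c: "osc hb s n (bvec b) = scaleF c (bvec (w, m'))" by blast
  have "diag f 0 (osc hb s n (bvec b)) = scaleF (f w) (osc hb s n (bvec b))"
    unfolding c by (simp add: linop_scale[OF linop_diag] diag_bvec mult.commute)
  moreover have "diag f 0 (bvec b) = scaleF (f w) (bvec b)" by (simp add: b diag_bvec)
  ultimately show "diag f 0 (osc hb s n (bvec b)) = osc hb s n (diag f 0 (bvec b))"
    by (simp add: linop_scale[OF linop_osc])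
qed (intro linop_comp[OF linop_diag linop_osc] linop_comp[OF linop_osc linop_diag])+

lemma diag_diag: "diag f c (diag g d v) = diag g d (diag f c v)"
  by (rule linop_eqI[where v = v])
    (auto intro!: linop_comp[OF linop_diag linop_diag] simp: diag_bvec linop_scale[OF linop_diag] mult.commute)

lemma psgn_shift: "psgn (l1 + \<sigma>, l2 - \<sigma>, l3 + 1) = - psgn (l1, l2, l3)"
  "psgn (l1 + \<sigma>, l2 - \<sigma>, l3 - 1) = - psgn (l1, l2, l3)"
  by (simp_all add: psgn_def distrib_left right_diff_distrib exp_add exp_diff)

lemma diag_psgn_act:
  assumes "v \<in> fspan UNIV UNIV"
  shows "diag psgn 0 (fock_act hb x v) = scaleF (par x) (fock_act hb x (diag psgn 0 v))"
proof (cases x)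
  case (Xp n)
  show ?thesis
    using diag_vop[of psgn 1 1 v, OF _ assms] by (simp add: Xp X_plus_def par_def psgn_shift)
next
  case (Xm n)
  have "psgn (l1 + - 1, l2 - - 1, l3 + - 1) = - psgn (l1, l2, l3)" for l1 l2 l3
    using psgn_shift(2)[of l1 "- 1"] by simp
  then show ?thesis
    using diag_vop[of psgn "- 1" "- 1" v, OF _ assms]
    by (simp add: Xm X_minus_def par_def linop_scale[OF linop_diag] linop_diff[OF linop_diag]
        fock.scale_right_diff_distrib)
next
  case (H1 n)
  then show ?thesis by (simp add: A1_def par_def linop_add[OF linop_diag] diag_osc)
next
  case (H2 n)
  then show ?thesis by (simp add: A2_def par_def linop_scale[OF linop_diag] linop_diff[OF linop_diag] diag_osc)
next
  case D
  show ?thesis unfolding D D_eq by (simp add: par_def diag_diag[of psgn])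
next
  case (Kp j)
  show ?thesis unfolding Kp Kp_eq by (simp add: par_def diag_diag[of psgn])
next
  case (Km j)
  show ?thesis unfolding Km Km_eq by (simp add: par_def diag_diag[of psgn])
qed (simp add: par_def)

lemma diag_inverse: "(\<And>w. f w * g w = 1) \<Longrightarrow> diag f 0 (diag g 0 v) = v"
  by (rule linop_eqI[where v = v])
    (auto intro!: linop_comp[OF linop_diag linop_diag] linop_id simp: diag_bvec linop_scale[OF linop_diag] mult.commute)

text \<open>\<open>\<eta>\<^sub>0\<close> anticommutes with the odd generators; the parity twist \<open>diag psgn 0\<close> corrects the sign.\<close>

lemma CokerM_iso_KerM:
  assumes a: "\<alpha> \<in> \<int>"
  shows "CokerM hb \<alpha> \<beta> \<cong>\<^sub>U KerM hb \<alpha> (\<beta> - 1)"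
proof -
  let ?P = "diag psgn 0" and ?R = "diag (\<lambda>w. inverse (psgn w)) 0"
  let ?\<Phi> = "\<lambda>v. ?P (eta hb 0 v)"
  let ?C = "car (CokerM hb \<alpha> \<beta>)" and ?K = "car (KerM hb \<alpha> (\<beta> - 1))"
  have psgn0: "psgn w \<noteq> 0" for w by (cases w) (simp add: psgn_def)
  have PR: "?P (?R v) = v" and RP: "?R (?P v) = v" for v
    by (rule diag_inverse, simp add: psgn0)+
  have eta_diag: "eta hb 0 (diag f 0 v) = - diag f 0 (eta hb 0 v)"
    if "v \<in> fock_sum \<alpha> \<beta>'" "\<And>l1 l2 l3. f (l1, l2, l3 + 1) = - f (l1, l2, l3)" for v f \<beta>'
  proof -
    have "v \<in> fspan UNIV UNIV" by (rule subsetD[OF fock_sum_subset that(1)])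
    then show ?thesis
      using diag_vop[of f 0 1 v] that(2) by (simp add: eta_0)
  qed
  have p1: "psgn (l1, l2, l3 + 1) = - psgn (l1, l2, l3)" for l1 l2 l3
    using psgn_shift(1)[of l1 0] by simp
  have K: "?\<Phi> v \<in> ?K" if "v \<in> ?C" for v
  proof -
    have "v \<in> fock_sum \<alpha> \<beta>" using that by (simp add: car_CokerM[OF a])
    then have e: "eta hb 0 v \<in> fock_sum \<alpha> (\<beta> - 1)" "eta hb 0 (eta hb 0 v) = 0"
      by (rule eta_0_fock_sum, rule eta_0_eta_0)
    then show ?thesis
      using eta_diag[OF e(1) p1] diag_fspan[of "eta hb 0 v"]
      by (simp add: car_KerM[OF a] linop_zero[OF linop_diag]) (simp add: fock_sum_eq)
  qed
  have "inj_on ?\<Phi> ?C"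
  proof (rule inj_onI)
    fix u v assume uv: "u \<in> ?C" "v \<in> ?C" "?\<Phi> u = ?\<Phi> v"
    from arg_cong[OF uv(3), of ?R] have "eta hb 0 u = eta hb 0 v" by (simp add: RP)
    moreover have "u = xi hb 0 (eta hb 0 u)" "v = xi hb 0 (eta hb 0 v)"
      using uv(1,2) by (simp_all add: car_CokerM[OF a])
    ultimately show "u = v" by simp
  qed
  moreover have "u \<in> ?\<Phi> ` ?C" if "u \<in> ?K" for u
  proof -
    \<comment> \<open>The preimage is \<xi>_0 of the untwisted u, since \<xi>_0 is a right inverse
      of \<eta>_0 on the kernel of \<eta>_0.\<close>
    let ?y = "?R u"
    have u: "u \<in> fock_sum \<alpha> (\<beta> - 1)" "eta hb 0 u = 0" using that by (auto simp: car_KerM[OF a])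
    have y: "?y \<in> fock_sum \<alpha> (\<beta> - 1)" using u diag_fspan by (simp add: fock_sum_eq)
    have "eta hb 0 ?y = 0"
      using eta_diag[OF u(1), of "\<lambda>w. inverse (psgn w)"] u(2) p1 by (simp add: linop_zero[OF linop_diag])
    then have ey: "eta hb 0 (xi hb 0 ?y) = ?y"
      using eta_xi[OF a y] by (simp add: linop_zero[OF linop_xi])
    moreover have "xi hb 0 ?y \<in> ?C"
      using xi_0_fock_sum[OF y] ey by (simp add: car_CokerM[OF a])
    moreover have "u = ?\<Phi> (xi hb 0 ?y)" unfolding ey PR ..
    ultimately show ?thesis by blast
  qed
  ultimately have "bij_betw ?\<Phi> ?C ?K" using K by (auto simp: bij_betw_def)
  moreover have "linear_on ?C ?\<Phi>"
    by (rule linop_linear_on) (rule linop_comp[OF linop_diag linop_eta])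
  moreover have "?\<Phi> (act (CokerM hb \<alpha> \<beta>) x v) = act (KerM hb \<alpha> (\<beta> - 1)) x (?\<Phi> v)" if "v \<in> ?C" for x v
  proof -
    have v: "v \<in> fock_sum \<alpha> \<beta>" using that by (simp add: car_CokerM[OF a])
    have e: "eta hb 0 v \<in> fspan UNIV UNIV" using eta_0_fock_sum[OF v] fock_sum_subset by auto
    have "?\<Phi> (act (CokerM hb \<alpha> \<beta>) x v) = ?P (eta hb 0 (fock_act hb x v))"
      using eta_xi_eta[OF a act_fock_sum[OF v]] by (simp add: CokerM_def)
    \<comment> \<open>One sign comes from \<eta>_0, the other from the parity twist.\<close>
    also have "\<dots> = scaleF (par x) (scaleF (par x) (fock_act hb x (?P (eta hb 0 v))))"
      by (simp only: eta_0_act[OF a v] linop_scale[OF linop_diag] diag_psgn_act[OF e])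
    also have "\<dots> = fock_act hb x (?P (eta hb 0 v))"
      by (simp add: par_def split: gen.splits)
    finally show ?thesis by (simp add: KerM_def)
  qed
  ultimately show ?thesis unfolding module_iso_def by blast
qed

end

section \<open>Generation by highest weight vectors\<close>

abbreviation pure_c :: "complex \<Rightarrow> complex \<Rightarrow> fock set" where
  "pure_c \<alpha> \<beta> \<equiv> fspan (fwts \<alpha> \<beta>) {Bc}"

lemma pure_c_subset: "pure_c \<alpha> \<beta> \<subseteq> fspan UNIV UNIV"
  by (rule fspan_mono) auto

lemma pure_c_fock_sum: "pure_c \<alpha> \<beta> \<subseteq> fock_sum \<alpha> \<beta>"
  unfolding fock_sum_eq by (rule fspan_mono) auto

lemma orbit_eq:
  assumes "w \<in> orbit w'"
  shows "orbit w = orbit w'"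
proof -
  obtain l1 l2 l3 where w': "w' = (l1, l2, l3)" by (cases w') auto
  obtain i :: int where w: "w = (l1 + of_int i, l2 - of_int i, l3 + of_int i)"
    using assms by (auto simp: w' orbit_iff)
  have "(l1 + of_int j, l2 - of_int j, l3 + of_int j) \<in> orbit w" for j :: int
    unfolding w orbit_iff by (rule exI[of _ "j - i"]) simp
  moreover have "(l1 + of_int i + of_int j, l2 - of_int i - of_int j, l3 + of_int i + of_int j) \<in> orbit w'" for j :: int
    unfolding w' orbit_iff by (rule exI[of _ "i + j"]) simp
  ultimately show ?thesis by (auto simp: orbit_iff w w')
qed

lemma eh_pure_c: "v \<in> pure_c \<alpha> \<beta> \<Longrightarrow> eh hb p v \<in> pure_c \<alpha> \<beta>"
  and xh_pure_c: "v \<in> pure_c \<alpha> \<beta> \<Longrightarrow> xh hb p v \<in> pure_c \<alpha> \<beta>"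
proof -
  assume v: "v \<in> pure_c \<alpha> \<beta>"
  have "(+) (1, - 1, 0) ` shifted 0 1 W = shifted 1 1 W" for W
    by (force simp: shifted_def image_iff)
  then show "eh hb p v \<in> pure_c \<alpha> \<beta>"
    using fspan_mult_vac[OF vop_fspan[of 0 "{Bc}" 1 v "fwts \<alpha> \<beta>" hb 0 0 p], of "(1, - 1, 0)"] v
      fspan_mono[OF orbit_shift[of 1 "(\<beta> - \<alpha>, - \<beta>, \<alpha>)"] order_refl, of "{Bc}"]
    by (auto simp: eh_def)
  have "(+) (- 1, 1, 0) ` shifted 0 (- 1) W = shifted (- 1) (- 1) W" for W
    by (force simp: shifted_def image_iff)
  then show "xh hb p v \<in> pure_c \<alpha> \<beta>"
    using fspan_mult_vac[OF vop_fspan[of 0 "{Bc}" "- 1" v "fwts \<alpha> \<beta>" hb 0 0 p], of "(- 1, 1, 0)"] v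
      fspan_mono[OF orbit_shift[of "- 1" "(\<beta> - \<alpha>, - \<beta>, \<alpha>)"] order_refl, of "{Bc}"]
    by (auto simp: xh_def)
qed

lemma vop_nonint_pure_c:
  assumes v: "v \<in> pure_c \<alpha> \<beta>" and t: "\<tau> \<in> \<int>" and p: "p - \<tau> * \<alpha> \<notin> \<int>"
  shows "vop hb 0 0 \<tau> s p v = 0"
proof (rule vop_nonint[OF v])
  fix l1 l2 l3 assume "(l1, l2, l3) \<in> fwts \<alpha> \<beta>"
  then obtain i where i: "l3 = \<alpha> + of_int i" using fwts_third by blast
  show "p - \<tau> * l3 \<notin> \<int>"
  proof
    assume "p - \<tau> * l3 \<in> \<int>"
    then have "p - \<tau> * l3 + \<tau> * of_int i \<in> \<int>" using t by (intro Ints_add Ints_mult Ints_of_int)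
    then show False using p by (simp add: i algebra_simps)
  qed
qed

lemma eh_nonint: "v \<in> pure_c \<alpha> \<beta> \<Longrightarrow> p - \<alpha> \<notin> \<int> \<Longrightarrow> eh hb p v = 0"
  and xh_nonint: "v \<in> pure_c \<alpha> \<beta> \<Longrightarrow> p + \<alpha> \<notin> \<int> \<Longrightarrow> xh hb p v = 0"
  by (simp_all add: eh_def xh_def vop_nonint_pure_c)

text \<open>The a-translations in \<open>eh\<close> and \<open>xh\<close> commute with the fermion
  modes. They cancel in mixed products and combine to one common factor otherwise, so the
  anticommutation relations carry over.\<close>

lemma eh_xh_conv:
  assumes v: "v \<in> fspan UNIV UNIV"
  shows "eh hb p (xh hb r v) = vop hb 0 0 1 0 p (vop hb 0 0 (- 1) 0 r v)"
    and "xh hb r (eh hb p v) = vop hb 0 0 (- 1) 0 r (vop hb 0 0 1 0 p v)"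
    and "eh hb p (eh hb r v) = vac (2, - 2, 0) * vop hb 0 0 1 0 p (vop hb 0 0 1 0 r v)"
    and "xh hb p (xh hb r v) = vac (- 2, 2, 0) * vop hb 0 0 (- 1) 0 p (vop hb 0 0 (- 1) 0 r v)"
proof -
  have V: "vop hb 0 0 \<tau> 0 q v \<in> fspan UNIV UNIV" for \<tau> q
    using vop_fspan[of 0 UNIV \<tau> v UNIV hb 0 0 q] v fspan_mono[of "shifted 0 \<tau> UNIV" UNIV UNIV UNIV] by auto
  have 1: "vac (1, - 1, 0) * (vac (- 1, 1, 0) * u) = u" "vac (- 1, 1, 0) * (vac (1, - 1, 0) * u) = u" for u
    by (simp_all add: mult.assoc[symmetric] vac_mult flip: zero_prod_def)
  have 2: "vac (1, - 1, 0) * (vac (1, - 1, 0) * u) = vac (2, - 2, 0) * u"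
    "vac (- 1, 1, 0) * (vac (- 1, 1, 0) * u) = vac (- 2, 2, 0) * u" for u
    by (simp_all add: mult.assoc[symmetric] vac_mult)
  show "eh hb p (xh hb r v) = vop hb 0 0 1 0 p (vop hb 0 0 (- 1) 0 r v)"
    "xh hb r (eh hb p v) = vop hb 0 0 (- 1) 0 r (vop hb 0 0 1 0 p v)"
    "eh hb p (eh hb r v) = vac (2, - 2, 0) * vop hb 0 0 1 0 p (vop hb 0 0 1 0 r v)"
    "xh hb p (xh hb r v) = vac (- 2, 2, 0) * vop hb 0 0 (- 1) 0 p (vop hb 0 0 (- 1) 0 r v)"
    by (simp_all add: eh_def xh_def vop_vac_mult[OF V] 1 2)
qed

context qgen
begin

lemma eh_eh: "v \<in> pure_c \<alpha> \<beta> \<Longrightarrow> eh hb p (eh hb r v) = - eh hb r (eh hb p v)"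
  and xh_xh: "v \<in> pure_c \<alpha> \<beta> \<Longrightarrow> xh hb p (xh hb r v) = - xh hb r (xh hb p v)"
proof -
  assume "v \<in> pure_c \<alpha> \<beta>"
  then have v: "v \<in> fspan UNIV UNIV" using pure_c_subset by blast
  show "eh hb p (eh hb r v) = - eh hb r (eh hb p v)" "xh hb p (xh hb r v) = - xh hb r (xh hb p v)"
    using vop_anticommute[of 1 v 0 0 0 p r, OF _ v] vop_anticommute[of "- 1" v 0 0 0 p r, OF _ v]
    by (simp_all add: eh_xh_conv[OF v] eq_neg_iff_add_eq_0 flip: distrib_left)
qed

lemma eh_xh:
  assumes a: "\<alpha> \<in> \<int>" and v: "v \<in> pure_c \<alpha> \<beta>" and p: "p \<in> \<int>"
  shows "eh hb p (xh hb r v) = (if p + r + 1 = 0 then v else 0) - xh hb r (eh hb p v)"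
proof -
  have v': "v \<in> fspan UNIV UNIV" using v pure_c_subset by auto
  have "v \<in> fock_sum \<alpha> \<beta>" using v pure_c_fock_sum by auto
  from vop_anticommute_dual[OF fock_sum_integral[OF a this p], of 0 0 0 r]
  have "xh hb r (eh hb p v) + eh hb p (xh hb r v) = (if p + r + 1 = 0 then v else 0)"
    by (simp add: eh_xh_conv[OF v'] vop_trivial[OF v'] add_ac)
  then show ?thesis unfolding eq_diff_eq by (simp only: add.commute)
qed

lemma qint_int_neq_0: "z \<noteq> 0 \<Longrightarrow> qint hb (of_int z) \<noteq> 0"
proof (cases "z > 0")
  case True
  then show ?thesis using qint_neq_0[of "nat z"] by simp
next
  case False
  assume "z \<noteq> 0"
  then have "qint hb (of_nat (nat (- z))) \<noteq> 0" using False by (intro qint_neq_0) auto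
  moreover have "of_nat (nat (- z)) = - (of_int z :: complex)" using False by simp
  ultimately show ?thesis by (simp add: qint_minus)
qed

lemma qint_generic: "qpow hb (2 * x) \<noteq> 1 \<Longrightarrow> qint hb x \<noteq> 0"
  using qpow_eq_minus_iff[of x] qdenom_neq_0 by (simp add: qint_def)

end

text \<open>Submodules of \<open>FockM\<close> and of \<open>KerM\<close> both have this form,
  because the kernel carries the restricted Fock action.\<close>

locale stable_subspace = qgen +
  fixes \<alpha> \<beta> :: complex and S :: "fock set"
  assumes subS: "fock.subspace S"
    and S_fock: "S \<subseteq> fock_sum \<alpha> \<beta>"
    and S_act: "\<And>x v. v \<in> S \<Longrightarrow> fock_act hb x v \<in> S"
begin

lemma S_mon_sum: "n \<ge> 1 \<Longrightarrow> u \<in> S \<Longrightarrow> (mon Ba1 n + mon Ba2 n) * u \<in> S"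
  using S_act[of u "H1 (- int n)"] by (simp add: A1_def osc_creation distrib_right)

text \<open>H^1 and H^2 supply the sum and, up to the factor (q^n + q^-n)/2, the difference of the
  two a-modes. The factor is nonzero because q^(4n) is not 1.\<close>

lemma S_mon:
  assumes "n \<ge> 1" "u \<in> S" "t \<noteq> Bc"
  shows "mon t n * u \<in> S"
proof -
  let ?h = "(qpow hb (- of_nat n) + qpow hb (of_nat n)) / 2"
  have "qpow hb (2 * of_nat n) \<noteq> - 1"
  proof
    assume "qpow hb (2 * of_nat n) = - 1"
    moreover have "qpow hb (of_nat (4 * n)) = qpow hb (2 * of_nat n) * qpow hb (2 * of_nat n)"
      unfolding qpow_add[symmetric] by simp
    ultimately show False using qpow_neq_1[of "4 * n"] assms(1) by simp
  qed
  moreover have "qpow hb (2 * of_nat n) = qpow hb (of_nat n) * qpow hb (of_nat n)"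
    unfolding qpow_add[symmetric] by simp
  ultimately have h: "?h \<noteq> 0"
    by (auto simp: qpow_minus field_simps eq_neg_iff_add_eq_0 add.commute)
  define h where "h = ?h"
  have "scaleF h ((mon Ba1 n - mon Ba2 n) * u) \<in> S"
    using S_act[OF assms(2), of "H2 (- int n)"] assms(1)
    by (simp add: A2_def osc_creation left_diff_distrib h_def)
  from fock.subspace_scale[OF subS this, of "1 / h"] h
  have d: "(mon Ba1 n - mon Ba2 n) * u \<in> S" by (simp add: h_def[symmetric] del: divide_eq_0_iff)
  note s = S_mon_sum[OF assms(1,2)]
  have half: "scaleF (1 / 2) (x + x) = x" for x :: fock
    using fock.scale_left_distrib[of "1 / 2" "1 / 2" x] by (simp add: fock.scale_right_distrib)
  have "mon Ba1 n * u = scaleF (1 / 2) ((mon Ba1 n + mon Ba2 n) * u + (mon Ba1 n - mon Ba2 n) * u)"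
    "mon Ba2 n * u = scaleF (1 / 2) ((mon Ba1 n + mon Ba2 n) * u - (mon Ba1 n - mon Ba2 n) * u)"
    using half[of "mon Ba1 n * u"] half[of "mon Ba2 n * u"] by (simp_all add: algebra_simps)
  then show ?thesis
    using assms(3) fock.subspace_scale[OF subS fock.subspace_add[OF subS s d], of "1 / 2"]
      fock.subspace_scale[OF subS fock.subspace_diff[OF subS s d], of "1 / 2"]
    by (cases t) auto
qed

lemma S_cser:
  assumes "u \<in> S"
  shows "cser hb \<sigma> \<kappa> 0 0 $ k * u \<in> S"
  unfolding cser_def
  by (rule eser_closed[OF subS _ assms])
    (simp add: cgen_def S_mon_sum fock.subspace_scale[OF subS])

abbreviation Sc :: "fock set" where "Sc \<equiv> S \<inter> pure_c \<alpha> \<beta>"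

lemma pure_c_sum: "pure_c \<alpha> \<beta> \<subseteq> fspan {(l1, l2, l3). l1 + l2 = - \<alpha>} {Bc}"
  using fwts_sum by (intro fspan_mono) auto

lemma S_eh:
  assumes u: "u \<in> Sc"
  shows "eh hb p u \<in> Sc"
proof -
  have uc: "u \<in> pure_c \<alpha> \<beta>" and uS: "u \<in> S" using u by auto
  have "eh hb p u \<in> S"
  proof (cases "p - \<alpha> \<in> \<int>")
    case False
    then show ?thesis using eh_nonint[OF uc] fock.subspace_0[OF subS] by simp
  next
    case True
    show ?thesis
    \<comment> \<open>The argument x - \<alpha> accounts for the power -\<alpha> that the zero mode
      of H^1 contributes, as l1 + l2 = -\<alpha>.\<close>
    proof (rule descent[where g = "\<lambda>x. eh hb x u" and V = "\<lambda>x. vop hb 1 (- 1 / 2) 1 0 (x - \<alpha>) u", OF subS])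
      show "cser hb 1 (- 1 / 2) 0 0 $ 0 = 1" by (simp add: cser_def)
      show "\<exists>N0. \<forall>N\<ge>N0. eh hb (p - of_nat N) u = 0"
        using vop_eventually_0[of u hb 0 0 1 0 p] pure_c_subset uc by (fastforce simp: eh_def)
      show "\<exists>N0. \<forall>N\<ge>N0. vop hb 1 (- 1 / 2) 1 0 (x - \<alpha>) u = (\<Sum>k\<le>N. cser hb 1 (- 1 / 2) 0 0 $ k * eh hb (x - of_nat k) u)" for x
        using vop_split[OF subsetD[OF pure_c_sum uc], of hb 1 "- 1 / 2" 1 0 "x - \<alpha>"] by (simp add: eh_def)
      fix x assume x: "x - p \<in> \<int>"
      obtain z where z: "x - \<alpha> = of_int z"
        using Ints_add[OF x True] by (auto simp: Ints_def)
      have "vop hb 1 (- 1 / 2) 1 0 (x - \<alpha>) u = fock_act hb (Xp (- z - 1)) u"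
        by (simp add: X_plus_def z)
      then show "vop hb 1 (- 1 / 2) 1 0 (x - \<alpha>) u \<in> S" using S_act[OF uS, of "Xp (- z - 1)"] by simp
    qed (rule S_cser)
  qed
  then show ?thesis using eh_pure_c[OF uc] by simp
qed

text \<open>The two exponentials of X^- are split separately and subtracted; by
  \<open>vop_rescale\<close> the k-th term then carries [x - k]_q, so \<open>descent\<close> applies
  to the modes with this factor attached.\<close>

lemma S_qint_xh:
  assumes u: "u \<in> Sc"
  shows "scaleF (qint hb p) (xh hb p u) \<in> S"
proof -
  have uc: "u \<in> pure_c \<alpha> \<beta>" and uS: "u \<in> S" using u by auto
  have u': "u \<in> fspan UNIV UNIV" using uc pure_c_subset by auto
  let ?D = "qpow hb 1 - qpow hb (- 1)" and ?V = "\<lambda>s. vop hb (- 1) (1 / 2) (- 1) s" and ?C = "cser hb (- 1) (1 / 2) 0 0"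
  let ?X = "\<lambda>x. scaleF (1 / ?D) (?V 1 (x + \<alpha>) u - ?V (- 1) (x + \<alpha>) u)"
  show ?thesis
  proof (cases "p + \<alpha> \<in> \<int>")
    case False
    then show ?thesis using xh_nonint[OF uc] fock.subspace_0[OF subS] by simp
  next
    case True
    show ?thesis
    proof (rule descent[where g = "\<lambda>x. scaleF (qint hb x) (xh hb x u)" and V = ?X, OF subS])
      show "?C $ 0 = 1" by (simp add: cser_def)
      show "\<exists>N0. \<forall>N\<ge>N0. scaleF (qint hb (p - of_nat N)) (xh hb (p - of_nat N) u) = 0"
        using vop_eventually_0[OF u', of hb 0 0 "- 1" 0 p] by (fastforce simp: xh_def)
      show "\<exists>N0. \<forall>N\<ge>N0. ?X x = (\<Sum>k\<le>N. ?C $ k * scaleF (qint hb (x - of_nat k)) (xh hb (x - of_nat k) u))" for x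
      proof -
        have split: "\<exists>N0. \<forall>N\<ge>N0. ?V s (x + \<alpha>) u = (\<Sum>k\<le>N. scaleF (qpow hb (s * (x - of_nat k))) (?C $ k * xh hb (x - of_nat k) u))" for s
          using vop_split[OF subsetD[OF pure_c_sum uc], of hb "- 1" "1 / 2" "- 1" s "x + \<alpha>"]
          by (simp add: xh_def vop_rescale[OF u', of hb "- 1" s])
        obtain N1 where N1: "\<And>N. N \<ge> N1 \<Longrightarrow> ?V 1 (x + \<alpha>) u = (\<Sum>k\<le>N. scaleF (qpow hb (1 * (x - of_nat k))) (?C $ k * xh hb (x - of_nat k) u))"
          using split by blast
        obtain N2 where N2: "\<And>N. N \<ge> N2 \<Longrightarrow> ?V (- 1) (x + \<alpha>) u = (\<Sum>k\<le>N. scaleF (qpow hb (- 1 * (x - of_nat k))) (?C $ k * xh hb (x - of_nat k) u))"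
          using split by blast
        have "?X x = (\<Sum>k\<le>N. ?C $ k * scaleF (qint hb (x - of_nat k)) (xh hb (x - of_nat k) u))" if "N \<ge> max N1 N2" for N
        proof -
          have N: "N \<ge> N1" "N \<ge> N2" using that by auto
          have q: "scaleF (1 / ?D) (scaleF (qpow hb (1 * y)) z - scaleF (qpow hb (- 1 * y)) z) = scaleF (qint hb y) z" for y z
            by (simp add: qint_def flip: fock.scale_left_diff_distrib)
          show ?thesis
            unfolding N1[OF N(1)] N2[OF N(2)] sum_subtractf[symmetric] scaleF_sum q by simp
        qed
        then show ?thesis by blast
      qed
      fix x assume x: "x - p \<in> \<int>"
      obtain z where z: "x + \<alpha> = of_int z"
        using Ints_add[OF x True] by (auto simp: Ints_def)
      have "?X x = fock_act hb (Xm (- z)) u" by (simp add: X_minus_def z)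
      then show "?X x \<in> S" using S_act[OF uS, of "Xm (- z)"] by simp
    qed (rule S_cser)
  qed
qed

lemma S_xh:
  assumes u: "u \<in> Sc" and q: "qint hb p \<noteq> 0"
  shows "xh hb p u \<in> Sc"
  using fock.subspace_scale[OF subS S_qint_xh[OF u, of p], of "1 / qint hb p"] q u xh_pure_c by auto

text \<open>Reduces a claim about the whole Fock space to vectors free of a-bosons. T will be the
  identity for nonintegral \<alpha> and the projection \<eta>_0 \<xi>_0 for integral
  \<alpha>.\<close>

lemma S_all:
  assumes T: "linop T" and T_mon: "\<And>t n u. t \<noteq> Bc \<Longrightarrow> n \<ge> 1 \<Longrightarrow> T (mon t n * u) = mon t n * T u"
    and pure: "\<And>u. u \<in> pure_c \<alpha> \<beta> \<Longrightarrow> T u \<in> S"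
    and v: "v \<in> fock_sum \<alpha> \<beta>"
  shows "T v \<in> S"
proof -
  have "fspan (fwts \<alpha> \<beta>) UNIV \<subseteq> {v. T v \<in> S}"
  proof (rule fspan_subset)
    show "fock.subspace {v. T v \<in> S}"
      using subS by (auto simp: fock.subspace_def linop_zero[OF T] linop_add[OF T] linop_scale[OF T])
  next
    fix w and m :: "(boson \<times> nat) multiset"
    assume w: "w \<in> fwts \<alpha> \<beta>" and "\<forall>(s, n)\<in>#m. s \<in> (UNIV :: boson set) \<and> 1 \<le> n"
    then have m: "\<forall>(s, n)\<in>#m. 1 \<le> n" by auto
    let ?c = "filter_mset (\<lambda>x. fst x = Bc) m"
    \<comment> \<open>The c-modes \<open>?c\<close> of m are held fixed; the a-modes
      \<open>ma\<close> are added one at a time.\<close>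
    have "T (bvec (w, ?c + ma)) \<in> S" if "\<forall>(s, n)\<in>#ma. s \<noteq> Bc \<and> 1 \<le> n" for ma
      using that
    proof (induction ma)
      case empty
      show ?case using w m by (intro pure) (auto simp: bvec_fspan)
    next
      case (add x ma)
      obtain t n where x: "x = (t, n)" by (cases x)
      show ?case using add by (auto simp: x bvec_add_mset T_mon S_mon)
    qed
    from this[of "filter_mset (\<lambda>x. fst x \<noteq> Bc) m"] m
    have "T (bvec (w, m)) \<in> S" by (auto simp flip: multiset_partition)
    then show "bvec (w, m) \<in> {v. T v \<in> S}" by simp
  qed
  then show ?thesis using v by (auto simp: fock_sum_eq)
qed

lemma S_eq_fock_sum:
  assumes generic: "\<And>n::int. qpow hb (2 * (\<alpha> + of_int n)) \<noteq> 1"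
    and vac: "vac (\<beta> - \<alpha>, - \<beta>, \<alpha>) \<in> S"
  shows "S = fock_sum \<alpha> \<beta>"
proof -
  have sub: "fock.subspace Sc" using subS subspace_fspan by (rule fock.subspace_inter)
  have "v \<in> Sc" if "v \<in> ferm hb (\<beta> - \<alpha>, - \<beta>, \<alpha>)" for v
    using that
  proof (induction rule: ferm.induct)
    case vac
    show ?case using assms(2) by (auto simp: vac_fspan orbit_iff intro!: exI[of _ 0])
  next
    case (xh u p)
    show ?case
    proof (cases "p + \<alpha> \<in> \<int>")
      case False
      then show ?thesis using xh_nonint[of u, where \<alpha> = \<alpha> and \<beta> = \<beta> and p = p] xh.IH fock.subspace_0[OF sub] by simp
    next
      case True
      then obtain z where "p + \<alpha> = of_int z" by (auto simp: Ints_def)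
      then have "\<alpha> = of_int z - p" by (simp add: algebra_simps)
      \<comment> \<open>On this Fock space \<xi> has only powers p with p + \<alpha> integral, so
        \<open>generic\<close> rules out [p] = 0.\<close>
      then have "2 * (\<alpha> + of_int (- z)) = - (2 * p)" by simp
      then have "qpow hb (2 * p) \<noteq> 1" using generic[of "- z"] by (simp only: qpow_minus) auto
      then show ?thesis by (rule S_xh[OF xh.IH qint_generic])
    qed
  next
    case (add u v)
    then show ?case by (intro fock.subspace_add[OF sub])
  next
    case (scale u c)
    then show ?case by (intro fock.subspace_scale[OF sub])
  next
    case (eh u p)
    then show ?case by (intro S_eh)
  qed
  then have "pure_c \<alpha> \<beta> \<subseteq> S" using fspan_subset_ferm[of "(\<beta> - \<alpha>, - \<beta>, \<alpha>)"] by auto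
  then have "v \<in> S" if "v \<in> fock_sum \<alpha> \<beta>" for v
    using S_all[of "\<lambda>v. v" v] that by (auto simp: linop_id)
  then show ?thesis using S_fock by auto
qed

text \<open>The vacuum with l3 = 0 lies in the kernel for every integral \<alpha>, unlike the one
  with l3 = \<alpha>, so both signs of \<alpha> are treated together.\<close>

lemma S_eq_kernel:
  assumes a: "\<alpha> \<in> \<int>" and ker: "\<And>v. v \<in> S \<Longrightarrow> eta hb 0 v = 0"
    and vac: "vac (\<beta> - 2 * \<alpha>, \<alpha> - \<beta>, 0) \<in> S"
  shows "S = {v \<in> fock_sum \<alpha> \<beta>. eta hb 0 v = 0}"
proof -
  let ?w = "(\<beta> - 2 * \<alpha>, \<alpha> - \<beta>, 0 :: complex)"
  have sub: "fock.subspace Sc" using subS subspace_fspan by (rule fock.subspace_inter)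
  obtain k where k: "\<alpha> = of_int k" using a by (auto simp: Ints_def)
  have "?w = (\<beta> - \<alpha> + of_int (- k), - \<beta> - of_int (- k), \<alpha> + of_int (- k))" by (simp add: k)
  then have w: "?w \<in> fwts \<alpha> \<beta>" unfolding orbit_iff by blast
  have eh0: "eh hb (- 1) v = 0" if "v \<in> S" for v
    using ker[OF that] by (simp add: eh_def eta_0)
  \<comment> \<open>\<open>xh hb 0\<close> stands for \<xi>_0 and \<open>eh hb (- 1)\<close> for
    \<eta>_0; the a-translations in them keep everything inside one Fock space.\<close>
  have ferm: "\<exists>s\<in>Sc. \<exists>s'\<in>Sc. v = s + xh hb 0 s'" if "v \<in> ferm hb ?w" for v
    using that
  proof (induction rule: ferm.induct)
    case vac
    have "vac ?w \<in> Sc" using assms(3) w by (simp add: vac_fspan)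
    then show ?case using fock.subspace_0[OF sub] linop_zero[OF linop_xh]
      by (intro bexI[of _ "vac ?w"] bexI[of _ 0]) auto
  next
    case (add u v)
    then obtain s s' t t' where "s \<in> Sc" "s' \<in> Sc" "t \<in> Sc" "t' \<in> Sc" "u = s + xh hb 0 s'" "v = t + xh hb 0 t'" by blast
    then show ?case
      by (intro bexI[of _ "s + t"] bexI[of _ "s' + t'"] fock.subspace_add[OF sub])
        (auto simp: linop_add[OF linop_xh])
  next
    case (scale u c)
    then obtain s s' where "s \<in> Sc" "s' \<in> Sc" "u = s + xh hb 0 s'" by blast
    then show ?case
      by (intro bexI[of _ "scaleF c s"] bexI[of _ "scaleF c s'"] fock.subspace_scale[OF sub])
        (auto simp: linop_scale[OF linop_xh] fock.scale_right_distrib)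
  next
    case (eh u p)
    then obtain s s' where s: "s \<in> Sc" "s' \<in> Sc" "u = s + xh hb 0 s'" by blast
    show ?case
    proof (cases "p \<in> \<int>")
      case False
      then have "p - \<alpha> \<notin> \<int>" using a Ints_add[of "p - \<alpha>" \<alpha>] by auto
      moreover have "u \<in> pure_c \<alpha> \<beta>" using s xh_pure_c fock.subspace_add[OF subspace_fspan] by auto
      ultimately have "eh hb p u = 0" by (rule eh_nonint[rotated])
      then show ?thesis using fock.subspace_0[OF sub] linop_zero[OF linop_xh] by (intro bexI[of _ 0]) auto
    next
      case True
      \<comment> \<open>Anticommuting past \<xi>_0 leaves s' itself exactly when p = -1.\<close>
      have "eh hb p u = (eh hb p s + (if p + 1 = 0 then s' else 0)) + xh hb 0 (- eh hb p s')"
        using eh_xh[OF a _ True, of s' \<beta> 0] s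
        by (simp add: linop_add[OF linop_eh] linop_uminus[OF linop_xh])
      moreover have "eh hb p s + (if p + 1 = 0 then s' else 0) \<in> Sc" "- eh hb p s' \<in> Sc"
        using s S_eh fock.subspace_add[OF sub] fock.subspace_0[OF sub] fock.subspace_neg[OF sub] by auto
      ultimately show ?thesis by blast
    qed
  next
    case (xh u p)
    then obtain s s' where s: "s \<in> Sc" "s' \<in> Sc" "u = s + xh hb 0 s'" by blast
    show ?case
    proof (cases "p \<in> \<int>")
      case False
      then have "p + \<alpha> \<notin> \<int>" using a Ints_diff[of "p + \<alpha>" \<alpha>] by auto
      moreover have "u \<in> pure_c \<alpha> \<beta>" using s xh_pure_c fock.subspace_add[OF subspace_fspan] by auto
      ultimately have "xh hb p u = 0" by (rule xh_nonint[rotated])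
      then show ?thesis using fock.subspace_0[OF sub] linop_zero[OF linop_xh] by (intro bexI[of _ 0]) auto
    next
      case True
      have xx: "xh hb p (xh hb 0 s') = - xh hb 0 (xh hb p s')"
        using xh_xh[of s', where \<alpha> = \<alpha> and \<beta> = \<beta> and p = p and r = 0] s by auto
      show ?thesis
      proof (cases "p = 0")
        case True
        have "xh hb 0 (xh hb 0 s') + xh hb 0 (xh hb 0 s') = 0"
          using xx by (simp only: True eq_neg_iff_add_eq_0)
        then have "xh hb 0 (xh hb 0 s') = 0" by (rule fock_double_0)
        then have "xh hb p u = 0 + xh hb 0 s" by (simp add: s(3) True linop_add[OF linop_xh])
        then show ?thesis using s fock.subspace_0[OF sub] by blast
      next
        case False
        then have q: "qint hb p \<noteq> 0" using \<open>p \<in> \<int>\<close> qint_int_neq_0 by (auto simp: Ints_def)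
        have "xh hb p u = xh hb p s + xh hb 0 (- xh hb p s')"
          by (simp add: s(3) linop_add[OF linop_xh] xx linop_uminus[OF linop_xh])
        then show ?thesis using S_xh[OF s(1) q] S_xh[OF s(2) q] fock.subspace_neg[OF sub] by blast
      qed
    qed
  qed
  have pure: "v \<in> S" if v: "v \<in> pure_c \<alpha> \<beta>" "eta hb 0 v = 0" for v
  proof -
    have "v \<in> ferm hb ?w" using fspan_subset_ferm[of ?w] v(1) orbit_eq[OF w] by auto
    then obtain s s' where s: "s \<in> Sc" "s' \<in> Sc" "v = s + xh hb 0 s'" using ferm by blast
    have "eh hb (- 1) v = 0" using v(2) by (simp add: eh_def eta_0)
    \<comment> \<open>\<eta>_0 kills s and s', so the relation \<eta>_0 \<xi>_0 + \<xi>_0 \<eta>_0 =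
      1 lets it read off the component s'.\<close>
    moreover have "eh hb (- 1) v = s'"
      using eh_xh[OF a _ _, of s' \<beta> "- 1" 0] s eh0
      by (simp add: linop_add[OF linop_eh] linop_zero[OF linop_xh])
    ultimately have "s' = 0" by simp
    then show ?thesis using s by (simp add: linop_zero[OF linop_xh])
  qed
  let ?T = "\<lambda>v. eta hb 0 (xi hb 0 v)"
  have "?T v \<in> S" if "v \<in> fock_sum \<alpha> \<beta>" for v
  proof (rule S_all[OF _ _ _ that])
    show "linop ?T" by (intro linop_comp[OF linop_eta] linop_xi)
    show "?T (mon t n * u) = mon t n * ?T u" if "t \<noteq> Bc" "n \<ge> 1" for t n u
      using that by (simp add: eta_0 xi_0 vop_mon gam_def)
    fix u assume u: "u \<in> pure_c \<alpha> \<beta>"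
    have "?T u = eh hb (- 1) (xh hb 0 u)"
      using u pure_c_subset[where \<alpha> = \<alpha> and \<beta> = \<beta>] by (auto simp: eh_xh_conv eta_0 xi_0)
    then have "?T u \<in> pure_c \<alpha> \<beta>" using u eh_pure_c xh_pure_c by simp
    moreover have "eta hb 0 (?T u) = 0"
      using u pure_c_fock_sum by (intro eta_0_eta_0[OF xi_0_fock_sum]) auto
    ultimately show "?T u \<in> S" by (rule pure)
  qed
  moreover have "v = ?T v" if "v \<in> fock_sum \<alpha> \<beta>" "eta hb 0 v = 0" for v
    using eta_xi[OF a that(1)] that(2) by (simp add: linop_zero[OF linop_xi])
  ultimately have "v \<in> S" if "v \<in> fock_sum \<alpha> \<beta>" "eta hb 0 v = 0" for v
    using that by metis
  then show ?thesis using S_fock ker by blast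
qed

end

section \<open>Transport of highest weight modules along isomorphisms\<close>

lemma umodule_car:
  assumes "umodule M"
  shows "fock.subspace (car M)" "v \<in> car M \<Longrightarrow> act M x v \<in> car M"
    "u \<in> car M \<Longrightarrow> v \<in> car M \<Longrightarrow> act M x (u + v) = act M x u + act M x v"
    "v \<in> car M \<Longrightarrow> act M x (scaleF c v) = scaleF c (act M x v)"
  using assms by (auto simp: umodule_def linear_on_def image_subset_iff)

lemma module_iso_sym:
  assumes M: "umodule M" and iso: "M \<cong>\<^sub>U N"
  shows "N \<cong>\<^sub>U M"
proof -
  obtain \<Phi> where lin: "linear_on (car M) \<Phi>" and bij: "bij_betw \<Phi> (car M) (car N)"
    and act: "\<And>x v. v \<in> car M \<Longrightarrow> \<Phi> (act M x v) = act N x (\<Phi> v)"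
    using iso unfolding module_iso_def by blast
  let ?\<Psi> = "inv_into (car M) \<Phi>"
  have inv: "?\<Psi> (\<Phi> v) = v" if "v \<in> car M" for v
    using bij that by (simp add: bij_betw_def)
  have surj: "\<exists>v\<in>car M. w = \<Phi> v" if "w \<in> car N" for w
    using bij that by (auto simp: bij_betw_def)
  have "linear_on (car N) ?\<Psi>"
    unfolding linear_on_def
  proof (intro conjI ballI allI)
    fix w w' assume "w \<in> car N" "w' \<in> car N"
    then obtain v v' where v: "v \<in> car M" "w = \<Phi> v" "v' \<in> car M" "w' = \<Phi> v'" using surj by metis
    then have "w + w' = \<Phi> (v + v')" using lin by (simp add: linear_on_def)
    then show "?\<Psi> (w + w') = ?\<Psi> w + ?\<Psi> w'"
      using v inv fock.subspace_add[OF umodule_car(1)[OF M]] by simp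
  next
    fix c w assume "w \<in> car N"
    then obtain v where v: "v \<in> car M" "w = \<Phi> v" using surj by metis
    then have "scaleF c w = \<Phi> (scaleF c v)" using lin by (simp add: linear_on_def)
    then show "?\<Psi> (scaleF c w) = scaleF c (?\<Psi> w)"
      using v inv fock.subspace_scale[OF umodule_car(1)[OF M]] by simp
  qed
  moreover have "bij_betw ?\<Psi> (car N) (car M)" using bij by (rule bij_betw_inv_into)
  moreover have "?\<Psi> (act N x w) = act M x (?\<Psi> w)" if "w \<in> car N" for x w
  proof -
    obtain v where v: "v \<in> car M" "w = \<Phi> v" using surj[OF \<open>w \<in> car N\<close>] by blast
    then show ?thesis using inv umodule_car(2)[OF M] by (simp flip: act)
  qed
  ultimately show ?thesis unfolding module_iso_def by blast
qed

lemma highest_weight_module_iso: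
  assumes M: "umodule M" and iso: "M \<cong>\<^sub>U N" and N: "highest_weight_module N lam"
  shows "highest_weight_module M lam"
proof -
  obtain \<Phi> where lin: "linear_on (car M) \<Phi>" and bij: "bij_betw \<Phi> (car M) (car N)"
    and act: "\<And>x v. v \<in> car M \<Longrightarrow> \<Phi> (act M x v) = act N x (\<Phi> v)"
    using iso unfolding module_iso_def by blast
  obtain lam0 lam1 lam2 where lam: "lam = (lam0, lam1, lam2)" by (cases lam) auto
  obtain w where w: "hw_vector N lam w" and gen: "\<And>S. submodule N S \<Longrightarrow> w \<in> S \<Longrightarrow> S = car N"
    using N unfolding highest_weight_module_def by blast
  have "w \<in> car N" using w by (simp add: lam)
  then obtain v where v: "v \<in> car M" and wv: "w = \<Phi> v" using bij by (auto simp: bij_betw_def)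
  note sub = umodule_car(1)[OF M] and car = umodule_car(2)[OF M]
  have inj: "a = b" if "\<Phi> a = \<Phi> b" "a \<in> car M" "b \<in> car M" for a b
    using bij that by (auto simp: bij_betw_def inj_on_def)
  have scale: "\<Phi> (scaleF c a) = scaleF c (\<Phi> a)" if "a \<in> car M" for c a
    using lin that by (auto simp: linear_on_def)
  have add: "\<Phi> (a + b) = \<Phi> a + \<Phi> b" if "a \<in> car M" "b \<in> car M" for a b
    using lin that by (auto simp: linear_on_def)
  have diff: "\<Phi> (a - b) = \<Phi> a - \<Phi> b" if "a \<in> car M" "b \<in> car M" for a b
    using add[OF fock.subspace_diff[OF sub that] that(2)] by (simp add: algebra_simps)
  have zero: "\<Phi> 0 = 0" using scale[OF v, of 0] by simp
  note c0 = fock.subspace_0[OF sub] and cs = fock.subspace_scale[OF sub]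
  have hw: "hw_vector M lam v"
    unfolding lam hw_vector.simps
  proof (intro conjI)
    show "v \<noteq> 0" using w by (auto simp: lam wv zero)
    show "act M (Xp 0) v = 0"
      by (rule inj) (use w v car c0 in \<open>auto simp: lam wv zero act\<close>)
    show "act M (Xm 1) (act M (Km C1) v) = 0"
      by (rule inj) (use w v car c0 in \<open>auto simp: lam wv zero act\<close>)
    show "act M Cent v - act M (H1 0) v = scaleF lam0 v"
      by (rule inj) (use w v car cs fock.subspace_diff[OF sub] in \<open>auto simp: lam wv act diff scale\<close>)
    show "act M (H1 0) v = scaleF lam1 v"
      by (rule inj) (use w v car cs in \<open>auto simp: lam wv act scale\<close>)
    show "act M (H2 0) v = scaleF lam2 v"
      by (rule inj) (use w v car cs in \<open>auto simp: lam wv act scale\<close>)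
  qed (rule v)
  moreover have "S = car M" if S: "submodule M S" "v \<in> S" for S
  proof -
    have SM: "S \<subseteq> car M" and Ssub: "fock.subspace S" and Sact: "\<And>x u. u \<in> S \<Longrightarrow> act M x u \<in> S"
      using S(1) by (auto simp: submodule_def)
    have "fock.subspace (\<Phi> ` S)"
    proof (rule fock.subspaceI)
      show "0 \<in> \<Phi> ` S" using zero fock.subspace_0[OF Ssub] by (metis imageI)
      show "x + y \<in> \<Phi> ` S" if "x \<in> \<Phi> ` S" "y \<in> \<Phi> ` S" for x y
        using that SM add fock.subspace_add[OF Ssub] by (auto simp: subset_iff image_iff) metis
      show "scaleF c x \<in> \<Phi> ` S" if "x \<in> \<Phi> ` S" for c x
        using that SM scale fock.subspace_scale[OF Ssub] by (auto simp: subset_iff image_iff) metis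
    qed
    moreover have "act N x u \<in> \<Phi> ` S" if "u \<in> \<Phi> ` S" for x u
      using that SM Sact by (auto simp: subset_iff simp flip: act)
    moreover have "\<Phi> ` S \<subseteq> car N" using SM bij by (auto simp: bij_betw_def)
    ultimately have "\<Phi> ` S = car N" by (intro gen) (use S wv in \<open>auto simp: submodule_def\<close>)
    then have "\<Phi> ` S = \<Phi> ` car M" using bij by (simp add: bij_betw_def)
    then show ?thesis using bij SM by (metis bij_betw_def inj_on_image_eq_iff order_refl)
  qed
  ultimately show ?thesis unfolding highest_weight_module_def using M by blast
qed

section \<open>Highest weight vectors of the Fock module and of the kernel\<close>

lemma diag_const:
  assumes "v \<in> fspan W B" "\<And>w. w \<in> W \<Longrightarrow> f w = c"
  shows "diag f 0 v = scaleF c v"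
proof -
  have "fspan W B \<subseteq> {v. diag f 0 v = scaleF c v}"
    by (intro fspan_subset linop_subspace_eq linop_diag linop_scaleF linop_id) (simp add: diag_bvec assms(2))
  then show ?thesis using assms(1) by auto
qed

lemma A1_0_fock_sum:
  assumes "v \<in> fock_sum \<alpha> \<beta>"
  shows "A1 hb 0 v = scaleF (- \<alpha>) v"
proof -
  have "A1 hb 0 v = diag (\<lambda>w. zero_mode Ba1 w + zero_mode Ba2 w) 0 v"
    by (rule linop_eqI[OF linop_A1 linop_diag]) (auto simp: A1_def osc_0_bvec diag_bvec fock.scale_left_distrib)
  also have "\<dots> = scaleF (- \<alpha>) v"
    by (rule diag_const[OF assms[unfolded fock_sum_eq]]) (use fwts_sum in auto)
  finally show ?thesis .
qed

lemma Km_C1_fock_sum: "v \<in> fock_sum \<alpha> \<beta> \<Longrightarrow> fock_act hb (Km C1) v = scaleF (qpow hb \<alpha>) v"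
  unfolding Km_eq fock_sum_eq using fwts_sum by (auto intro!: diag_const)

lemma A2_0_vac: "A2 hb 0 (vac (l1, l2, l3)) = scaleF (l1 - l2) (vac (l1, l2, l3))"
  by (simp add: A2_def osc_0_eq diag_vac fock.scale_left_diff_distrib)

lemma vac_fock_sum: "vac (\<beta> - \<alpha>, - \<beta>, \<alpha>) \<in> fock_sum \<alpha> \<beta>"
  unfolding fock_sum_eq vac_fspan orbit_iff by (rule exI[of _ 0]) simp

text \<open>The zero-mode powers -\<alpha> and \<alpha> cancel on this vacuum, so the exponentials
  start at z^0, while both modes ask for z^-1.\<close>

lemma X_plus_0_vac: "X_plus hb 0 (vac (\<beta> - \<alpha>, - \<beta>, \<alpha>)) = 0"
  and X_minus_1_vac: "X_minus hb 1 (vac (\<beta> - \<alpha>, - \<beta>, \<alpha>)) = 0"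
proof -
  have "cidx F (- 1) = 0" for F using cidx_of_int[of F "- 1"] by simp
  then show "X_plus hb 0 (vac (\<beta> - \<alpha>, - \<beta>, \<alpha>)) = 0" "X_minus hb 1 (vac (\<beta> - \<alpha>, - \<beta>, \<alpha>)) = 0"
    by (simp_all add: X_plus_def X_minus_def vop_vac)
qed

text \<open>h_0 and h_1 are scalars on all of \<open>fock_sum\<close> since l1 + l2 = -\<alpha>;
  only the eigenvalue of h_2 has to be supplied.\<close>

lemma hw_vectorI:
  assumes "act M = fock_act hb" "v \<in> car M" "v \<in> fock_sum \<alpha> \<beta>" "v \<noteq> 0"
    and "X_plus hb 0 v = 0" "X_minus hb 1 v = 0" "A2 hb 0 v = scaleF c v"
  shows "hw_vector M (1 + \<alpha>, - \<alpha>, c) v"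
proof -
  have "X_minus hb 1 (scaleF a v) = 0" for a
    using assms(6) by (simp add: X_minus_def linop_scale[OF linop_vop] flip: fock.scale_right_diff_distrib)
  then show ?thesis
    using assms Km_C1_fock_sum[OF assms(3), of hb] A1_0_fock_sum[OF assms(3), of hb]
    by (simp add: fock.scale_left_distrib del: fock_act.simps(8))
qed

context qgen
begin

lemma FockM_highest_weight:
  assumes generic: "\<And>n::int. qpow hb (2 * (\<alpha> + of_int n)) \<noteq> 1"
  shows "highest_weight_module (FockM hb \<alpha> \<beta>) (1 + \<alpha>, - \<alpha>, 2 * \<beta> - \<alpha>)"
proof -
  let ?v = "vac (\<beta> - \<alpha>, - \<beta>, \<alpha>)"
  have "hw_vector (FockM hb \<alpha> \<beta>) (1 + \<alpha>, - \<alpha>, 2 * \<beta> - \<alpha>) ?v"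
    by (rule hw_vectorI[of _ hb _ \<alpha> \<beta>])
      (simp_all add: FockM_def vac_fock_sum X_plus_0_vac X_minus_1_vac A2_0_vac)
  moreover have "S = car (FockM hb \<alpha> \<beta>)" if S: "submodule (FockM hb \<alpha> \<beta>) S" "?v \<in> S" for S
  proof -
    interpret stable_subspace hb \<alpha> \<beta> S
      using S by unfold_locales (auto simp: submodule_def FockM_def)
    show ?thesis using S_eq_fock_sum[OF generic S(2)] by (simp add: FockM_def)
  qed
  ultimately show ?thesis
    unfolding highest_weight_module_def using umodule_FockM by blast
qed

text \<open>By \<open>S_eq_kernel\<close> it suffices to reach the vacuum \<open>?w\<close> with l3
  = 0 from the highest weight vector. For \<alpha> \<ge> 0 this is a descent from l3 = \<alpha> by
  modes of \<xi> of nonzero index; for \<alpha> < 0 it is an ascent by modes of \<eta>.\<close>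

lemma KerM_highest_weight:
  assumes a: "\<alpha> \<in> \<int>"
  shows "highest_weight_module (KerM hb \<alpha> \<beta>)
    (1 + \<alpha>, - \<alpha>, if \<alpha> \<in> \<nat> then 2 * \<beta> - \<alpha> else 2 * \<beta> - \<alpha> + 2)"
proof -
  let ?M = "KerM hb \<alpha> \<beta>" and ?w = "vac (\<beta> - 2 * \<alpha>, \<alpha> - \<beta>, 0)"
  let ?c = "if \<alpha> \<in> \<nat> then 2 * \<beta> - \<alpha> else 2 * \<beta> - \<alpha> + 2"
  obtain a0 where a0: "\<alpha> = of_int a0" using a by (auto simp: Ints_def)
  have act: "act ?M = fock_act hb" by (simp add: KerM_def)
  have stable: "stable_subspace hb \<alpha> \<beta> S" if "submodule ?M S" for S
    using that by unfold_locales (auto simp: submodule_def act car_KerM[OF a])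
  have gen: "S = car ?M" if S: "submodule ?M S" "?w \<in> S" for S
  proof -
    interpret stable_subspace hb \<alpha> \<beta> S by (rule stable[OF S(1)])
    have "eta hb 0 u = 0" if "u \<in> S" for u using S(1) that by (auto simp: submodule_def car_KerM[OF a])
    from S_eq_kernel[OF a this S(2)] show ?thesis by (simp add: car_KerM[OF a])
  qed
  have pure: "vac (\<beta> - 2 * \<alpha> + of_int i, \<alpha> - \<beta> - of_int i, of_int i) \<in> pure_c \<alpha> \<beta>" for i
    unfolding vac_fspan orbit_iff by (rule exI[of _ "i - a0"]) (simp add: a0)
  have "\<exists>v. hw_vector ?M (1 + \<alpha>, - \<alpha>, ?c) v \<and> (\<forall>S. submodule ?M S \<and> v \<in> S \<longrightarrow> ?w \<in> S)"
  proof (cases "\<alpha> \<in> \<nat>")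
    case True
    then obtain k where k: "\<alpha> = of_nat k" by (auto elim: Nats_cases)
    let ?v = "vac (\<beta> - \<alpha>, - \<beta>, \<alpha>)"
    have "- 1 - \<alpha> = of_int (- 1 - int k)" by (simp add: k)
    then have "cidx F (- 1 - \<alpha>) = 0" for F by (simp only: cidx_of_int) simp
    then have "eta hb 0 ?v = 0" by (simp add: eta_0 vop_vac)
    then have "hw_vector ?M (1 + \<alpha>, - \<alpha>, ?c) ?v"
      using True by (intro hw_vectorI[of _ hb _ \<alpha> \<beta>])
        (simp_all add: act car_KerM[OF a] vac_fock_sum X_plus_0_vac X_minus_1_vac A2_0_vac)
    moreover have "?w \<in> S" if S: "submodule ?M S" "?v \<in> S" for S
    proof -
      interpret stable_subspace hb \<alpha> \<beta> S by (rule stable[OF S(1)])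
      let ?u = "\<lambda>i::int. vac (\<beta> - 2 * \<alpha> + of_int i, \<alpha> - \<beta> - of_int i, of_int i)"
      have "j \<le> k \<Longrightarrow> ?u (int (k - j)) \<in> S" for j
      proof (induction j)
        case 0
        then show ?case using S(2) by (simp add: k)
      next
        case (Suc j)
        define i where "i = int (k - j)"
        have i: "i \<noteq> 0" "int (k - Suc j) = i - 1" using Suc.prems by (auto simp: i_def)
        have "?u i \<in> Sc" using Suc pure[of i] by (simp add: i_def)
        then have "xh hb (of_int (- i)) (?u i) \<in> Sc"
          using i(1) qint_int_neq_0[of "- i"] by (intro S_xh) auto
        moreover have "xh hb (of_int (- i)) (?u i) = ?u (i - 1)"
          by (simp add: xh_vac cser_def algebra_simps)
        ultimately show ?case by (simp add: i(2))
      qed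
      from this[of k] show ?thesis by simp
    qed
    ultimately show ?thesis by blast
  next
    case False
    define k where "k = nat (- a0)"
    have neg: "a0 < 0"
    proof (rule ccontr)
      assume "\<not> a0 < 0"
      then have "\<alpha> = of_nat (nat a0)" by (simp add: a0)
      then show False using False by simp
    qed
    then have k: "\<alpha> = - of_nat k" "k \<ge> 1" by (auto simp: k_def a0)
    \<comment> \<open>The vacuum of \<open>fock_sum\<close> \<alpha> \<beta> is not in the kernel
      here. Its substitute is the \<eta>_0-image of the vacuum for \<beta> + 1, which raises the
      h_2-weight by 2.\<close>
    let ?u = "vac (\<beta> + 1 - \<alpha>, - (\<beta> + 1), \<alpha>)"
    let ?v = "eta hb 0 ?u"
    note u = vac_fock_sum[of "\<beta> + 1" \<alpha>]
    have v: "?v \<in> fock_sum \<alpha> \<beta>" using eta_0_fock_sum[OF u] by simp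
    have v_eh: "?v = eh hb (- 1) (vac (\<beta> - \<alpha>, - \<beta>, \<alpha>))"
      by (simp add: eta_0 vop_vac eh_vac algebra_simps minus_diff_commute)
    \<comment> \<open>\<xi>_0 kills \<open>?u\<close> as \<alpha> < 0, so \<xi>_0 \<eta>_0 fixes
      \<open>?u\<close>; this is what makes \<open>?v\<close> nonzero.\<close>
    have "xi hb 0 ?u = 0" using False by (simp add: xi_0 vop_vac cidx_not_Nats)
    then have "xi hb 0 ?v = ?u" using eta_xi[OF a u] by (simp add: linop_zero[OF linop_eta])
    then have "?v \<noteq> 0" using linop_zero[OF linop_xi] by (metis vac_neq_0)
    moreover have "X_plus hb 0 ?v = 0"
      using eta_0_act[OF a u, of "Xp 0"] X_plus_0_vac[where \<beta> = "\<beta> + 1" and \<alpha> = \<alpha>]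
      by (simp add: par_def linop_zero[OF linop_eta])
    moreover have "X_minus hb 1 ?v = 0"
      using eta_0_act[OF a u, of "Xm 1"] X_minus_1_vac[where \<beta> = "\<beta> + 1" and \<alpha> = \<alpha>]
      by (simp add: par_def linop_zero[OF linop_eta])
    moreover have "A2 hb 0 ?v = scaleF ?c ?v"
    proof -
      have c: "\<beta> + 1 - \<alpha> - - (\<beta> + 1) = ?c" using False by simp
      have "A2 hb 0 ?v = eta hb 0 (A2 hb 0 ?u)"
        using eta_0_act[OF a u, of "H2 0"] by (simp add: par_def)
      also have "\<dots> = scaleF ?c ?v" unfolding A2_0_vac c by (rule linop_scale[OF linop_eta])
      finally show ?thesis .
    qed
    ultimately have "hw_vector ?M (1 + \<alpha>, - \<alpha>, ?c) ?v"
      using v eta_0_eta_0[OF u] by (intro hw_vectorI[of _ hb _ \<alpha> \<beta>]) (simp_all add: act car_KerM[OF a])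
    moreover have "?w \<in> S" if S: "submodule ?M S" "?v \<in> S" for S
    proof -
      interpret stable_subspace hb \<alpha> \<beta> S by (rule stable[OF S(1)])
      let ?y = "\<lambda>i::int. vac (\<beta> - 2 * \<alpha> + of_int i, \<alpha> - \<beta> - of_int i, of_int i)"
      have eh_y: "eh hb (of_int i) (?y i) = ?y (i + 1)" for i
        by (simp add: eh_vac cser_def algebra_simps)
      \<comment> \<open>The outer \<open>eh hb (- 1)\<close> is carried along by anticommutation
        while the vacuum climbs; at l3 = -1 it is itself the climbing mode and yields
        \<open>?w\<close>.\<close>
      have "eh hb (- 1) (?y (- int (Suc j))) \<in> S \<Longrightarrow> ?w \<in> S" for j
      proof (induction j)
        case 0
        then show ?case using eh_y[of "- 1"] by simp
      next
        case (Suc j)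
        let ?i = "- int (Suc (Suc j))"
        have "eh hb (- 1) (?y ?i) \<in> Sc" using Suc.prems eh_pure_c[OF pure] by blast
        then have "eh hb (of_int ?i) (eh hb (- 1) (?y ?i)) \<in> S" using S_eh by blast
        moreover have "eh hb (of_int ?i) (eh hb (- 1) (?y ?i)) = - eh hb (- 1) (?y (- int (Suc j)))"
          unfolding eh_eh[OF pure, of "of_int ?i" "- 1"] eh_y by simp
        ultimately have "eh hb (- 1) (?y (- int (Suc j))) \<in> S"
          using fock.subspace_neg[OF subS] by fastforce
        then show ?case by (rule Suc.IH)
      qed
      moreover have "?y (- int (Suc (k - 1))) = vac (\<beta> - \<alpha>, - \<beta>, \<alpha>)"
        using k(2) by (simp add: k(1) of_nat_diff algebra_simps)
      ultimately show ?thesis using S(2) unfolding v_eh by metis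
    qed
    ultimately show ?thesis by blast
  qed
  then show ?thesis
    unfolding highest_weight_module_def using umodule_KerM[OF a] gen by blast
qed

end

text \<open>\<open>generic\<close> keeps every [p]_q with p in \<alpha> + Z away from 0. This is not
  automatic, since q^(2p) = 1 can hold for nonintegral complex p.\<close>

theorem theorem2:
  fixes hb \<alpha> \<beta> :: complex
  assumes not_root_of_unity: "\<And>n::nat. n > 0 \<Longrightarrow> qpow hb 1 ^ n \<noteq> 1"
    and generic: "\<And>n::int. \<alpha> \<notin> \<int> \<Longrightarrow> qpow hb (2 * (\<alpha> + of_int n)) \<noteq> 1"
  shows
    "(\<alpha> \<in> \<int> \<longrightarrow>
        highest_weight_module (KerM hb \<alpha> (\<beta> + 3/2 * \<alpha>)) (lam_weight \<alpha> \<beta>) \<and>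
        highest_weight_module (CokerM hb \<alpha> (\<beta> + 3/2 * \<alpha> + 1)) (lam_weight \<alpha> \<beta>) \<and>
        KerM hb \<alpha> (\<beta> + 3/2 * \<alpha>) \<cong>\<^sub>U CokerM hb \<alpha> (\<beta> + 3/2 * \<alpha> + 1)) \<and>
     (\<alpha> \<notin> \<int> \<longrightarrow>
        highest_weight_module (FockM hb \<alpha> (\<beta> + 3/2 * \<alpha>)) (lam_weight \<alpha> \<beta>)) \<and>
     (\<alpha> \<in> \<int> \<longrightarrow>
        decomposes (FockM hb \<alpha> (\<beta> + 3/2 * \<alpha>))
          (KerM hb \<alpha> (\<beta> + 3/2 * \<alpha>)) (CokerM hb \<alpha> (\<beta> + 3/2 * \<alpha>)) \<and>
        (\<forall>x\<in>- range Xp. \<forall>v\<in>car (CokerM hb \<alpha> (\<beta> + 3/2 * \<alpha>)).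
           act (CokerM hb \<alpha> (\<beta> + 3/2 * \<alpha>)) x v = act (FockM hb \<alpha> (\<beta> + 3/2 * \<alpha>)) x v) \<and>
        highest_weight_module (KerM hb \<alpha> (\<beta> + 3/2 * \<alpha>)) (lam_weight \<alpha> \<beta>) \<and>
        highest_weight_module (CokerM hb \<alpha> (\<beta> + 3/2 * \<alpha>)) (lam_weight \<alpha> (\<beta> - 1)) \<and>
        CokerM hb \<alpha> (\<beta> + 3/2 * \<alpha>) \<cong>\<^sub>U KerM hb \<alpha> ((\<beta> - 1) + 3/2 * \<alpha>))"
proof -
  interpret qgen hb using not_root_of_unity by unfold_locales
  have lam: "lam_weight \<alpha> b = (1 + \<alpha>, - \<alpha>, if \<alpha> \<in> \<nat> then 2 * (b + 3/2 * \<alpha>) - \<alpha> else 2 * (b + 3/2 * \<alpha>) - \<alpha> + 2)"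
    if "\<alpha> \<in> \<int>" for b
    using that by (simp add: lam_weight_def)
  have Ker: "highest_weight_module (KerM hb \<alpha> (b + 3/2 * \<alpha>)) (lam_weight \<alpha> b)" if "\<alpha> \<in> \<int>" for b
    using KerM_highest_weight[OF that, of "b + 3/2 * \<alpha>"] by (simp only: lam[OF that])
  have iso: "CokerM hb \<alpha> (b + 1 + 3/2 * \<alpha>) \<cong>\<^sub>U KerM hb \<alpha> (b + 3/2 * \<alpha>)" if "\<alpha> \<in> \<int>" for b
    using CokerM_iso_KerM[OF that, of "b + 1 + 3/2 * \<alpha>"] by simp
  have Coker: "highest_weight_module (CokerM hb \<alpha> (b + 1 + 3/2 * \<alpha>)) (lam_weight \<alpha> b)" if "\<alpha> \<in> \<int>" for b
    by (rule highest_weight_module_iso[OF umodule_CokerM[OF that] iso[OF that] Ker[OF that]])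
  have Fock: "highest_weight_module (FockM hb \<alpha> (\<beta> + 3/2 * \<alpha>)) (lam_weight \<alpha> \<beta>)" if "\<alpha> \<notin> \<int>"
    using FockM_highest_weight[OF generic[OF that], of "\<beta> + 3/2 * \<alpha>"] that
    by (simp add: lam_weight_def add.commute)
  have b: "\<beta> + 3 * \<alpha> / 2 + 1 = \<beta> + 1 + 3 * \<alpha> / 2" by simp
  show ?thesis
    using Ker[of \<beta>] Coker[of \<beta>] Coker[of "\<beta> - 1"] iso[of \<beta>] iso[of "\<beta> - 1"] Fock
      module_iso_sym[OF umodule_CokerM iso] FockM_decomposes[of \<alpha>] CokerM_act_eq[of \<alpha>]
    by (simp add: b)
qed

end
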